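(* For each $d\in\mathbb{N}$ there exists a positive constant $C_d$, depending only on $d$, such that for each $t\in\mathbb{N}$ and each integer $N\ge C_d t^d$ there exists a spherical $t$-design in $S^d$ consisting of $N$ points.
   Context: $\mathbb{N}$ denotes the positive integers. $S^d$ is the unit sphere in $\mathbb{R}^{d+1}$, with the Lebesgue measure $\mu_d$ normalized by $\mu_d(S^d)=1$. A set of points $x_1,\ldots,x_N\in S^d$ is called a spherical $t$-design if $$\int_{S^d}P(x)\,d\mu_d(x)=\frac1N\sum_{i=1}^N P(x_i)$$ for all (real) algebraic polynomials $P$ in $d+1$ variables of total degree at most $t$. *)

theory Defs
  imports "HOL-Analysis.Analysis"
begin

text \<open>
  The normalized Lebesgue measure on the unit sphere, via the cone construction: the measure
  of a Borel set \<open>A\<close> of the sphere is the proportion of the unit ball occupied by the cone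
  \<open>{r x | 0 < r \<le> 1, x \<in> A}\<close>; see \<open>emeasure_sphere_lebesgue\<close>. The origin is removed
  from the ball because \<open>sgn x = x /\<^sub>R norm x\<close> does not map it to the sphere.
\<close>

definition punctured_ball :: "'a::euclidean_space set" where
  "punctured_ball = cball 0 1 - {0}"

definition sphere_lebesgue :: "'a::euclidean_space measure" where
  "sphere_lebesgue =
     distr (uniform_measure (restrict_space lborel punctured_ball) punctured_ball)
           (restrict_space borel (sphere 0 1)) sgn"

text \<open>
  Real polynomial functions in the coordinates of \<open>x\<close>, of total degree at most \<open>t\<close>; the
  exponent vector \<open>a\<close> stands for the monomial \<open>\<Prod>i. x $ i ^ a i\<close>, and \<open>c\<close> lists the coefficients.
\<close>

definition polynomial_of_degree_le :: "nat \<Rightarrow> (real ^ 'n::finite \<Rightarrow> real) \<Rightarrow> bool" where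
  "polynomial_of_degree_le t P \<longleftrightarrow>
     (\<exists>c :: ('n \<Rightarrow> nat) \<Rightarrow> real.
        P = (\<lambda>x. \<Sum>a | (\<Sum>i\<in>UNIV. a i) \<le> t. c a * (\<Prod>i\<in>UNIV. x $ i ^ a i)))"

definition spherical_design :: "nat \<Rightarrow> (real ^ 'n::finite) set \<Rightarrow> bool" where
  "spherical_design t X \<longleftrightarrow>
     finite X \<and> X \<noteq> {} \<and> X \<subseteq> sphere 0 1 \<and>
     (\<forall>P. polynomial_of_degree_le t P \<longrightarrow>
        (\<integral>x. P x \<partial>sphere_lebesgue) = (\<Sum>x\<in>X. P x) / real (card X))"

lemma finite_exponents_le: "finite {a :: 'n::finite \<Rightarrow> nat. (\<Sum>i\<in>UNIV. a i) \<le> t}"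
proof (rule finite_subset)
  show "{a :: 'n \<Rightarrow> nat. (\<Sum>i\<in>UNIV. a i) \<le> t} \<subseteq> UNIV \<rightarrow>\<^sub>E {..t}"
  proof
    fix a :: "'n \<Rightarrow> nat" assume "a \<in> {a. (\<Sum>i\<in>UNIV. a i) \<le> t}"
    moreover have "a i \<le> (\<Sum>i\<in>UNIV. a i)" for i by (rule member_le_sum) auto
    ultimately have "a i \<le> t" for i using order_trans by blast
    then show "a \<in> UNIV \<rightarrow>\<^sub>E {..t}" by (simp add: PiE_iff)
  qed
qed (simp add: finite_PiE)

lemma punctured_ball_sets [measurable]: "punctured_ball \<in> sets borel"
  unfolding punctured_ball_def by measurable

lemma emeasure_punctured_ball:
  "emeasure lborel (punctured_ball :: 'a set) = emeasure lborel (cball 0 1 :: 'a::euclidean_space set)"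
  unfolding punctured_ball_def by (rule emeasure_Diff_null_set) auto

lemma sgn_measurable_punctured_ball:
  "sgn \<in> measurable (uniform_measure (restrict_space lborel punctured_ball) punctured_ball)
     (restrict_space borel (sphere (0 :: 'a::euclidean_space) 1))"
proof -
  have "sgn \<in> borel_measurable (restrict_space (lborel :: 'a measure) punctured_ball)"
    by (intro measurable_restrict_space1) (simp add: sgn_div_norm[abs_def])
  then show ?thesis
    by (auto simp: measurable_restrict_space2_iff space_restrict_space punctured_ball_def norm_sgn
        cong: measurable_cong_sets)
qed

lemma space_sphere_lebesgue [simp]: "space sphere_lebesgue = sphere 0 1"
  by (simp add: sphere_lebesgue_def space_restrict_space)

lemma sets_sphere_lebesgue [simp]:
  "sets sphere_lebesgue = sets (restrict_space borel (sphere 0 1))"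
  by (simp add: sphere_lebesgue_def)

lemma emeasure_sphere_lebesgue:
  fixes A :: "'a::euclidean_space set"
  assumes "A \<in> sets borel" "A \<subseteq> sphere 0 1"
  shows "emeasure sphere_lebesgue A =
    emeasure lborel {r *\<^sub>R x | r x. 0 < r \<and> r \<le> 1 \<and> x \<in> A} / emeasure lborel (cball 0 1 :: 'a set)"
proof -
  let ?U = "uniform_measure (restrict_space lborel punctured_ball) (punctured_ball :: 'a set)"
  let ?B = "punctured_ball :: 'a set"
  have A: "A \<in> sets (restrict_space borel (sphere 0 1))"
    using assms by (auto simp: sets_restrict_space_iff)
  have cone: "sgn -` A \<inter> ?B = {r *\<^sub>R x | r x. 0 < r \<and> r \<le> 1 \<and> x \<in> A}"
  proof (intro equalityI subsetI)
    fix y assume y: "y \<in> sgn -` A \<inter> ?B"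
    have "y = norm y *\<^sub>R sgn y" by (cases "y = 0") (simp_all add: sgn_div_norm)
    with y show "y \<in> {r *\<^sub>R x | r x. 0 < r \<and> r \<le> 1 \<and> x \<in> A}"
      unfolding punctured_ball_def by (intro CollectI exI[of _ "norm y"] exI[of _ "sgn y"]) auto
  next
    fix y assume "y \<in> {r *\<^sub>R x | r x. 0 < r \<and> r \<le> 1 \<and> x \<in> A}"
    then obtain r x where rx: "y = r *\<^sub>R x" "0 < r" "r \<le> 1" "x \<in> A" by auto
    then have "norm x = 1" using assms by auto
    with rx have "norm y = r" by simp
    moreover have "sgn y = x" using rx \<open>norm x = 1\<close> by (simp add: sgn_scaleR, simp add: sgn_div_norm)
    ultimately have "sgn y = x" "norm y = r" by blast+
    with rx show "y \<in> sgn -` A \<inter> ?B" by (auto simp: punctured_ball_def)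
  qed
  have meas: "sgn -` A \<inter> ?B \<in> sets (restrict_space lborel ?B)"
    using measurable_sets[OF sgn_measurable_punctured_ball A]
    by (simp add: space_restrict_space)
  have "emeasure sphere_lebesgue A = emeasure ?U (sgn -` A \<inter> ?B)"
    unfolding sphere_lebesgue_def
    by (subst emeasure_distr[OF sgn_measurable_punctured_ball A]) (simp add: space_restrict_space)
  also have "\<dots> = emeasure (restrict_space lborel ?B) (?B \<inter> (sgn -` A \<inter> ?B))
      / emeasure (restrict_space lborel ?B) ?B"
    by (intro emeasure_uniform_measure meas) (simp add: sets_restrict_space_iff)
  also have "\<dots> = emeasure lborel (sgn -` A \<inter> ?B) / emeasure lborel ?B"
    by (subst (1 2) emeasure_restrict_space) (auto simp: Int_commute)
  finally show ?thesis by (simp add: cone emeasure_punctured_ball)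
qed

lemma emeasure_sphere_lebesgue_space:
  "emeasure sphere_lebesgue (sphere (0 :: 'a::euclidean_space) 1) = 1"
proof -
  have cone: "{r *\<^sub>R x | r x. 0 < r \<and> r \<le> 1 \<and> x \<in> sphere (0 :: 'a) 1} = punctured_ball"
  proof (intro equalityI subsetI)
    fix y :: 'a assume "y \<in> punctured_ball"
    moreover have "y = norm y *\<^sub>R sgn y" by (cases "y = 0") (simp_all add: sgn_div_norm)
    ultimately show "y \<in> {r *\<^sub>R x | r x. 0 < r \<and> r \<le> 1 \<and> x \<in> sphere (0 :: 'a) 1}"
      unfolding punctured_ball_def
      by (intro CollectI exI[of _ "norm y"] exI[of _ "sgn y"]) (auto simp: norm_sgn)
  qed (auto simp: punctured_ball_def)
  have "emeasure lborel (cball (0 :: 'a) 1) \<noteq> 0"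
    using content_cball_pos[of 1 "0 :: 'a"] by (auto simp: measure_def)
  moreover have "emeasure lborel (cball (0 :: 'a) 1) < top"
    by (metis emeasure_lborel_cball_finite infinity_ennreal_def)
  ultimately have "emeasure lborel (punctured_ball :: 'a set) / emeasure lborel (cball (0 :: 'a) 1) = 1"
    unfolding emeasure_punctured_ball by (rule ennreal_divide_self)
  then show ?thesis
    using emeasure_sphere_lebesgue[of "sphere (0 :: 'a) 1"] cone by simp
qed

end

theory Submission
  imports Defs "HOL-Homology.Brouwer_Degree"
begin

text \<open>
  The proof follows Bondarenko, Radchenko and Viazovska, with elementary substitutes for their
  analytic tools. Start from \<open>N\<close> points that are equidistributed at a scale \<open>\<delta> = c / t\<close>. For a
  mean zero polynomial \<open>P\<close> of degree at most \<open>t\<close>, normalized such that the \<open>L\<^sup>1\<close> norm of its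
  derivatives along the coordinate plane rotations is \<open>1\<close>, move all points by a distance of order
  \<open>s = c' / t\<close>, with \<open>\<delta>\<close> much smaller than \<open>s\<close>, in a direction in which \<open>P\<close> increases. The
  quadrature error of the initial points is of order \<open>\<delta>\<close> while the move gains a multiple of \<open>s\<close>,
  so the sum of \<open>P\<close> over the moved points is positive. Hence the vector of these sums,
  as a function of \<open>P\<close>, points outward on the boundary of a star-shaped body and therefore vanishes
  somewhere, and the points moved according to such a \<open>P\<close> form a design. The direction field is
  Lipschitz with constant of order \<open>t\<close>, so the motion is injective and the points stay distinct.

  All error terms are controlled by one estimate: on balls of radius \<open>c / t\<close> the oscillation of a
  polynomial of degree at most \<open>t\<close> is dominated by a function whose integral is a small multiple of
  its \<open>L\<^sup>1\<close> norm. It reduces to trigonometric polynomials in one variable by joining nearby points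
  of the sphere by a fixed sequence of plane rotations.
\<close>


section \<open>Trigonometric polynomials\<close>

text \<open>The number of points may be as small as a constant times \<open>t ^ d\<close>, so every
  error must be a small fraction of an integral norm, uniformly in \<open>t\<close>. Maxima of
  derivatives would cost powers of \<open>t\<close>. Dominating functions do not: degree and radius
  enter them only through their product. This is why estimates compare everything with values at one
  point \<open>y\<close>, which is finally integrated over the sphere. Plane rotations take the
  place of gradients because a polynomial restricted to a rotation orbit is a trigonometric
  polynomial of the same degree, and because they preserve the measure. The best direction of motion
  is the sign of each derivative. The sign is discontinuous, whereas the topological argument needs
  continuity in \<open>P\<close> and distinctness of the moved points needs a Lipschitz bound in
  \<open>x\<close>. Clipping gives the former, regularization the latter, each at a cost that the
  gain absorbs. The star-shaped body lives in the space of coefficients with respect to a basis of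
  the mean zero polynomials as functions on the sphere; without independence there, the norm of the
  derivatives would vanish at nonzero coefficients. If no zero existed, a sphere would be
  contractible.\<close>

lemma sum_cis_roots_of_unity:
  fixes m :: int and M :: nat
  assumes "\<bar>m\<bar> < int M"
  shows "(\<Sum>j<M. cis (of_int m * (2 * pi * real j / real M))) = (if m = 0 then of_nat M else 0)"
proof (cases "m = 0")
  case False
  define z where "z = cis (of_int m * (2 * pi / real M))"
  have M: "M > 0" using assms by linarith
  have zj: "cis (of_int m * (2 * pi * real j / real M)) = z ^ j" for j
    unfolding z_def Complex.DeMoivre by (rule arg_cong[of _ _ cis]) (simp add: field_simps)
  have "z ^ M = cis (2 * pi * of_int m)" unfolding z_def Complex.DeMoivre using M by (intro arg_cong[of _ _ cis]) (simp add: field_simps)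
  also have "\<dots> = 1" by (rule cis_multiple_2pi) simp
  finally have zM: "z ^ M = 1" .
  have "z \<noteq> 1"
  proof
    assume "z = 1"
    then obtain x :: int where "of_int m * (2 * pi / real M) = 2 * pi * of_int x"
      by (auto simp: z_def complex_eq_iff cos_one_2pi_int mult_ac)
    then have "of_int m = real M * of_int x" using M by (simp add: field_simps)
    then have "m = int M * x" by (metis of_int_eq_iff of_int_mult of_int_of_nat_eq)
    then have "\<bar>m\<bar> = int M * \<bar>x\<bar>" by (simp add: abs_mult)
    moreover have "\<bar>x\<bar> \<ge> 1" using False \<open>m = int M * x\<close> by (cases "x = 0") auto
    ultimately have "\<bar>m\<bar> \<ge> int M" by (simp add: mult_le_cancel_left1)
    then show False using assms by simp
  qed
  then have "(\<Sum>j<M. z ^ j) = 0" using zM by (simp add: geometric_sum)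
  then show ?thesis using False unfolding zj by simp
qed simp

text \<open>The count of pairs with \<open>b - a = m\<close> is the Fourier coefficient at
  \<open>m\<close> of the squared Dirichlet sum, that is, of \<open>t\<close> times the Fejer
  kernel.\<close>

lemma sum_sum_indicator_diff:
  fixes m :: int
  shows "(\<Sum>a<t. \<Sum>b<t. if int a - int b + m = 0 then 1 else 0 :: complex) = of_nat (nat (int t - \<bar>m\<bar>))"
proof -
  have inner: "(\<Sum>b<t. if int a - int b + m = 0 then 1 else 0 :: complex) =
      (if 0 \<le> int a + m \<and> int a + m < int t then 1 else 0)" for a
  proof -
    have "(\<Sum>b<t. if int a - int b + m = 0 then 1 else 0 :: complex)
       = of_nat (card {b\<in>{..<t}. int a - int b + m = 0})"
      by (simp add: sum.If_cases Int_def)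
    also have "{b\<in>{..<t}. int a - int b + m = 0} = (if 0 \<le> int a + m \<and> int a + m < int t then {nat (int a + m)} else {})"
      by auto
    finally show ?thesis by simp
  qed
  have "(\<Sum>a<t. \<Sum>b<t. if int a - int b + m = 0 then 1 else 0 :: complex) =
      of_nat (card {a\<in>{..<t}. 0 \<le> int a + m \<and> int a + m < int t})"
    by (simp add: inner sum.If_cases Int_def)
  also have "{a\<in>{..<t}. 0 \<le> int a + m \<and> int a + m < int t} = {nat (- m)..<nat (min (int t) (int t - m))}"
    by auto
  also have "card \<dots> = nat (int t - \<bar>m\<bar>)" by simp
  finally show ?thesis .
qed

text \<open>Sampling \<open>2 t sin (t u)\<close> times the Fejer kernel at \<open>3 t\<close> equidistant points gives weights that
  differentiate every trigonometric polynomial of degree at most \<open>t\<close>; as the Fejer kernel is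
  nonnegative, their total mass is at most \<open>2 t\<close>.\<close>

lemma ex_differentiation_weights:
  fixes t :: nat
  assumes "t \<ge> 1"
  defines "u \<equiv> \<lambda>j. 2 * pi * real j / real (3 * t)"
  shows "\<exists>w :: nat \<Rightarrow> real. (\<Sum>j<3*t. \<bar>w j\<bar>) \<le> 2 * real t \<and>
     (\<forall>k::int. \<bar>k\<bar> \<le> int t \<longrightarrow> (\<Sum>j<3*t. of_real (w j) * cis (of_int k * u j)) = \<i> * of_int k)"
proof -
  define F where "F j = (cmod (\<Sum>a<t. cis (real a * u j)))\<^sup>2" for j
  define w where "w j = 2 / real (3 * t) * sin (real t * u j) * F j" for j
  have t: "real t > 0" using assms by simp
  have F: "of_real (F j) = (\<Sum>a<t. \<Sum>b<t. cis (of_int (int a - int b) * u j))" for j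
  proof -
    have "of_real (F j) = (\<Sum>a<t. cis (real a * u j)) * cnj (\<Sum>a<t. cis (real a * u j))"
      unfolding F_def using complex_norm_square[of "\<Sum>a<t. cis (real a * u j)"] by simp
    also have "\<dots> = (\<Sum>a<t. \<Sum>b<t. cis (real a * u j) * cis (- (real b * u j)))"
      by (simp add: sum_product cis_cnj cnj_sum)
    also have "\<dots> = (\<Sum>a<t. \<Sum>b<t. cis (of_int (int a - int b) * u j))"
      by (simp add: cis_mult algebra_simps)
    finally show ?thesis .
  qed
  define N where "N m = (\<Sum>j<3*t. of_real (F j) * cis (of_int m * u j))" for m :: int
  \<comment> \<open>The range of \<open>m\<close> covers the shifts \<open>k + t\<close> and
    \<open>k - t\<close>. Since \<open>\<bar>a - b\<bar> < t\<close>, all frequencies stay below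
    \<open>3 * t\<close>, so that this many nodes suffice to avoid aliasing.\<close>
  have N: "N m = of_nat (3 * t) * of_nat (nat (int t - \<bar>m\<bar>))" if "\<bar>m\<bar> \<le> 2 * int t" for m
  proof -
    have "N m = (\<Sum>j<3*t. \<Sum>a<t. \<Sum>b<t. cis (of_int (int a - int b + m) * u j))"
      unfolding N_def F sum_distrib_right by (simp add: cis_mult algebra_simps)
    also have "\<dots> = (\<Sum>a<t. \<Sum>j<3*t. \<Sum>b<t. cis (of_int (int a - int b + m) * u j))"
      by (rule sum.swap)
    also have "\<dots> = (\<Sum>a<t. \<Sum>b<t. \<Sum>j<3*t. cis (of_int (int a - int b + m) * u j))"
      by (intro sum.cong refl sum.swap)
    also have "\<dots> = (\<Sum>a<t. \<Sum>b<t. of_nat (3 * t) * (if int a - int b + m = 0 then 1 else 0))"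
    proof (intro sum.cong refl)
      fix a b assume "a \<in> {..<t}" "b \<in> {..<t}"
      then have "\<bar>int a - int b + m\<bar> < int (3 * t)" using that by auto
      from sum_cis_roots_of_unity[OF this] show
        "(\<Sum>j<3*t. cis (of_int (int a - int b + m) * u j)) = of_nat (3 * t) * (if int a - int b + m = 0 then 1 else 0)"
        unfolding u_def by simp
    qed
    also have "\<dots> = of_nat (3 * t) * of_nat (nat (int t - \<bar>m\<bar>))"
      by (simp only: sum_distrib_left[symmetric] sum_sum_indicator_diff)
    finally show ?thesis .
  qed
  have "(\<Sum>j<3*t. \<bar>w j\<bar>) \<le> (\<Sum>j<3*t. 2 / real (3 * t) * F j)"
  proof (intro sum_mono)
    fix j
    have "\<bar>w j\<bar> = 2 / real (3 * t) * F j * \<bar>sin (real t * u j)\<bar>"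
      by (simp add: w_def abs_mult F_def)
    also have "\<dots> \<le> 2 / real (3 * t) * F j"
      by (intro mult_left_le) (auto simp: F_def)
    finally show "\<bar>w j\<bar> \<le> 2 / real (3 * t) * F j" .
  qed
  also have "\<dots> = 2 * real t"
  proof -
    have "complex_of_real (\<Sum>j<3*t. F j) = N 0" by (simp add: N_def)
    also have "\<dots> = of_real (real (3 * t) * real t)" by (subst N) auto
    finally have "(\<Sum>j<3*t. F j) = real (3 * t) * real t" by (simp only: of_real_eq_iff)
    then show ?thesis using t by (simp only: sum_distrib_left[symmetric]) (simp add: field_simps)
  qed
  finally have "(\<Sum>j<3*t. \<bar>w j\<bar>) \<le> 2 * real t" .
  moreover have "(\<Sum>j<3*t. of_real (w j) * cis (of_int k * u j)) = \<i> * of_int k" if k: "\<bar>k\<bar> \<le> int t" for k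
  proof -
    have s: "of_real (2 * sin (real t * u j)) = - \<i> * (cis (real t * u j) - cis (- (real t * u j)))" for j
      by (simp add: complex_eq_iff)
    have ident: "(- \<i> * (A - B)) / n * F * c = - \<i> / n * (F * (A * c) - F * (B * c))" for A B F n c :: complex
      by (simp add: right_diff_distrib left_diff_distrib diff_divide_distrib mult_ac)
    have "of_real (w j) * cis (of_int k * u j) = - \<i> / of_nat (3 * t) *
        (of_real (F j) * cis (of_int (k + int t) * u j) - of_real (F j) * cis (of_int (k - int t) * u j))" for j
    proof -
      have "of_real (w j) * cis (of_int k * u j)
        = of_real (2 * sin (real t * u j)) / of_nat (3 * t) * of_real (F j) * cis (of_int k * u j)"
        by (simp add: w_def)
      also have "\<dots> = - \<i> / of_nat (3 * t) * (of_real (F j) * (cis (real t * u j) * cis (of_int k * u j))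
         - of_real (F j) * (cis (- (real t * u j)) * cis (of_int k * u j)))"
        unfolding s by (rule ident)
      finally show ?thesis by (simp add: cis_mult algebra_simps)
    qed
    then have "(\<Sum>j<3*t. of_real (w j) * cis (of_int k * u j)) = - \<i> / of_nat (3 * t) * (N (k + int t) - N (k - int t))"
      unfolding N_def by (simp only: sum_subtractf[symmetric] sum_distrib_left)
    \<comment> \<open>Two triangles of half-width \<open>t\<close>, centred at \<open>-t\<close> and
      \<open>t\<close>: their difference is linear, equal to \<open>-k\<close>, exactly on
      \<open>\<bar>k\<bar> \<le> t\<close>.\<close>
    also have "\<dots> = - \<i> * (of_nat (nat (int t - \<bar>k + int t\<bar>)) - of_nat (nat (int t - \<bar>k - int t\<bar>)))"
      using t k by (subst (1 2) N) (auto simp: field_simps)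
    also have "\<dots> = - \<i> * of_int (- k)"
      using k by (cases "k \<ge> 0") (auto simp: of_nat_nat)
    finally show ?thesis by simp
  qed
  ultimately show ?thesis by blast
qed

text \<open>Convolution on the cyclic group of nodes multiplies the symbols of two weights, and
  their total masses at most multiply. All orders of differentiation thus use the same
  \<open>3 * t\<close> nodes, which later allows a Taylor series to be summed node by node.\<close>

lemma ex_higher_differentiation_weights:
  fixes t :: nat
  assumes "t \<ge> 1"
  defines "u \<equiv> \<lambda>j. 2 * pi * real j / real (3 * t)"
  shows "\<exists>w :: nat \<Rightarrow> real. (\<Sum>j<3*t. \<bar>w j\<bar>) \<le> (2 * real t) ^ n \<and>
     (\<forall>k::int. \<bar>k\<bar> \<le> int t \<longrightarrow> (\<Sum>j<3*t. of_real (w j) * cis (of_int k * u j)) = (\<i> * of_int k) ^ n)"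
proof (induction n)
  case 0
  show ?case
    using assms(1) by (intro exI[of _ "\<lambda>j. if j = 0 then 1 else 0"])
      (auto simp: if_distrib sum.If_cases if_distribR u_def cong: if_cong)
next
  case (Suc n)
  let ?M = "3 * t"
  have M: "?M > 0" using assms by simp
  obtain w where w: "(\<Sum>j<?M. \<bar>w j\<bar>) \<le> 2 * real t"
     "\<And>k. \<bar>k\<bar> \<le> int t \<Longrightarrow> (\<Sum>j<?M. of_real (w j) * cis (of_int k * u j)) = \<i> * of_int k"
    using ex_differentiation_weights[OF assms(1)] unfolding u_def by blast
  obtain v where v: "(\<Sum>j<?M. \<bar>v j\<bar>) \<le> (2 * real t) ^ n"
     "\<And>k. \<bar>k\<bar> \<le> int t \<Longrightarrow> (\<Sum>j<?M. of_real (v j) * cis (of_int k * u j)) = (\<i> * of_int k) ^ n"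
    using Suc.IH by blast
  \<comment> \<open>Cyclic convolution of the first-order weights with those of order
    \<open>n\<close>.\<close>
  define x where "x j = (\<Sum>(a, b) \<in> {p \<in> {..<?M} \<times> {..<?M}. (fst p + snd p) mod ?M = j}. w a * v b)" for j
  have group: "(\<Sum>j<?M. \<Sum>p \<in> {p \<in> {..<?M} \<times> {..<?M}. (fst p + snd p) mod ?M = j}. g p) = (\<Sum>p\<in>{..<?M} \<times> {..<?M}. g p)"
    for g :: "nat \<times> nat \<Rightarrow> 'b::comm_monoid_add"
    using M by (intro sum.group) auto
  have per: "cis (of_int k * u ((a + b) mod ?M)) = cis (of_int k * u a) * cis (of_int k * u b)" for k a b
  proof -
    define q where "q = (a + b) div ?M"
    have "a + b = ?M * q + (a + b) mod ?M" by (simp add: q_def)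
    then have "real a + real b = real ?M * real q + real ((a + b) mod ?M)"
      by (metis of_nat_add of_nat_mult)
    then have "2 * pi * (real a + real b) / real ?M = 2 * pi * (real ?M * real q + real ((a + b) mod ?M)) / real ?M"
      by (rule arg_cong)
    then have "u a + u b = 2 * pi * real q + u ((a + b) mod ?M)"
      using assms(1) unfolding u_def distrib_left add_divide_distrib by simp
    then have "cis (of_int k * u a) * cis (of_int k * u b) = cis (2 * pi * of_int (k * int q)) * cis (of_int k * u ((a + b) mod ?M))"
      unfolding cis_mult by (simp add: algebra_simps flip: distrib_left)
    also have "cis (2 * pi * of_int (k * int q)) = 1" by (rule cis_multiple_2pi) auto
    finally show ?thesis by simp
  qed
  have "(\<Sum>j<?M. \<bar>x j\<bar>) \<le> (\<Sum>j<?M. \<Sum>p \<in> {p \<in> {..<?M} \<times> {..<?M}. (fst p + snd p) mod ?M = j}. \<bar>w (fst p)\<bar> * \<bar>v (snd p)\<bar>)"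
    unfolding x_def by (intro sum_mono order.trans[OF sum_abs]) (auto simp: abs_mult case_prod_beta)
  also have "\<dots> = (\<Sum>j<?M. \<bar>w j\<bar>) * (\<Sum>j<?M. \<bar>v j\<bar>)"
    unfolding group by (simp add: sum_product sum.cartesian_product case_prod_beta)
  also have "\<dots> \<le> (2 * real t) * (2 * real t) ^ n" using w v by (intro mult_mono sum_nonneg) auto
  finally have 1: "(\<Sum>j<?M. \<bar>x j\<bar>) \<le> (2 * real t) ^ Suc n" by simp
  have 2: "(\<Sum>j<?M. of_real (x j) * cis (of_int k * u j)) = (\<i> * of_int k) ^ Suc n" if k: "\<bar>k\<bar> \<le> int t" for k
  proof -
    have "(\<Sum>j<?M. of_real (x j) * cis (of_int k * u j)) =
      (\<Sum>j<?M. \<Sum>p \<in> {p \<in> {..<?M} \<times> {..<?M}. (fst p + snd p) mod ?M = j}.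
        (of_real (w (fst p)) * cis (of_int k * u (fst p))) * (of_real (v (snd p)) * cis (of_int k * u (snd p))))"
      unfolding x_def of_real_sum sum_distrib_right
      by (intro sum.cong refl) (auto simp: per[symmetric] mult_ac)
    also have "\<dots> = (\<Sum>j<?M. of_real (w j) * cis (of_int k * u j)) * (\<Sum>j<?M. of_real (v j) * cis (of_int k * u j))"
      unfolding group by (simp add: sum_product sum.cartesian_product case_prod_beta)
    finally show ?thesis using w(2)[OF k] v(2)[OF k] by simp
  qed
  show ?case using 1 2 by blast
qed

section \<open>Trigonometric polynomials and their oscillation near a point\<close>

inductive trig_poly :: "nat \<Rightarrow> (real \<Rightarrow> complex) \<Rightarrow> bool" for t where
  cis: "\<bar>k\<bar> \<le> int t \<Longrightarrow> trig_poly t (\<lambda>\<theta>. c * cis (of_int k * \<theta>))"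
| add: "trig_poly t f \<Longrightarrow> trig_poly t g \<Longrightarrow> trig_poly t (\<lambda>\<theta>. f \<theta> + g \<theta>)"

lemma trig_poly_scale: "trig_poly t f \<Longrightarrow> trig_poly t (\<lambda>\<theta>. c * f \<theta>)"
proof (induction rule: trig_poly.induct)
  case (cis k d)
  then show ?case using trig_poly.cis[of k t "c * d"] by (simp add: mult.assoc)
qed (auto simp: distrib_left intro: trig_poly.add)

lemma trig_poly_cis_mult:
  assumes "trig_poly t f" "\<bar>k\<bar> \<le> 1"
  shows "trig_poly (Suc t) (\<lambda>\<theta>. cis (of_int k * \<theta>) * f \<theta>)"
  using assms(1)
proof (induction rule: trig_poly.induct)
  case (cis l d)
  then have "trig_poly (Suc t) (\<lambda>\<theta>. d * cis (of_int (k + l) * \<theta>))" using assms(2) by (intro trig_poly.cis) auto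
  then show ?case by (simp add: algebra_simps flip: cis_mult)
qed (auto simp: distrib_left intro: trig_poly.add)

text \<open>The real factor has the form of a coordinate of a rotated point as a function of the
  angle, so each coordinate factor of a polynomial costs one degree.\<close>

lemma trig_poly_trig_mult:
  assumes "trig_poly t f"
  shows "trig_poly (Suc t) (\<lambda>\<theta>. of_real (a * cos \<theta> + b * sin \<theta> + c) * f \<theta>)"
proof -
  have *: "of_real (a * cos \<theta> + b * sin \<theta> + c) * f \<theta> = Complex (a/2) (- b/2) * (cis (of_int 1 * \<theta>) * f \<theta>)
    + (Complex (a/2) (b/2) * (cis (of_int (- 1) * \<theta>) * f \<theta>) + of_real c * (cis (of_int 0 * \<theta>) * f \<theta>))" for \<theta>
  proof -
    have "of_real (a * cos \<theta> + b * sin \<theta> + c) = Complex (a/2) (- b/2) * cis (of_int 1 * \<theta>)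
      + (Complex (a/2) (b/2) * cis (of_int (- 1) * \<theta>) + of_real c * cis (of_int 0 * \<theta>))"
      by (simp add: complex_eq_iff)
    then show ?thesis by (simp only: distrib_right mult.assoc)
  qed
  show ?thesis unfolding * by (intro trig_poly.add trig_poly_scale trig_poly_cis_mult assms) auto
qed

text \<open>Taylor expansion at \<open>0\<close> with each derivative replaced by its weighted
  samples. The weights of order \<open>n\<close> have mass at most \<open>(2 * t) ^ n\<close>, so
  the masses add up to the exponential series without its constant term. Nodes and weights are
  chosen before \<open>f\<close> and \<open>\<theta>\<close>; this uniformity makes the right-hand
  side usable as an operator.\<close>

lemma trig_poly_oscillation:
  fixes t :: nat and \<rho> :: real
  assumes "t \<ge> 1" "\<rho> \<ge> 0"
  shows "\<exists>(M::nat) u a. (\<forall>j<M. a j \<ge> 0) \<and> (\<Sum>j<M. a j) \<le> exp (2 * real t * \<rho>) - 1 \<and>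
    (\<forall>f \<theta>. trig_poly t f \<longrightarrow> \<bar>\<theta>\<bar> \<le> \<rho> \<longrightarrow> cmod (f \<theta> - f 0) \<le> (\<Sum>j<M. a j * cmod (f (u j))))"
proof -
  let ?M = "3 * t"
  define u where "u j = 2 * pi * real j / real (3 * t)" for j
  have "\<forall>n. \<exists>w :: nat \<Rightarrow> real. (\<Sum>j<3*t. \<bar>w j\<bar>) \<le> (2 * real t) ^ n \<and>
     (\<forall>k::int. \<bar>k\<bar> \<le> int t \<longrightarrow> (\<Sum>j<3*t. of_real (w j) * cis (of_int k * u j)) = (\<i> * of_int k) ^ n)"
    using ex_higher_differentiation_weights[OF assms(1)] unfolding u_def by blast
  then obtain w :: "nat \<Rightarrow> nat \<Rightarrow> real" where w: "\<And>n. (\<Sum>j<?M. \<bar>w n j\<bar>) \<le> (2 * real t) ^ n"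
    "\<And>n k. \<bar>k\<bar> \<le> int t \<Longrightarrow> (\<Sum>j<?M. of_real (w n j) * cis (of_int k * u j)) = (\<i> * of_int k) ^ n"
    by metis
  define A where "A r n j = (if n = 0 then 0 else r ^ n * w n j / fact n)" for r n j
  define E where "E = (\<lambda>n. if n = 0 then 0 else (2 * real t * \<rho>) ^ n / fact n)"
  have "(\<lambda>n. (2 * real t * \<rho>) ^ n / fact n) sums exp (2 * real t * \<rho>)"
    using exp_converges[of "2 * real t * \<rho>"] by (simp add: divide_inverse mult_ac)
  then have Esums: "E sums (exp (2 * real t * \<rho>) - 1)"
    using sums_iff_shift[of "\<lambda>n. (2 * real t * \<rho>) ^ n / fact n" 1 "exp (2 * real t * \<rho>) - 1"]
      sums_iff_shift[of E 1 "exp (2 * real t * \<rho>) - 1"] by (simp add: E_def)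
  have Ale: "(\<Sum>j<?M. \<bar>A \<rho> n j\<bar>) \<le> E n" for n
  proof (cases "n = 0")
    case False
    have "(\<Sum>j<?M. \<bar>A \<rho> n j\<bar>) = \<rho> ^ n / fact n * (\<Sum>j<?M. \<bar>w n j\<bar>)"
      using False assms by (simp add: A_def abs_mult sum_distrib_left)
    also have "\<dots> \<le> \<rho> ^ n / fact n * (2 * real t) ^ n"
      using assms w by (intro mult_left_mono) auto
    finally show ?thesis using False by (simp add: E_def power_mult_distrib mult_ac)
  qed (simp add: A_def E_def)
  have mono: "\<bar>A \<theta> n j\<bar> \<le> \<bar>A \<rho> n j\<bar>" if "\<bar>\<theta>\<bar> \<le> \<rho>" for \<theta> n j
    using that by (auto simp: A_def abs_mult power_abs intro!: divide_right_mono mult_right_mono power_mono)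
  have summ: "summable (\<lambda>n. \<bar>A \<rho> n j\<bar>)" if "j < ?M" for j
  proof (rule summable_comparison_test'[where N = 0])
    show "summable E" using Esums by (rule sums_summable)
    show "norm \<bar>A \<rho> n j\<bar> \<le> E n" for n
      using Ale[of n] member_le_sum[of j "{..<?M}" "\<lambda>j. \<bar>A \<rho> n j\<bar>"] that by simp
  qed
  \<comment> \<open>Absolute values at the endpoint \<open>\<rho>\<close> dominate the weights of
    all smaller angles at once.\<close>
  define a where "a j = suminf (\<lambda>n. \<bar>A \<rho> n j\<bar>)" for j
  have a0: "a j \<ge> 0" if "j < ?M" for j unfolding a_def using summ[OF that] by (intro suminf_nonneg) auto
  have "(\<Sum>j<?M. a j) = suminf (\<lambda>n. \<Sum>j<?M. \<bar>A \<rho> n j\<bar>)"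
    unfolding a_def using summ by (intro suminf_sum[symmetric]) auto
  also have "\<dots> \<le> suminf E"
    using Esums Ale summ by (intro suminf_le summable_sum) (auto simp: sums_iff)
  also have "\<dots> = exp (2 * real t * \<rho>) - 1" using Esums by (simp add: sums_iff)
  finally have asum: "(\<Sum>j<?M. a j) \<le> exp (2 * real t * \<rho>) - 1" .
  have "cmod (f \<theta> - f 0) \<le> (\<Sum>j<?M. a j * cmod (f (u j)))" if f: "trig_poly t f" and th: "\<bar>\<theta>\<bar> \<le> \<rho>" for f \<theta>
  proof -
    have summth: "summable (\<lambda>n. \<bar>A \<theta> n j\<bar>)" if "j < ?M" for j
      by (rule summable_comparison_test'[OF summ[OF that], where N = 0]) (use mono[OF th] in auto)
    define b where "b j = suminf (\<lambda>n. A \<theta> n j)" for j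
    have bsums: "(\<lambda>n. A \<theta> n j) sums b j" if "j < ?M" for j
      unfolding b_def by (intro summable_sums summable_rabs_cancel[OF summth[OF that]])
    have bcis: "(\<Sum>j<?M. of_real (b j) * cis (of_int k * u j)) = cis (of_int k * \<theta>) - 1" if k: "\<bar>k\<bar> \<le> int t" for k
    proof -
      have "(\<lambda>n. \<Sum>j<?M. of_real (A \<theta> n j) * cis (of_int k * u j)) sums (\<Sum>j<?M. of_real (b j) * cis (of_int k * u j))"
        by (intro sums_sum sums_mult2 sums_of_real bsums) auto
      moreover have "(\<Sum>j<?M. of_real (A \<theta> n j) * cis (of_int k * u j)) = (if n = 0 then 0 else (\<i> * of_int k * of_real \<theta>) ^ n / fact n)" for n
      proof (cases "n = 0")
        case False
        have "(\<Sum>j<?M. of_real (A \<theta> n j) * cis (of_int k * u j)) = of_real (\<theta> ^ n / fact n) * (\<Sum>j<?M. of_real (w n j) * cis (of_int k * u j))"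
          using False by (simp add: A_def sum_distrib_left mult_ac)
        then show ?thesis using False unfolding w(2)[OF k] by (simp add: power_mult_distrib mult_ac)
      qed (simp add: A_def)
      moreover have "(\<lambda>n. if n = 0 then 0 else (\<i> * of_int k * of_real \<theta>) ^ n / fact n) sums (cis (of_int k * \<theta>) - 1)"
      proof -
        define z where "z = \<i> * of_int k * complex_of_real \<theta>"
        have "(\<lambda>n. z ^ n / fact n) sums exp z"
          using exp_converges[of z] by (simp add: scaleR_conv_of_real divide_inverse mult_ac)
        then have "(\<lambda>n. if n = 0 then 0 else z ^ n / fact n) sums (exp z - 1)"
          using sums_iff_shift[of "\<lambda>n. z ^ n / fact n" 1 "exp z - 1"]
            sums_iff_shift[of "\<lambda>n. if n = 0 then 0 else z ^ n / fact n" 1 "exp z - 1"] by simp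
        moreover have "exp z = cis (of_int k * \<theta>)" by (simp add: z_def cis_conv_exp mult_ac)
        ultimately show ?thesis unfolding z_def by simp
      qed
      ultimately show ?thesis by (simp add: sums_iff)
    qed
    \<comment> \<open>Both sides are linear in \<open>f\<close>, so \<open>bcis\<close> for single
      exponentials is enough.\<close>
    have "(\<Sum>j<?M. of_real (b j) * f (u j)) = f \<theta> - f 0"
      using f
    proof (induction rule: trig_poly.induct)
      case (cis k c)
      have "(\<Sum>j<?M. of_real (b j) * (c * cis (of_int k * u j))) = c * (\<Sum>j<?M. of_real (b j) * cis (of_int k * u j))"
        by (simp add: sum_distrib_left mult_ac)
      then show ?case unfolding bcis[OF cis] by (simp add: right_diff_distrib)
    next
      case (add f g)
      then show ?case by (simp add: distrib_left sum.distrib)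
    qed
    then have "cmod (f \<theta> - f 0) \<le> (\<Sum>j<?M. cmod (of_real (b j) * f (u j)))" by (metis norm_sum)
    also have "\<dots> \<le> (\<Sum>j<?M. a j * cmod (f (u j)))"
    proof (intro sum_mono)
      fix j assume "j \<in> {..<?M}"
      then have j: "j < ?M" by simp
      have "\<bar>b j\<bar> \<le> suminf (\<lambda>n. \<bar>A \<theta> n j\<bar>)" unfolding b_def by (rule summable_rabs[OF summth[OF j]])
      also have "\<dots> \<le> a j" unfolding a_def by (intro suminf_le mono[OF th] summth summ j)
      finally show "cmod (of_real (b j) * f (u j)) \<le> a j * cmod (f (u j))"
        by (simp add: norm_mult mult_right_mono)
    qed
    finally show ?thesis .
  qed
  then show ?thesis using a0 asum by blast
qed

section \<open>Plane rotations and polynomials\<close>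

type_synonym 'n plane = "'n \<times> 'n"

text \<open>A rotation only if the two indices differ; for equal indices the first branch scales a
  coordinate. Hence the recurring hypothesis \<open>fst p \<noteq> snd p\<close>.\<close>

definition rot :: "'n plane \<Rightarrow> real \<Rightarrow> real ^ 'n \<Rightarrow> real ^ 'n::finite" where
  "rot p \<theta> x = (\<chi> i. if i = fst p then cos \<theta> * x $ fst p - sin \<theta> * x $ snd p
     else if i = snd p then sin \<theta> * x $ fst p + cos \<theta> * x $ snd p else x $ i)"

text \<open>The last plane of the list acts first. Angles are attached to planes rather than to
  positions, so one angle function serves all tails of a list in inductions.\<close>

fun rots :: "'n plane list \<Rightarrow> ('n plane \<Rightarrow> real) \<Rightarrow> real ^ 'n \<Rightarrow> real ^ 'n::finite" where
  "rots [] \<theta> x = x"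
| "rots (p # L) \<theta> x = rot p (\<theta> p) (rots L \<theta> x)"

lemma rot_0 [simp]: "rot p 0 x = x"
  by (auto simp: rot_def vec_eq_iff)

lemma linear_rot: "linear (rot p \<theta>)"
  by (rule linearI) (auto simp: rot_def vec_eq_iff algebra_simps)

lemma sum_pair:
  fixes f :: "'n::finite \<Rightarrow> 'b::comm_monoid_add"
  assumes "a \<noteq> b"
  shows "(\<Sum>i\<in>UNIV. f i) = f a + f b + (\<Sum>i\<in>UNIV - {a, b}. f i)"
proof -
  have "(\<Sum>i\<in>UNIV. f i) = (\<Sum>i\<in>{a, b}. f i) + (\<Sum>i\<in>UNIV - {a, b}. f i)"
    by (metis Diff_partition add.commute finite sum.subset_diff top_greatest)
  then show ?thesis using assms by simp
qed

lemma inner_rot: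
  assumes "fst p \<noteq> snd p"
  shows "rot p \<theta> x \<bullet> rot p \<theta> y = x \<bullet> (y :: real ^ 'n::finite)"
proof -
  define a b where "a = fst p" and "b = snd p"
  have ab: "a \<noteq> b" using assms by (simp add: a_def b_def)
  have "rot p \<theta> x \<bullet> rot p \<theta> y = (cos \<theta> * x $ a - sin \<theta> * x $ b) * (cos \<theta> * y $ a - sin \<theta> * y $ b)
     + (sin \<theta> * x $ a + cos \<theta> * x $ b) * (sin \<theta> * y $ a + cos \<theta> * y $ b) + (\<Sum>i\<in>UNIV - {a, b}. x $ i * y $ i)"
    unfolding inner_vec_def sum_pair[OF ab]
    by (intro arg_cong2[where f = "(+)"] sum.cong) (use ab in \<open>auto simp: rot_def a_def b_def\<close>)
  also have "\<dots> = ((cos \<theta>)\<^sup>2 + (sin \<theta>)\<^sup>2) * (x $ a * y $ a + x $ b * y $ b) + (\<Sum>i\<in>UNIV - {a, b}. x $ i * y $ i)"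
  proof -
    have "(c * x $ a - s * x $ b) * (c * y $ a - s * y $ b) + (s * x $ a + c * x $ b) * (s * y $ a + c * y $ b)
      = (c\<^sup>2 + s\<^sup>2) * (x $ a * y $ a + x $ b * y $ b)" for c s
      by (simp add: algebra_simps power2_eq_square)
    then show ?thesis by simp
  qed
  also have "\<dots> = x \<bullet> y" unfolding inner_vec_def sum_pair[OF ab] by simp
  finally show ?thesis .
qed

lemma norm_rot:
  assumes "fst p \<noteq> snd p"
  shows "norm (rot p \<theta> x) = norm (x :: real ^ 'n::finite)"
  using inner_rot[OF assms, of \<theta> x x] by (simp add: norm_eq_sqrt_inner)

lemma orthogonal_transformation_rot: "fst p \<noteq> snd p \<Longrightarrow> orthogonal_transformation (rot p \<theta>)"
  by (simp add: orthogonal_transformation linear_rot norm_rot)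

lemma rot_diff: "rot p \<theta> x - rot p \<theta> y = rot p \<theta> (x - y)"
  using linear_diff[OF linear_rot] by metis

lemma dist_rot:
  assumes "fst p \<noteq> snd p"
  shows "dist (rot p \<theta> x) (rot p \<theta> y) = dist x (y :: real ^ 'n::finite)"
  by (simp add: dist_norm rot_diff norm_rot[OF assms])

lemma rot_add:
  assumes "fst p \<noteq> snd p"
  shows "rot p (\<alpha> + \<beta>) x = rot p \<alpha> (rot p \<beta> x)"
  using assms by (auto simp: rot_def vec_eq_iff cos_add sin_add algebra_simps)

lemma dist_rot_self:
  assumes "fst p \<noteq> snd p"
  shows "dist (rot p \<theta> x) x \<le> \<bar>\<theta>\<bar> * norm (x :: real ^ 'n::finite)"
proof -
  define a b where "a = fst p" and "b = snd p"
  have ab: "a \<noteq> b" using assms by (simp add: a_def b_def)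
  have "(norm (rot p \<theta> x - x))\<^sup>2 = (cos \<theta> * x $ a - sin \<theta> * x $ b - x $ a)\<^sup>2
     + (sin \<theta> * x $ a + cos \<theta> * x $ b - x $ b)\<^sup>2 + (\<Sum>i\<in>UNIV - {a, b}. 0)"
    unfolding norm_eq_sqrt_inner real_sqrt_pow2[OF inner_ge_zero] unfolding inner_vec_def sum_pair[OF ab]
    by (intro arg_cong2[where f = "(+)"] sum.cong) (use ab in \<open>auto simp: rot_def a_def b_def power2_eq_square\<close>)
  also have "\<dots> = ((cos \<theta> - 1)\<^sup>2 + (sin \<theta>)\<^sup>2) * ((x $ a)\<^sup>2 + (x $ b)\<^sup>2)"
  proof -
    have "(c * x $ a - s * x $ b - x $ a)\<^sup>2 + (s * x $ a + c * x $ b - x $ b)\<^sup>2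
      = ((c - 1)\<^sup>2 + s\<^sup>2) * ((x $ a)\<^sup>2 + (x $ b)\<^sup>2)" for c s
      by (simp add: algebra_simps power2_eq_square)
    then show ?thesis by simp
  qed
  also have "(cos \<theta> - 1)\<^sup>2 + (sin \<theta>)\<^sup>2 = (2 * sin (\<theta> / 2))\<^sup>2"
  proof -
    have "cos \<theta> = 1 - 2 * (sin (\<theta> / 2))\<^sup>2" using cos_double_sin[of "\<theta> / 2"] by simp
    moreover have "(cos \<theta> - 1)\<^sup>2 + (sin \<theta>)\<^sup>2 = 2 - 2 * cos \<theta>"
      using sin_cos_squared_add[of \<theta>] by (simp add: power2_eq_square algebra_simps)
    ultimately show ?thesis by (simp add: power2_eq_square)
  qed
  also have "(2 * sin (\<theta> / 2))\<^sup>2 \<le> \<theta>\<^sup>2"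
    using abs_sin_x_le_abs_x[of "\<theta> / 2"] by (intro abs_le_square_iff[THEN iffD1]) auto
  also have "(x $ a)\<^sup>2 + (x $ b)\<^sup>2 \<le> (norm x)\<^sup>2"
    unfolding norm_eq_sqrt_inner real_sqrt_pow2[OF inner_ge_zero] unfolding inner_vec_def sum_pair[OF ab]
    by (simp add: power2_eq_square sum_nonneg)
  finally have "(norm (rot p \<theta> x - x))\<^sup>2 \<le> (\<bar>\<theta>\<bar> * norm x)\<^sup>2"
    by (simp add: power_mult_distrib mult_left_mono mult_right_mono)
  then show ?thesis unfolding dist_norm by (rule power2_le_imp_le) simp
qed

lemma dist_rot_rot_le:
  assumes "fst p \<noteq> snd p" "norm x = 1"
  shows "dist (rot p \<alpha> x) (rot p \<beta> x) \<le> \<bar>\<alpha> - \<beta>\<bar>"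
proof -
  have "rot p \<alpha> x = rot p (\<alpha> - \<beta>) (rot p \<beta> x)" using rot_add[OF assms(1), of "\<alpha> - \<beta>" \<beta> x] by simp
  then show ?thesis
    using dist_rot_self[OF assms(1), of "\<alpha> - \<beta>" "rot p \<beta> x"] assms by (simp add: norm_rot)
qed

lemma norm_rots:
  assumes "\<forall>p\<in>set L. fst p \<noteq> snd p"
  shows "norm (rots L \<theta> x) = norm x"
  using assms by (induction L) (auto simp: norm_rot)

lemma dist_rots_self:
  assumes "\<forall>p\<in>set L. fst p \<noteq> snd p" "\<And>p. \<bar>\<theta> p\<bar> \<le> \<eta>" "norm x = 1"
  shows "dist (rots L \<theta> x) x \<le> real (length L) * \<eta>"
  using assms(1)
proof (induction L)
  case (Cons p L)
  have "dist (rots (p # L) \<theta> x) x \<le> dist (rot p (\<theta> p) (rots L \<theta> x)) (rots L \<theta> x) + dist (rots L \<theta> x) x"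
    by (simp add: dist_triangle)
  also have "\<dots> \<le> \<eta> + real (length L) * \<eta>"
    using Cons dist_rot_self[of p "\<theta> p" "rots L \<theta> x"] assms(2)[of p] assms(3)
    by (intro add_mono) (auto simp: norm_rots)
  finally show ?case by (simp add: algebra_simps)
qed simp

text \<open>A common rotation is an isometry; only the difference of the two angles, at most
  \<open>\<epsilon>\<close> per factor, can bring the points closer.\<close>

lemma dist_rots_ge:
  assumes "\<forall>p\<in>set L. fst p \<noteq> snd p" "norm x = 1" "norm y = 1" "\<And>p. \<bar>\<alpha> p - \<beta> p\<bar> \<le> \<epsilon>"
  shows "dist (rots L \<alpha> x) (rots L \<beta> y) \<ge> dist x y - real (length L) * \<epsilon>"
  using assms(1)
proof (induction L)
  case (Cons p L)
  let ?u = "rots L \<alpha> x" and ?v = "rots L \<beta> y"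
  have "dist ?u ?v = dist (rot p (\<alpha> p) ?u) (rot p (\<alpha> p) ?v)" using Cons.prems by (simp add: dist_rot)
  also have "\<dots> \<le> dist (rot p (\<alpha> p) ?u) (rot p (\<beta> p) ?v) + dist (rot p (\<beta> p) ?v) (rot p (\<alpha> p) ?v)"
    by (rule dist_triangle)
  also have "dist (rot p (\<beta> p) ?v) (rot p (\<alpha> p) ?v) \<le> \<bar>\<beta> p - \<alpha> p\<bar>"
    using Cons.prems assms(3) by (intro dist_rot_rot_le) (auto simp: norm_rots)
  also have "\<dots> \<le> \<epsilon>" using assms(4)[of p] by (simp add: abs_minus_commute)
  finally show ?case using Cons by (simp add: algebra_simps)
qed simp

lemma rots_cong: "(\<And>p. p \<in> set L \<Longrightarrow> \<alpha> p = \<beta> p) \<Longrightarrow> rots L \<alpha> x = rots L \<beta> x"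
  by (induction L) auto

lemma continuous_on_rot [continuous_intros]:
  fixes f :: "'a::t2_space \<Rightarrow> real"
  assumes "continuous_on S f" "continuous_on S g"
  shows "continuous_on S (\<lambda>z. rot p (f z) (g z))"
  unfolding rot_def
proof (intro continuous_on_vec_lambda)
  fix i
  show "continuous_on S (\<lambda>x. if i = fst p then cos (f x) * g x $ fst p - sin (f x) * g x $ snd p
      else if i = snd p then sin (f x) * g x $ fst p + cos (f x) * g x $ snd p else g x $ i)"
    by (cases "i = fst p"; cases "i = snd p") (auto intro!: continuous_intros assms)
qed

lemma continuous_on_rots [continuous_intros]:
  fixes g :: "'a::t2_space \<Rightarrow> real ^ 'n::finite"
  assumes "\<And>p. continuous_on S (\<lambda>z. f z p)" "continuous_on S g"
  shows "continuous_on S (\<lambda>z. rots L (f z) (g z))"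
  by (induction L) (auto intro!: continuous_intros assms)

section \<open>Polynomial functions and their derivatives along rotations\<close>

text \<open>Building polynomials one coordinate factor at a time gives short inductions for
  rotation, differentiation and restriction to orbits, which exponent vectors would obscure.
  \<open>poly_le_monomial\<close> is the link to the definition by coefficients.\<close>

inductive poly_le :: "nat \<Rightarrow> (real ^ 'n::finite \<Rightarrow> real) \<Rightarrow> bool" where
  const: "poly_le t (\<lambda>x. c)"
| coord: "poly_le t f \<Longrightarrow> poly_le (Suc t) (\<lambda>x. x $ i * f x)"
| add: "poly_le t f \<Longrightarrow> poly_le t g \<Longrightarrow> poly_le t (\<lambda>x. f x + g x)"

lemma poly_le_Suc: "poly_le t f \<Longrightarrow> poly_le (Suc t) f"
  by (induction rule: poly_le.induct) (auto intro: poly_le.intros)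

lemma poly_le_mono: "t \<le> t' \<Longrightarrow> poly_le t f \<Longrightarrow> poly_le t' f"
  by (induction t' rule: dec_induct) (auto intro: poly_le_Suc)

lemma poly_le_scale: "poly_le t f \<Longrightarrow> poly_le t (\<lambda>x. c * f x)"
proof (induction rule: poly_le.induct)
  case (coord t f i)
  then show ?case using poly_le.coord[of t "\<lambda>x. c * f x" i] by (simp add: mult_ac)
qed (auto simp: distrib_left intro: poly_le.intros)

lemma poly_le_sum: "(\<And>i. i \<in> I \<Longrightarrow> poly_le t (f i)) \<Longrightarrow> poly_le t (\<lambda>x. \<Sum>i\<in>I. f i x)"
  by (induction I rule: infinite_finite_induct) (auto intro: poly_le.intros)

lemma poly_le_coord_comb: "poly_le t f \<Longrightarrow> poly_le (Suc t) (\<lambda>x. (a * x $ i + b * x $ j) * f x)"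
  unfolding distrib_right mult.assoc by (intro poly_le.add poly_le_scale poly_le.coord)

lemma poly_le_rot: "poly_le t f \<Longrightarrow> poly_le t (\<lambda>x. f (rot p \<theta> x))"
proof (induction rule: poly_le.induct)
  case (coord t f i)
  have "\<exists>a b j k. \<forall>x. rot p \<theta> x $ i = a * x $ j + b * x $ k"
  proof -
    consider "i = fst p" | "i \<noteq> fst p" "i = snd p" | "i \<noteq> fst p" "i \<noteq> snd p" by blast
    then show ?thesis
    proof cases
      case 1
      then show ?thesis by (intro exI[of _ "cos \<theta>"] exI[of _ "- sin \<theta>"] exI[of _ "fst p"] exI[of _ "snd p"]) (simp add: rot_def)
    next
      case 2
      then show ?thesis by (intro exI[of _ "sin \<theta>"] exI[of _ "cos \<theta>"] exI[of _ "fst p"] exI[of _ "snd p"]) (simp add: rot_def)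
    next
      case 3
      then show ?thesis by (intro exI[of _ 1] exI[of _ 0] exI[of _ i]) (simp add: rot_def)
    qed
  qed
  then obtain a b j k where "\<And>x. rot p \<theta> x $ i = a * x $ j + b * x $ k" by blast
  then show ?case using poly_le_coord_comb[OF coord.IH] by simp
qed (auto intro: poly_le.intros)

lemma poly_le_continuous: "poly_le t f \<Longrightarrow> continuous_on S f"
  by (induction rule: poly_le.induct) (auto intro!: continuous_intros)

lemma rot_nth_trig: "\<exists>a b c. \<forall>\<theta>. rot p \<theta> x $ i = a * cos \<theta> + b * sin \<theta> + c"
proof -
  consider "i = fst p" | "i \<noteq> fst p" "i = snd p" | "i \<noteq> fst p" "i \<noteq> snd p" by blast
  then show ?thesis
  proof cases
    case 1
    then show ?thesis by (intro exI[of _ "x $ fst p"] exI[of _ "- x $ snd p"] exI[of _ 0]) (simp add: rot_def)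
  next
    case 2
    then show ?thesis by (intro exI[of _ "x $ snd p"] exI[of _ "x $ fst p"] exI[of _ 0]) (simp add: rot_def)
  next
    case 3
    then show ?thesis by (intro exI[of _ 0] exI[of _ "x $ i"]) (simp add: rot_def)
  qed
qed

lemma poly_le_trig_poly: "poly_le t f \<Longrightarrow> trig_poly t (\<lambda>\<theta>. of_real (f (rot p \<theta> x)))"
proof (induction rule: poly_le.induct)
  case (const t c)
  then show ?case using trig_poly.cis[of 0 t "of_real c"] by simp
next
  case (coord t f i)
  obtain a b c where "\<And>\<theta>. rot p \<theta> x $ i = a * cos \<theta> + b * sin \<theta> + c" using rot_nth_trig by metis
  then show ?case using trig_poly_trig_mult[OF coord.IH] by simp
qed (auto intro: trig_poly.intros)

text \<open>With \<open>p = (a, b)\<close>, this is the derivative along the vector field that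
  generates the rotations, \<open>x $ a\<close> times the \<open>b\<close>-th partial derivative
  minus \<open>x $ b\<close> times the \<open>a\<close>-th one.\<close>

definition rot_deriv :: "'n plane \<Rightarrow> (real ^ 'n::finite \<Rightarrow> real) \<Rightarrow> (real ^ 'n \<Rightarrow> real) \<Rightarrow> bool" where
  "rot_deriv p f f' \<longleftrightarrow>
     (\<forall>x \<theta>. ((\<lambda>\<theta>. f (rot p \<theta> x)) has_real_derivative f' (rot p \<theta> x)) (at \<theta>))"

lemma ex_rot_deriv_coord:
  assumes "fst p \<noteq> snd p"
  shows "\<exists>a j. rot_deriv p (\<lambda>x. x $ i) (\<lambda>x. a * x $ j)"
proof -
  consider "i = fst p" | "i \<noteq> fst p" "i = snd p" | "i \<noteq> fst p" "i \<noteq> snd p" by blast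
  then show ?thesis
  proof cases
    case 1
    then show ?thesis using assms
      by (intro exI[of _ "-1"] exI[of _ "snd p"]) (auto simp: rot_deriv_def rot_def intro!: derivative_eq_intros)
  next
    case 2
    then show ?thesis using assms
      by (intro exI[of _ 1] exI[of _ "fst p"]) (auto simp: rot_deriv_def rot_def intro!: derivative_eq_intros)
  next
    case 3
    then show ?thesis
      by (intro exI[of _ 0] exI[of _ i]) (auto simp: rot_deriv_def rot_def)
  qed
qed

text \<open>A rotation generator replaces one coordinate factor by another, so the degree bound does
  not grow and the oscillation estimate applies to the derivative with the same
  \<open>t\<close>.\<close>

lemma ex_rot_deriv:
  assumes "fst p \<noteq> snd p" "poly_le t f"
  shows "\<exists>f'. poly_le t f' \<and> rot_deriv p f f'"
  using assms(2)
proof (induction rule: poly_le.induct)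
  case (const t c)
  have "rot_deriv p (\<lambda>x. c) (\<lambda>x. 0)" by (simp add: rot_deriv_def)
  then show ?case using poly_le.const by blast
next
  case (coord t f i)
  then obtain f' where f': "poly_le t f'" "rot_deriv p f f'" by blast
  obtain a j where aj: "rot_deriv p (\<lambda>x. x $ i) (\<lambda>x. a * x $ j)" using ex_rot_deriv_coord[OF assms(1)] by blast
  have "rot_deriv p (\<lambda>x. x $ i * f x) (\<lambda>x. a * (x $ j * f x) + x $ i * f' x)"
    using aj f'(2) unfolding rot_deriv_def
    by (auto intro!: derivative_eq_intros)
  moreover have "poly_le (Suc t) (\<lambda>x. a * (x $ j * f x) + x $ i * f' x)"
    by (intro poly_le.add poly_le_scale poly_le.coord f' coord)
  ultimately show ?case by blast
next
  case (add t f g)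
  then obtain f' g' where "poly_le t f'" "rot_deriv p f f'" "poly_le t g'" "rot_deriv p g g'" by blast
  moreover from this have "rot_deriv p (\<lambda>x. f x + g x) (\<lambda>x. f' x + g' x)"
    unfolding rot_deriv_def by (auto intro!: derivative_eq_intros)
  ultimately show ?case using poly_le.add by blast
qed

lemma poly_le_monomial:
  fixes a :: "'n::finite \<Rightarrow> nat"
  shows "poly_le (\<Sum>i\<in>UNIV. a i) (\<lambda>x. \<Prod>i\<in>UNIV. x $ i ^ a i)"
proof -
  have pow: "poly_le (t + k) (\<lambda>x. x $ i ^ k * f x)" if "poly_le t f" for t k i and f :: "real ^ 'n \<Rightarrow> real"
    using that by (induction k) (auto simp: mult.assoc intro: poly_le.coord)
  have "poly_le (\<Sum>i\<in>I. a i) (\<lambda>x. \<Prod>i\<in>I. x $ i ^ a i)" if "finite I" for I :: "'n set"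
    using that
  proof (induction I)
    case (insert j I)
    from pow[OF insert.IH, of "a j" j] show ?case using insert.hyps by (simp add: add.commute)
  qed (simp add: poly_le.const)
  then show ?thesis by simp
qed

section \<open>The measure on the sphere\<close>

text \<open>The change of variables theorems of the library require a well-ordered index type.\<close>

typedef 'a ordered_copy = "UNIV :: 'a set" morphisms of_copy to_copy by simp

lemma bij_of_copy: "bij of_copy"
  by (metis bijI' of_copy_inject to_copy_inverse UNIV_I)

instance ordered_copy :: (finite) finite
  by standard (metis bij_of_copy bij_betw_finite finite)

instantiation ordered_copy :: (finite) wellorder
begin

definition "x \<le> y \<longleftrightarrow> to_nat (of_copy x) \<le> to_nat (of_copy y)"
definition "x < y \<longleftrightarrow> to_nat (of_copy x) < to_nat (of_copy y)"

instance
proof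
  fix P :: "'a ordered_copy \<Rightarrow> bool" and a
  assume "\<And>x. (\<And>y. y < x \<Longrightarrow> P y) \<Longrightarrow> P x"
  then show "P a"
    unfolding less_ordered_copy_def by (induction a rule: measure_induct_rule[of "\<lambda>x. to_nat (of_copy x)"]) blast
qed (auto simp: less_eq_ordered_copy_def less_ordered_copy_def of_copy_inject)

end

lemma lborel_distr_orthogonal_transformation_wellorder:
  fixes T :: "real ^ 'n::{finite,wellorder} \<Rightarrow> real ^ 'n::_"
  assumes "orthogonal_transformation T"
  shows "distr lborel borel T = lborel"
proof (rule lborel_eqI[symmetric])
  have T: "bij T" "linear T" and invT: "orthogonal_transformation (inv_into UNIV T)"
    using assms by (auto simp: orthogonal_transformation_bij orthogonal_transformation_linear orthogonal_transformation_inv)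
  have Tm: "T \<in> borel_measurable borel"
    using T(2) by (intro borel_measurable_continuous_onI linear_continuous_on) (simp add: linear_conv_bounded_linear)
  fix l u :: "real ^ 'n::_" assume lu: "\<And>b. b \<in> Basis \<Longrightarrow> l \<bullet> b \<le> u \<bullet> b"
  have eq: "T -` box l u = inv_into UNIV T ` box l u" using T(1) by (simp add: bij_vimage_eq_inv_image)
  have lm: "box l u \<in> lmeasurable" by simp
  have "emeasure (distr lborel borel T) (box l u) = emeasure lborel (T -` box l u)"
    using Tm by (simp add: emeasure_distr)
  also have "\<dots> = emeasure lebesgue (T -` box l u)"
    using measurable_sets[OF Tm, of "box l u"] by simp
  also have "\<dots> = emeasure lebesgue (box l u)"
    by (simp only: eq emeasure_eq_measure2[OF measurable_orthogonal_image[OF invT lm]]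
        emeasure_eq_measure2[OF lm] measure_orthogonal_image[OF invT lm])
  also have "\<dots> = (\<Prod>b\<in>Basis. (u - l) \<bullet> b)" using lu by simp
  finally show "emeasure (distr lborel borel T) (box l u) = (\<Prod>b\<in>Basis. (u - l) \<bullet> b)" .
qed simp

definition relabel :: "real ^ 'n::finite \<Rightarrow> real ^ 'n ordered_copy" where
  "relabel x = (\<chi> i. x $ of_copy i)"

definition unlabel :: "real ^ 'n ordered_copy \<Rightarrow> real ^ 'n::finite" where
  "unlabel x = (\<chi> i. x $ to_copy i)"

lemma relabel_unlabel [simp]: "relabel (unlabel x) = x" "unlabel (relabel y) = y"
  by (simp_all add: relabel_def unlabel_def vec_eq_iff of_copy_inverse to_copy_inverse)

lemma linear_relabel: "linear relabel" and linear_unlabel: "linear unlabel"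
  by (auto intro!: linearI simp: relabel_def unlabel_def vec_eq_iff)

lemma inner_relabel: "relabel x \<bullet> relabel y = x \<bullet> y"
  unfolding inner_vec_def relabel_def using sum.reindex_bij_betw[OF bij_of_copy, of "\<lambda>i. x $ i \<bullet> y $ i"] by simp

lemma norm_relabel: "norm (relabel x) = norm x"
  by (simp add: norm_eq_sqrt_inner inner_relabel)

lemma borel_measurable_unlabel: "unlabel \<in> borel_measurable borel"
  using linear_unlabel
  by (auto intro!: borel_measurable_continuous_onI linear_continuous_on simp: linear_conv_bounded_linear)

lemma lborel_distr_unlabel: "distr lborel borel unlabel = (lborel :: (real ^ 'n::finite) measure)"
proof (rule lborel_eqI[symmetric])
  fix l u :: "real ^ 'n" assume lu: "\<And>b. b \<in> Basis \<Longrightarrow> l \<bullet> b \<le> u \<bullet> b"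
  have prodB: "(\<Prod>b\<in>Basis. (v :: real ^ 'm::finite) \<bullet> b) = (\<Prod>i\<in>UNIV. v $ i)" for v
    by (simp add: Basis_vec_def UN_singleton axis_eq_axis prod.UNION_disjoint inner_axis image_image[symmetric] prod.reindex inj_on_def)
  have "unlabel -` box l u = box (relabel l) (relabel u)"
    by (auto simp: mem_box_cart unlabel_def relabel_def) (metis of_copy_inverse to_copy_inverse UNIV_I)+
  moreover have "\<And>b. b \<in> Basis \<Longrightarrow> relabel l \<bullet> b \<le> relabel u \<bullet> b"
  proof -
    have "l $ j \<le> u $ j" for j using lu[of "axis j 1"] by (auto simp: Basis_vec_def inner_axis)
    then show "relabel l \<bullet> b \<le> relabel u \<bullet> b" if "b \<in> Basis" for b
      using that by (auto simp: Basis_vec_def inner_axis relabel_def)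
  qed
  ultimately have "emeasure (distr lborel borel unlabel) (box l u) = (\<Prod>b\<in>Basis. (relabel u - relabel l) \<bullet> b)"
    using borel_measurable_unlabel by (subst emeasure_distr) (auto simp: emeasure_lborel_box_eq)
  also have "\<dots> = ennreal (\<Prod>i\<in>UNIV. (u - l) $ i)"
    unfolding prodB using prod.reindex_bij_betw[OF bij_of_copy, of "\<lambda>i. (u - l) $ i"] by (simp add: relabel_def)
  finally show "emeasure (distr lborel borel unlabel) (box l u) = (\<Prod>b\<in>Basis. (u - l) \<bullet> b)"
    by (simp add: prodB)
qed simp

text \<open>Conjugation with \<open>relabel\<close> transports the well-ordered case to an arbitrary
  finite index type.\<close>

lemma lborel_distr_orthogonal_transformation:
  fixes T :: "real ^ 'n::finite \<Rightarrow> real ^ 'n"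
  assumes "orthogonal_transformation T"
  shows "distr lborel borel T = lborel"
proof -
  have lin: "linear T" and nT: "\<And>x. norm (T x) = norm x" using assms by (auto simp: orthogonal_transformation)
  have Tm: "T \<in> borel_measurable borel"
    using lin by (intro borel_measurable_continuous_onI linear_continuous_on) (simp add: linear_conv_bounded_linear)
  define T' where "T' = relabel \<circ> T \<circ> unlabel"
  have "linear T'" unfolding T'_def by (intro linear_compose linear_relabel linear_unlabel lin)
  moreover have "norm (T' x) = norm x" for x
    using norm_relabel[of "unlabel x"] by (simp add: T'_def norm_relabel nT)
  ultimately have oT': "orthogonal_transformation T'" by (simp add: orthogonal_transformation)
  have T'm: "T' \<in> borel_measurable borel"
    using \<open>linear T'\<close> by (intro borel_measurable_continuous_onI linear_continuous_on) (simp add: linear_conv_bounded_linear)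
  have "distr lborel borel T = distr (distr lborel borel unlabel) borel T" by (simp add: lborel_distr_unlabel)
  also have "\<dots> = distr lborel borel (T \<circ> unlabel)"
    using Tm borel_measurable_unlabel by (subst distr_distr) auto
  also have "T \<circ> unlabel = unlabel \<circ> T'" by (auto simp: T'_def)
  also have "distr lborel borel (unlabel \<circ> T') = distr (distr lborel borel T') borel unlabel"
    using T'm borel_measurable_unlabel by (subst distr_distr) auto
  finally show ?thesis
    by (simp add: lborel_distr_orthogonal_transformation_wellorder[OF oT'] lborel_distr_unlabel)
qed

section \<open>Integration over the sphere through the cone construction\<close>

lemma cone_eq_vimage_sgn:
  fixes A :: "'a::euclidean_space set"
  assumes "A \<subseteq> sphere 0 1"
  shows "{r *\<^sub>R x | r x. 0 < r \<and> r \<le> 1 \<and> x \<in> A} = sgn -` A \<inter> punctured_ball"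
proof (intro equalityI subsetI)
  fix y assume y: "y \<in> sgn -` A \<inter> punctured_ball"
  have "y = norm y *\<^sub>R sgn y" by (cases "y = 0") (simp_all add: sgn_div_norm)
  with y show "y \<in> {r *\<^sub>R x | r x. 0 < r \<and> r \<le> 1 \<and> x \<in> A}"
    unfolding punctured_ball_def by (intro CollectI exI[of _ "norm y"] exI[of _ "sgn y"]) auto
next
  fix y assume "y \<in> {r *\<^sub>R x | r x. 0 < r \<and> r \<le> 1 \<and> x \<in> A}"
  then obtain r x where rx: "y = r *\<^sub>R x" "0 < r" "r \<le> 1" "x \<in> A" by auto
  then have "norm x = 1" using assms by auto
  then show "y \<in> sgn -` A \<inter> punctured_ball"
    using rx by (auto simp: punctured_ball_def sgn_div_norm)
qed

lemma borel_measurable_sgn: "sgn \<in> borel_measurable (borel :: 'a::euclidean_space measure)"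
  by (simp add: sgn_div_norm[abs_def])

lemma finite_measure_sphere_lebesgue: "finite_measure (sphere_lebesgue :: 'a::euclidean_space measure)"
  by (rule finite_measureI) (simp add: emeasure_sphere_lebesgue_space)

lemma integrable_sphere_lebesgue:
  fixes f :: "'a::euclidean_space \<Rightarrow> real"
  assumes "continuous_on (sphere 0 1) f"
  shows "integrable sphere_lebesgue f"
proof -
  interpret finite_measure "sphere_lebesgue :: 'a measure" by (rule finite_measure_sphere_lebesgue)
  have "bounded (f ` sphere 0 1)"
    by (intro compact_imp_bounded compact_continuous_image assms compact_sphere)
  then obtain B where "\<forall>x\<in>sphere 0 1. norm (f x) \<le> B" unfolding bounded_iff by auto
  moreover have "f \<in> borel_measurable sphere_lebesgue"
    using borel_measurable_continuous_on_restrict[OF assms] by (simp cong: measurable_cong_sets)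
  ultimately show ?thesis by (intro integrable_const_bound[of _ B]) (auto intro!: AE_I2)
qed

lemma integral_sphere_lebesgue_mono:
  fixes f g :: "'a::euclidean_space \<Rightarrow> real"
  assumes "continuous_on (sphere 0 1) f" "continuous_on (sphere 0 1) g" "\<And>x. norm x = 1 \<Longrightarrow> f x \<le> g x"
  shows "(\<integral>x. f x \<partial>sphere_lebesgue) \<le> (\<integral>x. g x \<partial>sphere_lebesgue)"
  by (intro integral_mono integrable_sphere_lebesgue assms) (use assms(3) in auto)

lemma integral_sphere_lebesgue_const [simp]:
  "(\<integral>x. c \<partial>(sphere_lebesgue :: 'a::euclidean_space measure)) = (c::real)"
  by (simp add: measure_def emeasure_sphere_lebesgue_space)

lemma integral_sphere_lebesgue_eq:
  fixes f :: "'a::euclidean_space \<Rightarrow> real"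
  assumes f: "f \<in> borel_measurable borel"
  shows "(\<integral>x. f x \<partial>sphere_lebesgue) = (\<integral>x. indicator punctured_ball x * f (sgn x) \<partial>lborel) / measure lborel (cball (0::'a) 1)"
proof -
  let ?B = "punctured_ball :: 'a set"
  let ?R = "restrict_space lborel ?B"
  define v where "v = measure lborel (cball (0::'a) 1)"
  have emB: "emeasure ?R ?B = ennreal v"
    unfolding v_def using emeasure_lborel_cball_finite[of "0 :: 'a" 1]
    by (subst emeasure_restrict_space) (auto simp: emeasure_punctured_ball emeasure_eq_ennreal_measure less_top)
  have Bset: "?B \<in> sets ?R" by (simp add: sets_restrict_space_iff)
  have v: "v > 0" unfolding v_def using content_cball_pos[of 1 "0 :: 'a"] by (simp add: measure_def)
  have fs: "f \<in> borel_measurable (restrict_space borel (sphere 0 1))"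
    using f by (rule measurable_restrict_space1)
  have fsgn: "(\<lambda>x. f (sgn x)) \<in> borel_measurable borel"
    by (rule measurable_compose[OF borel_measurable_sgn f])
  have "(\<integral>x. f x \<partial>sphere_lebesgue) = (\<integral>x. f (sgn x) \<partial>uniform_measure ?R ?B)"
    unfolding sphere_lebesgue_def by (rule integral_distr[OF sgn_measurable_punctured_ball fs])
  also have "\<dots> = (\<integral>x. f (sgn x) \<partial>density ?R (\<lambda>x. ennreal (1 / v)))"
  proof -
    have "uniform_measure ?R ?B = density ?R (\<lambda>x. ennreal (1 / v))"
      unfolding uniform_measure_def
      by (rule density_cong) (use v in \<open>auto simp: space_restrict_space emB divide_ennreal ennreal_1[symmetric] simp del: ennreal_1 intro!: AE_I2 borel_measurable_divide_ennreal borel_measurable_indicator[OF Bset]\<close>)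
    then show ?thesis by simp
  qed
  also have "\<dots> = (\<integral>x. (1 / v) * f (sgn x) \<partial>?R)"
    using v by (subst integral_density) (auto intro!: measurable_restrict_space1 fsgn)
  also have "\<dots> = (\<integral>x. f (sgn x) \<partial>?R) / v" by simp
  also have "(\<integral>x. f (sgn x) \<partial>?R) = (\<integral>x. indicator ?B x * f (sgn x) \<partial>lborel)"
    by (subst integral_restrict_space) auto
  finally show ?thesis by (simp add: v_def)
qed

text \<open>An orthogonal map commutes with \<open>sgn\<close> and preserves the punctured ball, so
  the invariance of Lebesgue measure passes to the sphere.\<close>

lemma integral_sphere_lebesgue_orthogonal_transformation:
  fixes T :: "real ^ 'n::finite \<Rightarrow> real ^ 'n" and f :: "real ^ 'n \<Rightarrow> real"
  assumes "orthogonal_transformation T" "f \<in> borel_measurable borel"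
  shows "(\<integral>x. f (T x) \<partial>sphere_lebesgue) = (\<integral>x. f x \<partial>sphere_lebesgue)"
proof -
  have lin: "linear T" and nT: "norm (T x) = norm x" for x using assms(1) by (auto simp: orthogonal_transformation)
  have Tm: "T \<in> borel_measurable borel"
    using lin by (intro borel_measurable_continuous_onI linear_continuous_on) (simp add: linear_conv_bounded_linear)
  have fT: "(\<lambda>x. f (T x)) \<in> borel_measurable borel" by (rule measurable_compose[OF Tm assms(2)])
  have sgnT: "sgn (T x) = T (sgn x)" for x by (simp add: sgn_div_norm nT linear_scale[OF lin])
  have ind: "indicator punctured_ball (T x) = (indicator punctured_ball x :: real)" for x
    using nT[of x] by (auto simp: punctured_ball_def indicator_def linear_0[OF lin])
  have g: "(\<lambda>x. indicator punctured_ball x * f (sgn x)) \<in> borel_measurable borel"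
    by (intro borel_measurable_times borel_measurable_indicator measurable_compose[OF borel_measurable_sgn assms(2)]) auto
  have "(\<integral>x. indicator punctured_ball x * f (T (sgn x)) \<partial>lborel) = (\<integral>x. indicator punctured_ball (T x) * f (sgn (T x)) \<partial>lborel)"
    by (simp add: ind sgnT)
  also have "\<dots> = (\<integral>x. indicator punctured_ball x * f (sgn x) \<partial>distr lborel borel T)"
    using Tm g by (subst integral_distr) auto
  finally show ?thesis
    by (simp add: integral_sphere_lebesgue_eq[OF assms(2)] integral_sphere_lebesgue_eq[OF fT]
        lborel_distr_orthogonal_transformation[OF assms(1)])
qed

text \<open>The cone over the cap contains at least \<open>1 / (2 * r)\<close> disjoint balls of
  radius \<open>r / 8\<close>, strung along the ray through \<open>z\<close>. Their number lowers
  the exponent of \<open>r\<close> by one, to the dimension of the sphere.\<close>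

lemma measure_sphere_cap_ge:
  fixes z :: "real ^ 'n::finite"
  assumes "norm z = 1" "0 < r" "r \<le> 1"
  shows "measure sphere_lebesgue (sphere 0 1 \<inter> ball z r) \<ge> r ^ (CARD('n) - 1) / (2 * 8 ^ CARD('n))"
proof -
  define A where "A = sphere 0 1 \<inter> ball z r"
  define K where "K = {s *\<^sub>R x | s x. 0 < s \<and> s \<le> 1 \<and> x \<in> A}"
  have Asub: "A \<subseteq> sphere 0 1" and Ab: "A \<in> sets borel" by (auto simp: A_def)
  have Keq: "K = sgn -` A \<inter> punctured_ball" unfolding K_def by (rule cone_eq_vimage_sgn[OF Asub])
  have Kb: "K \<in> sets borel"
    unfolding Keq using measurable_sets[OF borel_measurable_sgn Ab] by (simp add: punctured_ball_sets sets.Int)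
  define m where "m = nat \<lfloor>1 / r\<rfloor>"
  have m1: "real m \<le> 1 / r" using assms by (simp add: m_def)
  have m2: "1 / (2 * r) \<le> real m"
  proof -
    have "1 / r \<ge> 1" using assms by simp
    then have "\<lfloor>1 / r\<rfloor> \<ge> 1" by linarith
    then have "real m \<ge> 1" "real m \<ge> 1 / r - 1" unfolding m_def by linarith+
    then have "2 * real m \<ge> 1 / r" by simp
    then show ?thesis using assms by (simp add: field_simps)
  qed
  \<comment> \<open>The spacing \<open>r / 4\<close> is twice the radius. Centres have norm between
    \<open>1 / 2\<close> and \<open>3 / 4\<close>: the balls stay inside the unit ball, and each of
    the two error terms of the projection to the sphere is at most \<open>r / 4\<close>.\<close>
  define s where "s k = 1 / 2 + real k * r / 4" for k
  define Bk where "Bk k = ball (s k *\<^sub>R z) (r / 8)" for k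
  have sub: "Bk k \<subseteq> K" if k: "k < m" for k
  proof
    fix y assume "y \<in> Bk k"
    then have e: "norm (y - s k *\<^sub>R z) < r / 8" by (simp add: Bk_def dist_norm norm_minus_commute)
    have "real k \<le> 1 / r" using k m1 by linarith
    then have "real k * r \<le> 1" using assms by (simp add: field_simps)
    then have s: "1 / 2 \<le> s k" "s k \<le> 3 / 4" using assms by (auto simp: s_def)
    have ns: "norm (s k *\<^sub>R z) = s k" using s assms by simp
    have ny: "\<bar>s k - norm y\<bar> < r / 8" using e norm_triangle_ineq3[of y "s k *\<^sub>R z"] unfolding ns by linarith
    have yp: "norm y > 0" "norm y \<le> 1" using ny s assms by linarith+
    have "sgn y - z = (1 / norm y - 1 / s k) *\<^sub>R y + (1 / s k) *\<^sub>R (y - s k *\<^sub>R z)"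
      using s by (simp add: sgn_div_norm algebra_simps inverse_eq_divide)
    then have "norm (sgn y - z) \<le> norm ((1 / norm y - 1 / s k) *\<^sub>R y) + norm ((1 / s k) *\<^sub>R (y - s k *\<^sub>R z))"
      by (metis norm_triangle_ineq)
    also have "norm ((1 / norm y - 1 / s k) *\<^sub>R y) = \<bar>(1 / norm y - 1 / s k) * norm y\<bar>" by (simp add: abs_mult)
    also have "(1 / norm y - 1 / s k) * norm y = (s k - norm y) / s k" using yp s by (simp add: field_simps)
    also have "\<bar>(s k - norm y) / s k\<bar> = \<bar>s k - norm y\<bar> / s k" using s by simp
    also have "\<dots> \<le> (r / 8) / (1 / 2)" using ny s assms by (intro frac_le) auto
    also have "norm ((1 / s k) *\<^sub>R (y - s k *\<^sub>R z)) = norm (y - s k *\<^sub>R z) / s k" using s by simp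
    also have "\<dots> \<le> (r / 8) / (1 / 2)" using e s assms by (intro frac_le) auto
    finally have "norm (sgn y - z) < r" using assms by simp
    then have "sgn y \<in> A" using yp by (auto simp: A_def dist_norm norm_minus_commute norm_sgn)
    then show "y \<in> K" using yp by (auto simp: Keq punctured_ball_def)
  qed
  have disj: "disjoint_family_on Bk {..<m}"
    unfolding disjoint_family_on_def
  proof (intro ballI impI)
    fix k l :: nat assume "k \<noteq> l"
    then have "\<bar>real k - real l\<bar> \<ge> 1" by linarith
    then have "1 * r \<le> \<bar>real k - real l\<bar> * r" using assms by (intro mult_right_mono) auto
    moreover have "dist (s k *\<^sub>R z) (s l *\<^sub>R z) = \<bar>real k - real l\<bar> * r / 4"
    proof -
      have "s k *\<^sub>R z - s l *\<^sub>R z = ((real k - real l) * r / 4) *\<^sub>R z" by (simp add: s_def algebra_simps diff_divide_distrib)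
      then show ?thesis using assms by (simp add: dist_norm abs_mult)
    qed
    ultimately have "r / 8 + r / 8 \<le> dist (s k *\<^sub>R z) (s l *\<^sub>R z)" using assms by linarith
    then show "Bk k \<inter> Bk l = {}" unfolding Bk_def by (rule disjoint_ballI)
  qed
  define v where "v = unit_ball_vol (real CARD('n))"
  have v: "v > 0" unfolding v_def by simp
  have mB: "measure lborel (Bk k) = v * (r / 8) ^ CARD('n)" for k
    using assms content_ball[of "r / 8" "s k *\<^sub>R z"] by (simp add: Bk_def v_def measure_def)
  have finB: "emeasure lborel (Bk k) \<noteq> \<infinity>" for k
    using emeasure_lborel_ball_finite[of "s k *\<^sub>R z" "r / 8"] by (simp add: Bk_def less_top)
  have Bkb: "Bk k \<in> sets borel" for k by (simp add: Bk_def)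
  have bnd: "emeasure lborel K < \<infinity>"
  proof -
    have "emeasure lborel K \<le> emeasure lborel (cball (0::real ^ 'n) 1)"
      by (intro emeasure_mono) (auto simp: Keq punctured_ball_def)
    then show ?thesis using emeasure_lborel_cball_finite[of "0::real ^ 'n" 1] by (meson le_less_trans)
  qed
  have "real m * (v * (r / 8) ^ CARD('n)) = (\<Sum>k<m. measure lborel (Bk k))" by (simp add: mB)
  also have "\<dots> = measure lborel (\<Union>k<m. Bk k)"
    using disj finB
    by (intro measure_finite_Union[symmetric]) (auto simp: Bkb)
  also have "\<dots> \<le> measure lborel K"
    using sub Kb bnd by (intro measure_mono_fmeasurable) (auto simp: Bk_def fmeasurable_def)
  finally have *: "real m * (v * (r / 8) ^ CARD('n)) \<le> measure lborel K" .
  have vc: "measure lborel (cball (0::real^'n) 1) = v"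
    using content_cball[of 1 "0::real^'n"] by (simp add: v_def measure_def)
  have "emeasure sphere_lebesgue A = emeasure lborel K / emeasure lborel (cball 0 1 :: (real ^ 'n) set)"
    unfolding K_def by (rule emeasure_sphere_lebesgue[OF Ab Asub])
  also have "\<dots> = ennreal (measure lborel K) / ennreal v"
    using bnd emeasure_lborel_cball_finite[of "0::real ^ 'n" 1]
    by (simp add: emeasure_eq_ennreal_measure vc less_top)
  also have "\<dots> = ennreal (measure lborel K / v)" using v by (simp add: divide_ennreal)
  finally have "measure sphere_lebesgue A = measure lborel K / v"
    using v by (simp add: measure_def)
  also have "\<dots> \<ge> real m * (v * (r / 8) ^ CARD('n)) / v" using * v by (intro divide_right_mono) auto
  finally have "measure sphere_lebesgue A \<ge> real m * (r / 8) ^ CARD('n)" using v by simp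
  moreover have "1 / (2 * r) * (r / 8) ^ CARD('n) \<le> real m * (r / 8) ^ CARD('n)"
    using m2 assms by (intro mult_right_mono) auto
  moreover have "1 / (2 * r) * (r / 8) ^ CARD('n) = r ^ (CARD('n) - 1) / (2 * 8 ^ CARD('n))"
  proof -
    have "r ^ CARD('n) = r * r ^ (CARD('n) - 1)" by (simp flip: power_Suc)
    then show ?thesis using assms by (simp add: power_divide field_simps)
  qed
  ultimately show ?thesis unfolding A_def by simp
qed

section \<open>Oscillation of polynomials along rotations\<close>

text \<open>One operator has to serve all polynomials and all choices of angles. Each plane
  contributes the samples of \<open>trig_poly_oscillation\<close>, which are rotated copies of
  \<open>f\<close> and so have the same integral norm. If the tail has mass \<open>\<kappa>\<close>,
  the new mass plus one is \<open>exp (2 * t * \<rho>) * (1 + \<kappa>)\<close>, so the exponents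
  add along the list.\<close>

lemma ex_oscillation_operator:
  fixes L :: "'n::finite plane list"
  assumes "t \<ge> 1" "\<rho> \<ge> 0" "\<forall>p\<in>set L. fst p \<noteq> snd p"
  shows "\<exists>T. (\<forall>f. continuous_on UNIV f \<longrightarrow> continuous_on UNIV (T f) \<and> (\<forall>x. 0 \<le> T f x) \<and>
        (\<integral>x. T f x \<partial>sphere_lebesgue) \<le> (exp (2 * real t * \<rho> * real (length L)) - 1) * (\<integral>x. \<bar>f x\<bar> \<partial>sphere_lebesgue)) \<and>
      (\<forall>f x \<theta>. poly_le t f \<longrightarrow> (\<forall>p. \<bar>\<theta> p\<bar> \<le> \<rho>) \<longrightarrow> \<bar>f (rots L \<theta> x) - f x\<bar> \<le> T f x)"
  using assms(3)
proof (induction L)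
  case Nil
  show ?case by (intro exI[of _ "\<lambda>f x. 0"]) auto
next
  case (Cons p L)
  then have p: "fst p \<noteq> snd p" by simp
  define \<kappa> where "\<kappa> = exp (2 * real t * \<rho> * real (length L)) - 1"
  obtain T where T: "\<And>f. continuous_on UNIV f \<Longrightarrow> continuous_on UNIV (T f)" "\<And>f x. continuous_on UNIV f \<Longrightarrow> 0 \<le> T f x"
      "\<And>f. continuous_on UNIV f \<Longrightarrow> (\<integral>x. T f x \<partial>sphere_lebesgue) \<le> \<kappa> * (\<integral>x. \<bar>f x\<bar> \<partial>sphere_lebesgue)"
      "\<And>f x \<theta>. poly_le t f \<Longrightarrow> (\<And>p. \<bar>\<theta> p\<bar> \<le> \<rho>) \<Longrightarrow> \<bar>f (rots L \<theta> x) - f x\<bar> \<le> T f x"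
  proof -
    have "\<forall>p\<in>set L. fst p \<noteq> snd p" using Cons.prems by simp
    from Cons.IH[OF this] show ?thesis
      unfolding \<kappa>_def[symmetric] by (elim exE conjE) (rule that; blast)
  qed
  obtain M :: nat and u a where a: "\<And>j. j < M \<Longrightarrow> a j \<ge> 0" "(\<Sum>j<M. a j) \<le> exp (2 * real t * \<rho>) - 1"
    "\<And>f \<theta>. trig_poly t f \<Longrightarrow> \<bar>\<theta>\<bar> \<le> \<rho> \<Longrightarrow> cmod (f \<theta> - f 0) \<le> (\<Sum>j<M. a j * cmod (f (u j)))"
    using trig_poly_oscillation[OF assms(1,2)] by blast
  define F where "F f j = (\<lambda>y. f (rot p (u j) y))" for f :: "real ^ 'n \<Rightarrow> real" and j
  define T' where "T' f x = T f x + (\<Sum>j<M. a j * (\<bar>F f j x\<bar> + T (F f j) x))" for f x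
  have Fc: "continuous_on UNIV (F f j)" if "continuous_on UNIV f" for f j
    unfolding F_def by (rule continuous_on_compose2[OF that]) (auto intro!: continuous_intros)
  have cT': "continuous_on UNIV (T' f)" if "continuous_on UNIV f" for f
    unfolding T'_def by (intro continuous_intros T(1) Fc that)
  have pos: "0 \<le> T' f x" if "continuous_on UNIV f" for f x
    unfolding T'_def by (intro add_nonneg_nonneg sum_nonneg mult_nonneg_nonneg T(2) Fc that a) auto
  have int: "(\<integral>x. T' f x \<partial>sphere_lebesgue) \<le> (exp (2 * real t * \<rho> * real (length (p # L))) - 1) * (\<integral>x. \<bar>f x\<bar> \<partial>sphere_lebesgue)"
    if f: "continuous_on UNIV f" for f
  proof -
    define I where "I = (\<integral>x. \<bar>f x\<bar> \<partial>sphere_lebesgue)"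
    have I: "I \<ge> 0" unfolding I_def by simp
    have integ: "integrable sphere_lebesgue g" if "continuous_on UNIV g" for g :: "real ^ 'n \<Rightarrow> real"
      using that by (intro integrable_sphere_lebesgue) (rule continuous_on_subset, auto)
    have IF: "(\<integral>x. \<bar>F f j x\<bar> \<partial>sphere_lebesgue) = I" for j
      unfolding F_def I_def
      using orthogonal_transformation_rot[OF p] borel_measurable_continuous_onI[OF continuous_on_rabs[OF f]]
      by (rule integral_sphere_lebesgue_orthogonal_transformation)
    have "(\<integral>x. T' f x \<partial>sphere_lebesgue) = (\<integral>x. T f x \<partial>sphere_lebesgue) +
        (\<Sum>j<M. a j * ((\<integral>x. \<bar>F f j x\<bar> \<partial>sphere_lebesgue) + (\<integral>x. T (F f j) x \<partial>sphere_lebesgue)))"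
      unfolding T'_def
      by (simp add: integ T(1) Fc f Bochner_Integration.integral_add Bochner_Integration.integral_sum continuous_on_rabs)
    also have "\<dots> \<le> \<kappa> * I + (\<Sum>j<M. a j * (I + \<kappa> * I))"
    proof (intro add_mono sum_mono mult_left_mono)
      show "(\<integral>x. T f x \<partial>sphere_lebesgue) \<le> \<kappa> * I" unfolding I_def by (rule T(3)[OF f])
      show "(\<integral>x. T (F f j) x \<partial>sphere_lebesgue) \<le> \<kappa> * I" for j using T(3)[OF Fc[OF f], of j] by (simp add: IF)
    qed (auto simp: IF a)
    also have "(\<Sum>j<M. a j * (I + \<kappa> * I)) = (\<Sum>j<M. a j) * ((1 + \<kappa>) * I)"
      by (simp only: sum_distrib_right[symmetric]) (simp add: algebra_simps)
    also have "\<kappa> * I + (\<Sum>j<M. a j) * ((1 + \<kappa>) * I) \<le> \<kappa> * I + (exp (2 * real t * \<rho>) - 1) * ((1 + \<kappa>) * I)"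
      using a(2) I by (intro add_left_mono mult_right_mono) (auto simp: \<kappa>_def)
    also have "\<dots> = (exp (2 * real t * \<rho>) * (1 + \<kappa>) - 1) * I" by (simp add: algebra_simps)
    also have "exp (2 * real t * \<rho>) * (1 + \<kappa>) = exp (2 * real t * \<rho> * real (length (p # L)))"
      by (simp add: \<kappa>_def algebra_simps flip: exp_add)
    finally show ?thesis unfolding I_def .
  qed
  have dom: "\<bar>f (rots (p # L) \<theta> x) - f x\<bar> \<le> T' f x" if f: "poly_le t f" and th: "\<forall>p. \<bar>\<theta> p\<bar> \<le> \<rho>" for f x \<theta>
  proof -
    define z where "z = rots L \<theta> x"
    have "\<bar>f (rot p (\<theta> p) z) - f z\<bar> \<le> (\<Sum>j<M. a j * \<bar>f (rot p (u j) z)\<bar>)"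
      using a(3)[OF poly_le_trig_poly[OF f, of p z], of "\<theta> p"] th by (simp flip: of_real_diff)
    \<comment> \<open>The samples are taken at \<open>z\<close>, which depends on the angles. The
      estimate for the tail, applied to the rotated polynomial \<open>F f j\<close>, returns from
      \<open>z\<close> to \<open>x\<close>.\<close>
    also have "\<dots> \<le> (\<Sum>j<M. a j * (\<bar>F f j x\<bar> + T (F f j) x))"
    proof (intro sum_mono mult_left_mono)
      fix j assume "j \<in> {..<M}"
      show "\<bar>f (rot p (u j) z)\<bar> \<le> \<bar>F f j x\<bar> + T (F f j) x"
        using T(4)[of "F f j" \<theta> x] poly_le_rot[OF f, of p "u j"] th unfolding F_def z_def by fastforce
    qed (auto simp: a)
    finally show ?thesis using T(4)[OF f, of \<theta> x] th unfolding T'_def z_def by (auto simp: z_def)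
  qed
  show ?case using cT' pos int dom by (intro exI[of _ T']) blast
qed

text \<open>The left-hand side of the equation is the new value of a coordinate \<open>X\<close>
  when it is rotated against a coordinate \<open>A\<close>. At the angles
  \<open>\<plusminus>u\<close> with \<open>u = 8 / c * r\<close> the sine term has size at least
  \<open>2 * r\<close>, while the cosine changes \<open>X\<close> by at most
  \<open>u\<^sup>2 / 2\<close>, hence by at most \<open>r\<close>. The intermediate value theorem
  does the rest; \<open>r \<le> c\<^sup>2 / 32\<close> is equivalent to
  \<open>u \<le> c / 4\<close>.\<close>

lemma ex_angle:
  fixes A X Y r c :: real
  assumes "0 < c" "c \<le> 1" "A \<ge> c / 2" "\<bar>X\<bar> \<le> 1" "\<bar>X - Y\<bar> \<le> r" "r \<le> c\<^sup>2 / 32"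
  shows "\<exists>\<phi>. \<bar>\<phi>\<bar> \<le> 8 / c * r \<and> A * sin \<phi> + X * cos \<phi> = Y"
proof -
  define u where "u = 8 / c * r"
  have r: "0 \<le> r" using assms by linarith
  have u0: "0 \<le> u" using r assms by (simp add: u_def)
  have uc: "u \<le> c / 4" using assms by (simp add: u_def field_simps power2_eq_square)
  have cos_ge: "1 - cos v \<le> v\<^sup>2 / 2" for v :: real
  proof -
    have "1 - cos v = 2 * (sin (v / 2))\<^sup>2" using cos_double_sin[of "v / 2"] by simp
    also have "2 * (sin (v / 2))\<^sup>2 \<le> 2 * (v / 2)\<^sup>2"
      using abs_sin_x_le_abs_x[of "v / 2"] unfolding abs_le_square_iff by simp
    finally show ?thesis by (simp add: power2_eq_square)
  qed
  note cosu = cos_ge[of u]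
  have sinu: "sin u \<ge> u / 2"
  proof -
    have "sin 0 - 0 / 2 \<le> sin u - u / 2"
    proof (rule DERIV_nonneg_imp_nondecreasing[OF u0])
      fix v assume v: "0 \<le> v" "v \<le> u"
      have "v\<^sup>2 \<le> 1" using v uc assms by (simp add: power_le_one)
      then have "cos v - 1 / 2 \<ge> 0" using cos_ge[of v] by linarith
      moreover have "((\<lambda>v. sin v - v / 2) has_real_derivative cos v - 1 / 2) (at v)"
        by (auto intro!: derivative_eq_intros)
      ultimately show "\<exists>y. ((\<lambda>v. sin v - v / 2) has_real_derivative y) (at v) \<and> 0 \<le> y" by blast
    qed
    then show ?thesis by simp
  qed
  have main: "A * sin u \<ge> r + u\<^sup>2 / 2"
  proof -
    have "u\<^sup>2 / 2 \<le> r"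
    proof -
      have "u * u \<le> u * (c / 4)" using uc u0 by (intro mult_left_mono)
      also have "\<dots> = 2 * r" using assms by (simp add: u_def)
      finally show ?thesis by (simp add: power2_eq_square)
    qed
    moreover have "(c / 2) * (u / 2) \<le> A * sin u" using assms sinu u0 by (intro mult_mono) auto
    moreover have "(c / 2) * (u / 2) = 2 * r" using assms by (simp add: u_def)
    ultimately show ?thesis by linarith
  qed
  have Xc: "\<bar>X * cos u - X\<bar> \<le> u\<^sup>2 / 2"
  proof -
    have "\<bar>X * cos u - X\<bar> = \<bar>X\<bar> * (1 - cos u)"     proof -
      have "X * cos u - X = - (X * (1 - cos u))" by (simp add: algebra_simps)
      then show ?thesis by (simp add: abs_mult)
    qed
    also have "\<dots> \<le> 1 * (1 - cos u)" using assms by (intro mult_right_mono) auto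
    also have "\<dots> \<le> u\<^sup>2 / 2" using cosu by simp
    finally show ?thesis .
  qed
  define S W q where "S = A * sin u" and "W = X * cos u" and "q = u\<^sup>2 / 2"
  have SW: "S \<ge> r + q" "\<bar>W - X\<bar> \<le> q" using main Xc by (simp_all add: S_def W_def q_def)
  have "\<exists>\<phi>\<ge>- u. \<phi> \<le> u \<and> A * sin \<phi> + X * cos \<phi> = Y"
  proof (rule IVT')
    show "A * sin (- u) + X * cos (- u) \<le> Y" using SW assms by (simp flip: S_def W_def)
    show "Y \<le> A * sin u + X * cos u" using SW assms by (simp flip: S_def W_def)
  qed (use u0 in \<open>auto intro!: continuous_intros\<close>)
  then obtain \<phi> where "- u \<le> \<phi>" "\<phi> \<le> u" "A * sin \<phi> + X * cos \<phi> = Y" by blast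
  then show ?thesis by (intro exI[of _ \<phi>]) (auto simp: u_def)
qed

text \<open>Some coordinate \<open>k\<close> of \<open>x\<close> is not small. Rotations in the
  planes \<open>(k, j)\<close> set the coordinates \<open>j \<noteq> k\<close> to those of
  \<open>y\<close> one after the other, and all other planes get angle \<open>0\<close>. The norm
  then determines coordinate \<open>k\<close> up to sign, and closeness determines the sign. As
  \<open>k\<close> depends on \<open>x\<close> but the list must not, the list contains all
  pairs.\<close>

lemma ex_rots_eq:
  fixes L :: "'n::finite plane list"
  assumes L: "distinct L" "set L = {p. fst p \<noteq> snd p}"
  shows "\<exists>C\<ge>1. \<exists>r0>0. \<forall>x y r. norm x = 1 \<longrightarrow> norm y = 1 \<longrightarrow> dist x y \<le> r \<longrightarrow> r \<le> r0 \<longrightarrow>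
    (\<exists>\<theta>. (\<forall>p. \<bar>\<theta> p\<bar> \<le> C * r) \<and> rots L \<theta> x = y)"
proof -
  define c where "c = 1 / real CARD('n)"
  have c: "0 < c" "c \<le> 1" by (auto simp: c_def Suc_le_eq)
  define C where "C = 8 / c"
  have C: "C \<ge> 8" using c by (simp add: C_def field_simps)
  \<comment> \<open>The first bound is the one required by \<open>ex_angle\<close>; the second keeps
    the total displacement below \<open>c / 2\<close>, so coordinate \<open>k\<close> has size at
    least \<open>c / 2\<close> throughout.\<close>
  define r0 where "r0 = min (c\<^sup>2 / 32) (c / (2 * C * (real (length L) + 1)))"
  have r0: "r0 > 0" using c C by (simp add: r0_def)
  have "\<exists>\<theta>. (\<forall>p. \<bar>\<theta> p\<bar> \<le> C * r) \<and> rots L \<theta> x = y"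
    if x: "norm x = 1" and y: "norm y = 1" and dxy: "dist x y \<le> r" and rr0: "r \<le> r0" for x y :: "real ^ 'n" and r
  proof -
    have r: "0 \<le> r" using dxy zero_le_dist[of x y] by linarith
    have rc: "r \<le> c\<^sup>2 / 32" using rr0 by (simp add: r0_def)
    have mr: "real (length L) * (C * r) \<le> c / 2"
    proof -
      have "C * r \<le> C * (c / (2 * C * (real (length L) + 1)))" using rr0 C by (intro mult_left_mono) (auto simp: r0_def)
      also have "\<dots> = c / 2 / (real (length L) + 1)" using C by simp
      finally have "real (length L) * (C * r) \<le> real (length L) * (c / 2 / (real (length L) + 1))" by (intro mult_left_mono) auto
      also have "\<dots> \<le> c / 2" using c by (simp add: field_simps)
      finally show ?thesis .
    qed
    obtain k where k: "\<bar>x $ k\<bar> \<ge> c"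
    proof (rule ccontr)
      assume "\<not> thesis"
      then have "\<bar>x $ i\<bar> < c" for i using that[of i] by (metis not_le)
      then have "(\<Sum>i\<in>UNIV. \<bar>x $ i\<bar>) < (\<Sum>i\<in>(UNIV::'n set). c)" by (intro sum_strict_mono) auto
      also have "\<dots> = 1" by (simp add: c_def)
      finally show False using norm_le_l1_cart[of x] x by simp
    qed
    have comp: "\<bar>v $ i\<bar> \<le> 1" if "norm v = 1" for v :: "real ^ 'n" and i
      using component_le_norm_cart[of v i] that by simp
    have "\<exists>\<theta>. (\<forall>p. \<bar>\<theta> p\<bar> \<le> C * r) \<and>
        (\<forall>j. j \<noteq> k \<longrightarrow> rots L' \<theta> x $ j = (if (k, j) \<in> set L' then y $ j else x $ j))"
      if "distinct L'" "\<forall>p\<in>set L'. fst p \<noteq> snd p" "length L' \<le> length L" for L'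
      using that
    proof (induction L')
      case Nil
      then show ?case using r C by (intro exI[of _ "\<lambda>p. 0"]) auto
    next
      case (Cons p L')
      then obtain \<theta> where th: "\<And>p. \<bar>\<theta> p\<bar> \<le> C * r"
        "\<And>j. j \<noteq> k \<Longrightarrow> rots L' \<theta> x $ j = (if (k, j) \<in> set L' then y $ j else x $ j)" by auto
      define z where "z = rots L' \<theta> x"
      have z1: "norm z = 1" using Cons.prems x by (simp add: z_def norm_rots)
      have upd: "rots (p # L') (\<theta>(p := \<phi>)) x = rot p \<phi> z" for \<phi>
      proof -
        have "rots L' (\<theta>(p := \<phi>)) x = z" unfolding z_def by (rule rots_cong) (use Cons.prems in auto)
        then show ?thesis by simp
      qed
      have Cr: "0 \<le> C * r" using C r by simp
      show ?case
      proof (cases "fst p = k")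
        case False
        then show ?thesis
          using th Cr by (intro exI[of _ "\<theta>(p := 0)"]) (unfold upd, auto simp: z_def)
      next
        case True
        define j where "j = snd p"
        have p: "p = (k, j)" and jk: "j \<noteq> k" using True Cons.prems by (auto simp: j_def)
        have "dist z x \<le> real (length L') * (C * r)"
          unfolding z_def using Cons.prems th x by (intro dist_rots_self) auto
        also have "\<dots> \<le> real (length L) * (C * r)" using Cons.prems r C by (intro mult_right_mono) auto
        finally have "dist z x \<le> c / 2" using mr by linarith
        then have "\<bar>z $ k - x $ k\<bar> \<le> c / 2" using dist_vec_nth_le[of z k x] by (simp add: dist_real_def)
        then have zk: "\<bar>z $ k\<bar> \<ge> c / 2" using k by linarith
        have zj: "z $ j = x $ j" using th(2)[OF jk] Cons.prems p by (simp add: z_def)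
        have "\<bar>z $ j - y $ j\<bar> \<le> r" using dist_vec_nth_le[of x j y] dxy by (simp add: dist_real_def zj)
        then obtain \<phi> where \<phi>: "\<bar>\<phi>\<bar> \<le> C * r" "\<bar>z $ k\<bar> * sin \<phi> + z $ j * cos \<phi> = y $ j"
          using ex_angle[OF c zk comp[OF z1], of j "y $ j" r] rc by (auto simp: C_def)
        \<comment> \<open>\<open>ex_angle\<close> assumes a positive pivot; the sign of the actual
          pivot goes into the angle.\<close>
        define \<psi> where "\<psi> = sgn (z $ k) * \<phi>"
        have psi: "\<bar>\<psi>\<bar> \<le> C * r" using \<phi>(1) zk c by (simp add: \<psi>_def abs_mult abs_sgn_eq)
        have yj: "z $ k * sin \<psi> + z $ j * cos \<psi> = y $ j"
          using \<phi>(2) zk c by (cases "z $ k > 0"; cases "z $ k < 0") (auto simp: \<psi>_def)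
        have 1: "rot p \<psi> z $ j = y $ j" using yj jk by (simp add: rot_def p mult_ac add_ac)
        have 2: "rot p \<psi> z $ i = z $ i" if "i \<noteq> j" "i \<noteq> k" for i using that by (simp add: rot_def p)
        have "rot p \<psi> z $ i = (if (k, i) \<in> set (p # L') then y $ i else x $ i)" if "i \<noteq> k" for i
          using 1 2[of i] th(2)[OF that] that by (cases "i = j") (auto simp: p z_def)
        then show ?thesis
          using th(1) psi by (intro exI[of _ "\<theta>(p := \<psi>)"]) (unfold upd, auto)
      qed
    qed
    from this[of L] obtain \<theta> where th: "\<And>p. \<bar>\<theta> p\<bar> \<le> C * r"
        "\<And>j. j \<noteq> k \<Longrightarrow> rots L \<theta> x $ j = (if (k, j) \<in> set L then y $ j else x $ j)"
      using L by auto
    define z where "z = rots L \<theta> x"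
    have z1: "norm z = 1" using L x by (simp add: z_def norm_rots)
    have zj: "z $ j = y $ j" if "j \<noteq> k" for j using th(2)[OF that] L(2) that by (simp add: z_def)
    have "(\<Sum>i\<in>UNIV. (z $ i)\<^sup>2) = (\<Sum>i\<in>UNIV. (y $ i)\<^sup>2)"
      using z1 y by (simp add: norm_vec_def L2_set_def)
    then have "(z $ k)\<^sup>2 = (y $ k)\<^sup>2"
      by (simp add: sum.remove[of UNIV k] zj)
    then have sq: "z $ k = y $ k \<or> z $ k = - y $ k" by (simp add: power2_eq_iff)
    have "dist z x \<le> real (length L) * (C * r)"
      unfolding z_def using L th x by (intro dist_rots_self) auto
    then have "dist z x \<le> c / 2" using mr by linarith
    then have zx: "\<bar>z $ k - x $ k\<bar> \<le> c / 2" using dist_vec_nth_le[of z k x] by (simp add: dist_real_def)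
    have "c\<^sup>2 \<le> c" using c by (simp add: power2_eq_square mult_left_le)
    then have "r \<le> c / 32" using rc by linarith
    moreover have "\<bar>x $ k - y $ k\<bar> \<le> r" using dist_vec_nth_le[of x k y] dxy by (simp add: dist_real_def)
    ultimately have "z $ k = y $ k" using sq zx k c by linarith
    then have "z = y" using zj by (metis vec_eq_iff)
    then show ?thesis using th z_def by blast
  qed
  then show ?thesis using C r0 by (intro exI[of _ C] conjI exI[of _ r0]) auto
qed

text \<open>The mean value theorem for each rotation, telescoped. The reference values
  \<open>q p\<close> need not be derivatives at \<open>x\<close>: they are later taken at a
  neighbouring point of integration, or set to zero.\<close>

lemma rots_first_order:
  fixes P :: "real ^ 'n::finite \<Rightarrow> real"
  assumes "\<forall>p\<in>set L. fst p \<noteq> snd p" "\<forall>p\<in>set L. rot_deriv p P (Q p)"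
    "\<And>p. \<bar>\<theta> p\<bar> \<le> \<eta>" "norm x = 1" "real (length L) * \<eta> \<le> R"
    "\<And>p w. p \<in> set L \<Longrightarrow> norm w = 1 \<Longrightarrow> dist w x \<le> R \<Longrightarrow> \<bar>Q p w - q p\<bar> \<le> B p"
  shows "\<bar>P (rots L \<theta> x) - P x - (\<Sum>p\<leftarrow>L. \<theta> p * q p)\<bar> \<le> \<eta> * (\<Sum>p\<leftarrow>L. B p)"
  using assms(1,2,5,6)
proof (induction L)
  case (Cons p L)
  have \<eta>: "\<eta> \<ge> 0" using assms(3)[of undefined] by linarith
  define z where "z = rots L \<theta> x"
  have z1: "norm z = 1" using Cons.prems assms(4) by (simp add: z_def norm_rots)
  have dz: "dist z x \<le> real (length L) * \<eta>"
    unfolding z_def using Cons.prems assms by (intro dist_rots_self) auto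
  have p: "fst p \<noteq> snd p" using Cons.prems by simp
  have der: "((\<lambda>\<theta>. P (rot p \<theta> z)) has_real_derivative Q p (rot p \<tau> z)) (at \<tau>)" for \<tau>
    using Cons.prems by (simp add: rot_deriv_def)
  have "\<exists>\<tau>. \<bar>\<tau>\<bar> \<le> \<bar>\<theta> p\<bar> \<and> P (rot p (\<theta> p) z) - P z = \<theta> p * Q p (rot p \<tau> z)"
  proof (cases "\<theta> p = 0")
    case True
    then show ?thesis by (intro exI[of _ 0]) simp
  next
    case False
    then consider "\<theta> p > 0" | "\<theta> p < 0" by linarith
    then show ?thesis
    proof cases
      case 1
      from MVT2[OF 1, of "\<lambda>\<theta>. P (rot p \<theta> z)" "\<lambda>\<tau>. Q p (rot p \<tau> z)"] der
      obtain \<tau> where "0 < \<tau>" "\<tau> < \<theta> p" "P (rot p (\<theta> p) z) - P (rot p 0 z) = (\<theta> p - 0) * Q p (rot p \<tau> z)" by blast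
      then show ?thesis by (intro exI[of _ \<tau>]) auto
    next
      case 2
      from MVT2[OF 2, of "\<lambda>\<theta>. P (rot p \<theta> z)" "\<lambda>\<tau>. Q p (rot p \<tau> z)"] der
      obtain \<tau> where "\<theta> p < \<tau>" "\<tau> < 0" "P (rot p 0 z) - P (rot p (\<theta> p) z) = (0 - \<theta> p) * Q p (rot p \<tau> z)" by blast
      then show ?thesis by (intro exI[of _ \<tau>]) auto
    qed
  qed
  then obtain \<tau> where \<tau>: "\<bar>\<tau>\<bar> \<le> \<bar>\<theta> p\<bar>" "P (rot p (\<theta> p) z) - P z = \<theta> p * Q p (rot p \<tau> z)" by blast
  have "dist (rot p \<tau> z) x \<le> dist (rot p \<tau> z) z + dist z x" by (rule dist_triangle)
  also have "\<dots> \<le> \<eta> + real (length L) * \<eta>"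
    using dist_rot_self[OF p, of \<tau> z] z1 \<tau>(1) assms(3)[of p] dz by simp
  also have "\<dots> \<le> R" using Cons.prems by (simp add: algebra_simps)
  finally have "\<bar>Q p (rot p \<tau> z) - q p\<bar> \<le> B p"
    using z1 by (intro Cons.prems(4)) (auto simp: norm_rot[OF p])
  then have "\<bar>\<theta> p\<bar> * \<bar>Q p (rot p \<tau> z) - q p\<bar> \<le> \<eta> * B p"
    using assms(3)[of p] \<eta> by (intro mult_mono) auto
  moreover have "P (rot p (\<theta> p) z) - P z - \<theta> p * q p = \<theta> p * (Q p (rot p \<tau> z) - q p)"
    unfolding \<tau>(2) by (simp add: algebra_simps)
  ultimately have 1: "\<bar>P (rot p (\<theta> p) z) - P z - \<theta> p * q p\<bar> \<le> \<eta> * B p" by (simp add: abs_mult)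
  have "real (length L) * \<eta> \<le> R" using Cons.prems(3) \<eta> by (simp add: algebra_simps)
  then have 2: "\<bar>P z - P x - (\<Sum>p\<leftarrow>L. \<theta> p * q p)\<bar> \<le> \<eta> * (\<Sum>p\<leftarrow>L. B p)"
    unfolding z_def using Cons by simp
  show ?case using 1 2 by (simp add: z_def[symmetric] distrib_left abs_le_iff)
qed simp

section \<open>Steering fields and equidistributed points\<close>

text \<open>A continuous substitute for the sign of \<open>r\<close>, exact once
  \<open>\<bar>r\<bar> \<ge> \<epsilon>\<close>. Multiplied by \<open>r\<close>, it falls short of
  \<open>\<bar>r\<bar>\<close> by at most \<open>\<epsilon>\<close>.\<close>

definition clip :: "real \<Rightarrow> real \<Rightarrow> real" where
  "clip \<epsilon> r = max (-1) (min 1 (r / \<epsilon>))"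

lemma clip_bounds: "-1 \<le> clip \<epsilon> r" "clip \<epsilon> r \<le> 1" "\<bar>clip \<epsilon> r\<bar> \<le> 1"
  by (auto simp: clip_def)

lemma clip_lipschitz:
  assumes "\<epsilon> > 0"
  shows "clip \<epsilon> r - clip \<epsilon> s \<le> \<bar>r - s\<bar> / \<epsilon>"
proof -
  have "r / \<epsilon> - s / \<epsilon> \<le> \<bar>r - s\<bar> / \<epsilon>" "0 \<le> \<bar>r - s\<bar> / \<epsilon>"
    using assms by (auto simp: divide_right_mono simp flip: diff_divide_distrib)
  then show ?thesis unfolding clip_def by linarith
qed

lemma clip_mult_ge:
  assumes "\<epsilon> > 0"
  shows "clip \<epsilon> r * r \<ge> \<bar>r\<bar> - \<epsilon>"
proof -
  consider "r \<ge> \<epsilon>" | "r \<le> - \<epsilon>" | "\<bar>r\<bar> < \<epsilon>" by linarith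
  then show ?thesis
  proof cases
    case 3
    then have "clip \<epsilon> r = r / \<epsilon>" using assms by (auto simp: clip_def field_simps max_def min_def)
    then have "clip \<epsilon> r * r \<ge> 0" using assms by simp
    then show ?thesis using 3 by linarith
  qed (use assms in \<open>auto simp: clip_def field_simps max_def min_def\<close>)
qed

text \<open>The McShane regularization of the clipped function turns it into a \<open>1 / \<rho>\<close>-Lipschitz one,
  whose value at \<open>x\<close> is still controlled by values of \<open>q\<close> within distance \<open>2 \<rho>\<close> of \<open>x\<close>.\<close>

definition steer :: "real \<Rightarrow> real \<Rightarrow> ('a::euclidean_space \<Rightarrow> real) \<Rightarrow> 'a \<Rightarrow> real" where
  "steer \<epsilon> \<rho> q x = (INF y\<in>sphere 0 1. clip \<epsilon> (q y) + dist x y / \<rho>)"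

context
  fixes \<epsilon> \<rho> :: real
  assumes pos: "\<epsilon> > 0" "\<rho> > 0"
begin

lemma steer_le:
  assumes "norm y = 1"
  shows "steer \<epsilon> \<rho> q x \<le> clip \<epsilon> (q y) + dist x y / \<rho>"
  unfolding steer_def
proof (rule cINF_lower)
  show "bdd_below ((\<lambda>y. clip \<epsilon> (q y) + dist x y / \<rho>) ` sphere 0 1)"
  proof (rule bdd_belowI2[where m = "-1"])
    fix y show "-1 \<le> clip \<epsilon> (q y) + dist x y / \<rho>"
      using clip_bounds(1)[of \<epsilon> "q y"] pos by (simp add: add_increasing2)
  qed
qed (use assms in auto)

lemma steer_attained:
  assumes q: "continuous_on (sphere 0 1) q" and x: "norm x = 1"
  shows "\<exists>y. norm y = 1 \<and> steer \<epsilon> \<rho> q x = clip \<epsilon> (q y) + dist x y / \<rho>"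
proof -
  have "continuous_on (sphere 0 1) (\<lambda>y. clip \<epsilon> (q y) + dist x y / \<rho>)"
    unfolding clip_def using pos q by (intro continuous_intros) auto
  moreover have "sphere 0 1 \<noteq> ({} :: 'a set)" using x by auto
  ultimately obtain y where y: "y \<in> sphere 0 1"
     "\<And>w. w \<in> sphere 0 1 \<Longrightarrow> clip \<epsilon> (q y) + dist x y / \<rho> \<le> clip \<epsilon> (q w) + dist x w / \<rho>"
    using continuous_attains_inf[OF compact_sphere] by blast
  have "clip \<epsilon> (q y) + dist x y / \<rho> \<le> steer \<epsilon> \<rho> q x"
    unfolding steer_def by (rule cINF_greatest) (use y in auto)
  then show ?thesis using y(1) steer_le[of y q x] by (intro exI[of _ y]) auto
qed

lemma steer_abs_le:
  assumes q: "continuous_on (sphere 0 1) q" and x: "norm x = 1"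
  shows "\<bar>steer \<epsilon> \<rho> q x\<bar> \<le> 1"
proof -
  obtain y where "steer \<epsilon> \<rho> q x = clip \<epsilon> (q y) + dist x y / \<rho>" using steer_attained[OF assms] by blast
  then have "-1 \<le> steer \<epsilon> \<rho> q x" using clip_bounds(1)[of \<epsilon> "q y"] pos by (simp add: add_increasing2)
  moreover have "steer \<epsilon> \<rho> q x \<le> 1" using steer_le[OF x, of q x] clip_bounds(2)[of \<epsilon> "q x"] by simp
  ultimately show ?thesis by simp
qed

lemma steer_lipschitz:
  assumes q: "continuous_on (sphere 0 1) q" and x: "norm x = 1" "norm x' = 1"
  shows "\<bar>steer \<epsilon> \<rho> q x - steer \<epsilon> \<rho> q x'\<bar> \<le> dist x x' / \<rho>"
proof -
  have "steer \<epsilon> \<rho> q x \<le> steer \<epsilon> \<rho> q x' + dist x x' / \<rho>" if x': "norm x' = 1" for x x'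
  proof -
    obtain y where y: "norm y = 1" "steer \<epsilon> \<rho> q x' = clip \<epsilon> (q y) + dist x' y / \<rho>"
      using steer_attained[OF q x'] by blast
    have "steer \<epsilon> \<rho> q x \<le> clip \<epsilon> (q y) + dist x y / \<rho>" by (rule steer_le[OF y(1)])
    also have "dist x y / \<rho> \<le> dist x x' / \<rho> + dist x' y / \<rho>"
      using pos dist_triangle[of x y x'] by (simp add: divide_right_mono flip: add_divide_distrib)
    finally show ?thesis using y(2) by simp
  qed
  from this[OF x(1), of x'] this[OF x(2), of x] show ?thesis by (simp add: dist_commute abs_le_iff)
qed

text \<open>An infimum changes no more than the functions under it, and \<open>clip\<close> has
  Lipschitz constant \<open>1 / \<epsilon>\<close>. This provides the continuity in the polynomial
  on which the topological argument rests.\<close>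

lemma steer_stable:
  assumes "continuous_on (sphere 0 1) q" "continuous_on (sphere 0 1) q'" "norm x = 1"
    and "\<And>y. norm y = 1 \<Longrightarrow> \<bar>q y - q' y\<bar> \<le> \<eta>"
  shows "\<bar>steer \<epsilon> \<rho> q x - steer \<epsilon> \<rho> q' x\<bar> \<le> \<eta> / \<epsilon>"
proof -
  have "steer \<epsilon> \<rho> q x \<le> steer \<epsilon> \<rho> q' x + \<eta> / \<epsilon>"
    if q': "continuous_on (sphere 0 1) q'" and d: "\<And>y. norm y = 1 \<Longrightarrow> \<bar>q y - q' y\<bar> \<le> \<eta>" for q q'
  proof -
    obtain y where y: "norm y = 1" "steer \<epsilon> \<rho> q' x = clip \<epsilon> (q' y) + dist x y / \<rho>"
      using steer_attained[OF q' assms(3)] by blast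
    have "clip \<epsilon> (q y) - clip \<epsilon> (q' y) \<le> \<bar>q y - q' y\<bar> / \<epsilon>" by (rule clip_lipschitz[OF pos(1)])
    also have "\<dots> \<le> \<eta> / \<epsilon>" using d[OF y(1)] pos by (simp add: divide_right_mono)
    finally show ?thesis using steer_le[OF y(1), of q x] y(2) by simp
  qed
  from this[OF assms(2), of q] this[OF assms(1), of q'] assms(4) show ?thesis
    by (simp add: abs_minus_commute abs_le_iff)
qed

text \<open>The minimizer lies within \<open>2 * \<rho>\<close> of \<open>x\<close>, because
  \<open>clip\<close> and \<open>steer\<close> both take values between \<open>-1\<close> and
  \<open>1\<close>. For \<open>r \<ge> 0\<close> compare with the clipped value at the minimizer,
  which is below \<open>steer\<close>; for \<open>r < 0\<close> with the one at \<open>x\<close>,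
  which is above it.\<close>

lemma steer_mult_ge:
  assumes q: "continuous_on (sphere 0 1) q" and x: "norm x = 1"
    and B: "\<And>w. norm w = 1 \<Longrightarrow> dist w x \<le> 2 * \<rho> \<Longrightarrow> \<bar>q w - r\<bar> \<le> B"
  shows "steer \<epsilon> \<rho> q x * r \<ge> \<bar>r\<bar> - \<epsilon> - 2 * B"
proof -
  have clip_ge: "clip \<epsilon> (q w) * r \<ge> \<bar>r\<bar> - \<epsilon> - 2 * B" if "norm w = 1" "dist w x \<le> 2 * \<rho>" for w
  proof -
    have "\<bar>clip \<epsilon> (q w) * (q w - r)\<bar> \<le> 1 * \<bar>q w - r\<bar>"
      unfolding abs_mult by (intro mult_right_mono clip_bounds) auto
    then have "clip \<epsilon> (q w) * (q w - r) \<le> \<bar>q w - r\<bar>" by (simp only: abs_le_iff mult_1)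
    then have "clip \<epsilon> (q w) * q w - \<bar>q w - r\<bar> \<le> clip \<epsilon> (q w) * r" by (simp add: right_diff_distrib)
    then show ?thesis using clip_mult_ge[OF pos(1), of "q w"] B[OF that] by linarith
  qed
  obtain y where y: "norm y = 1" "steer \<epsilon> \<rho> q x = clip \<epsilon> (q y) + dist x y / \<rho>" using steer_attained[OF q x] by blast
  have "dist x y / \<rho> \<le> 2" using y(2) clip_bounds(1)[of \<epsilon> "q y"] steer_abs_le[OF q x] by linarith
  then have dy: "dist y x \<le> 2 * \<rho>" using pos by (simp add: field_simps dist_commute)
  show ?thesis
  proof (cases "r \<ge> 0")
    case True
    have "steer \<epsilon> \<rho> q x \<ge> clip \<epsilon> (q y)" using y(2) pos by simp
    then have "steer \<epsilon> \<rho> q x * r \<ge> clip \<epsilon> (q y) * r" using True by (rule mult_right_mono)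
    then show ?thesis using clip_ge[OF y(1) dy] by linarith
  next
    case False
    have "steer \<epsilon> \<rho> q x \<le> clip \<epsilon> (q x)" using steer_le[OF x, of q x] by simp
    then have "steer \<epsilon> \<rho> q x * r \<ge> clip \<epsilon> (q x) * r" using False by (intro mult_right_mono_neg) auto
    moreover have "dist x x \<le> 2 * \<rho>" using pos by simp
    ultimately show ?thesis using clip_ge[OF x] by linarith
  qed
qed

end

section \<open>Rounding masses on a connected net of points\<close>

text \<open>A connected finite graph presented by an order of attachment. Removing the last vertex
  leaves a graph of the same kind, as an induction that hands mass to a neighbour requires.\<close>

inductive connected_build :: "('a \<Rightarrow> 'a \<Rightarrow> bool) \<Rightarrow> 'a set \<Rightarrow> bool" for E where
  single: "connected_build E {v}"
| extend: "connected_build E V \<Longrightarrow> u \<in> V \<Longrightarrow> v \<notin> V \<Longrightarrow> E u v \<Longrightarrow> connected_build E (insert v V)"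

lemma connected_build_finite: "connected_build E V \<Longrightarrow> finite V"
  by (induction rule: connected_build.induct) auto

text \<open>Rounding the masses to integers: the vertex attached last keeps the integer part of its mass
  and passes the fractional part to a neighbour. Since its own mass \<open>a v\<close> is at least \<open>1\<close>, what it
  passes on can be taken from \<open>a v\<close>, so that no mass travels further than one edge; \<open>b v\<close> is the
  mass received from other vertices.\<close>

lemma ex_integer_rounding:
  assumes "connected_build E V" "\<And>j. j \<in> V \<Longrightarrow> a j \<ge> (1::real)" "\<And>j. j \<in> V \<Longrightarrow> b j \<ge> (0::real)"
    and "(\<Sum>j\<in>V. a j + b j) = real N"
  shows "\<exists>n. (\<Sum>j\<in>V. n j) = N \<and> (\<forall>j\<in>V. n j \<ge> (1::nat)) \<and> (\<forall>\<alpha> \<beta>.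
     (\<forall>i\<in>V. \<forall>j\<in>V. i = j \<or> E i j \<longrightarrow> \<alpha> j \<le> \<beta> i) \<longrightarrow>
     (\<Sum>j\<in>V. a j * \<alpha> j + b j * \<beta> j) \<le> (\<Sum>j\<in>V. real (n j) * \<beta> j))"
  using assms
proof (induction arbitrary: b N rule: connected_build.induct)
  case (single v)
  have "a v * \<alpha> v + b v * \<beta> v \<le> real N * \<beta> v" if "\<alpha> v \<le> \<beta> v" for \<alpha> \<beta>
  proof -
    have "a v * \<alpha> v \<le> a v * \<beta> v" using that single(1)[of v] by (intro mult_left_mono) auto
    moreover have "real N * \<beta> v = a v * \<beta> v + b v * \<beta> v" using single(3) by (simp flip: distrib_right)
    ultimately show ?thesis by linarith
  qed
  moreover have "N \<ge> 1" using single(1)[of v] single(2)[of v] single(3) by simp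
  ultimately show ?case by (intro exI[of _ "\<lambda>_. N"]) auto
next
  case (extend V u v)
  have fin: "finite V" by (rule connected_build_finite[OF extend.hyps(1)])
  define k where "k = nat \<lfloor>a v + b v\<rfloor>"
  define \<phi> where "\<phi> = a v + b v - real k"
  have av: "a v \<ge> 1" "b v \<ge> 0" using extend.prems by auto
  have k: "real k = of_int \<lfloor>a v + b v\<rfloor>" using av by (simp add: k_def)
  have phi: "0 \<le> \<phi>" "\<phi> < 1" unfolding \<phi>_def k by linarith+
  have k1: "k \<ge> 1" using av by (simp add: k_def le_nat_iff le_floor_iff)
  define b' where "b' = b(u := b u + \<phi>)"
  have sb': "(\<Sum>j\<in>V. g j + b' j * h j) = (\<Sum>j\<in>V. g j + b j * h j) + \<phi> * h u" for g h :: "'a \<Rightarrow> real"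
    using fin extend.hyps(2) by (simp add: sum.remove[of V u] b'_def algebra_simps)
  have tot: "a v + b v + (\<Sum>j\<in>V. a j + b j) = real N" using extend.prems(3) fin extend.hyps(3) by simp
  have "(\<Sum>j\<in>V. a j + b j) \<ge> 0" using extend.prems by (intro sum_nonneg) (simp add: add_nonneg_nonneg order.trans[OF zero_le_one])
  then have "real k \<le> real N" using tot phi by (simp add: \<phi>_def)
  then have kN: "k \<le> N" by simp
  have "(\<Sum>j\<in>V. a j + b' j) = real (N - k)"
    using sb'[of a "\<lambda>_. 1"] tot kN by (simp add: \<phi>_def of_nat_diff)
  moreover have "b' j \<ge> 0" if "j \<in> V" for j using extend.prems(2)[of j] that phi by (auto simp: b'_def)
  ultimately obtain n where n: "(\<Sum>j\<in>V. n j) = N - k" "\<And>j. j \<in> V \<Longrightarrow> n j \<ge> 1"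
     "\<And>\<alpha> \<beta>. (\<forall>i\<in>V. \<forall>j\<in>V. i = j \<or> E i j \<longrightarrow> \<alpha> j \<le> \<beta> i) \<Longrightarrow>
     (\<Sum>j\<in>V. a j * \<alpha> j + b' j * \<beta> j) \<le> (\<Sum>j\<in>V. real (n j) * \<beta> j)"
    using extend.IH[of b' "N - k"] extend.prems(1) by auto
  define n' where "n' = n(v := k)"
  have sn': "(\<Sum>j\<in>V. f j (n' j)) = (\<Sum>j\<in>V. f j (n j))" for f :: "'a \<Rightarrow> nat \<Rightarrow> 'b::comm_monoid_add"
    using extend.hyps(3) by (intro sum.cong) (auto simp: n'_def)
  \<comment> \<open>\<open>\<alpha>\<close> is the value where a mass starts and
    \<open>\<beta>\<close> the value where it ends; the masses \<open>b\<close> have already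
    travelled. Comparing such sums expresses a transport of mass without constructing the
    plan.\<close>
  have "(\<Sum>j\<in>insert v V. a j * \<alpha> j + b j * \<beta> j) \<le> (\<Sum>j\<in>insert v V. real (n' j) * \<beta> j)"
    if ab: "\<forall>i\<in>insert v V. \<forall>j\<in>insert v V. i = j \<or> E i j \<longrightarrow> \<alpha> j \<le> \<beta> i" for \<alpha> \<beta>
  proof -
    have "(a v - \<phi>) * \<alpha> v \<le> (a v - \<phi>) * \<beta> v" using ab av phi by (intro mult_left_mono) auto
    moreover have "\<phi> * \<alpha> v \<le> \<phi> * \<beta> u" using ab extend.hyps phi by (intro mult_left_mono) auto
    moreover have "(\<Sum>j\<in>V. a j * \<alpha> j + b' j * \<beta> j) \<le> (\<Sum>j\<in>V. real (n j) * \<beta> j)" using ab by (intro n(3)) auto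
    moreover have "real k * \<beta> v = (a v - \<phi>) * \<beta> v + b v * \<beta> v" by (simp add: \<phi>_def algebra_simps)
    moreover have "a v * \<alpha> v = (a v - \<phi>) * \<alpha> v + \<phi> * \<alpha> v" by (simp add: algebra_simps)
    ultimately have "a v * \<alpha> v + b v * \<beta> v + (\<Sum>j\<in>V. a j * \<alpha> j + b j * \<beta> j) \<le> real k * \<beta> v + (\<Sum>j\<in>V. real (n j) * \<beta> j)"
      using sb'[of "\<lambda>j. a j * \<alpha> j" \<beta>] by linarith
    then show ?thesis using fin extend.hyps(3) sn'[of "\<lambda>j m. real m * \<beta> j"] by (simp add: n'_def)
  qed
  moreover have "(\<Sum>j\<in>insert v V. n' j) = N" using fin extend.hyps(3) sn'[of "\<lambda>j m. m"] n(1) kN by (simp add: n'_def)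
  moreover have "\<forall>j\<in>insert v V. n' j \<ge> 1" using n(2) k1 by (simp add: n'_def)
  ultimately show ?case by blast
qed

text \<open>Each ball of radius \<open>\<delta> / 2\<close> in a finite cover holds at most one
  point of a separated set, so a separated set of greatest cardinality exists; a point far from it
  could be added.\<close>

lemma ex_maximal_separated:
  fixes S :: "'a::metric_space set"
  assumes "compact S" "\<delta> > 0"
  shows "\<exists>Z. finite Z \<and> Z \<subseteq> S \<and> (\<forall>x\<in>Z. \<forall>y\<in>Z. x \<noteq> y \<longrightarrow> \<delta> \<le> dist x y) \<and> (\<forall>x\<in>S. \<exists>z\<in>Z. dist x z < \<delta>)"
proof -
  define sep where "sep Z \<longleftrightarrow> finite Z \<and> Z \<subseteq> S \<and> (\<forall>x\<in>Z. \<forall>y\<in>Z. x \<noteq> y \<longrightarrow> \<delta> \<le> dist x y)" for Z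
  obtain F where F: "finite F" "S \<subseteq> (\<Union>x\<in>F. ball x (\<delta> / 2))"
  proof (rule compactE_image[OF assms(1), of S "\<lambda>x. ball x (\<delta> / 2)"])
    show "S \<subseteq> (\<Union>x\<in>S. ball x (\<delta> / 2))" using assms(2) by force
  qed auto
  have "card Z \<le> card F" if Z: "sep Z" for Z
  proof -
    have "\<forall>z\<in>Z. \<exists>x\<in>F. dist x z < \<delta> / 2" using Z F unfolding sep_def by fastforce
    then obtain f where f: "\<And>z. z \<in> Z \<Longrightarrow> f z \<in> F \<and> dist (f z) z < \<delta> / 2" by metis
    have "inj_on f Z"
    proof (rule inj_onI, rule ccontr)
      fix x y assume xy: "x \<in> Z" "y \<in> Z" "f x = f y" "x \<noteq> y"
      then have "dist x y < \<delta>"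
        using f[OF xy(1)] f[OF xy(2)] dist_triangle_half_r[of "f x" x \<delta> y] by simp
      then show False using Z xy unfolding sep_def by fastforce
    qed
    then show ?thesis using f F(1) by (intro card_inj_on_le[of f]) auto
  qed
  moreover have "sep {}" by (simp add: sep_def)
  ultimately obtain Z where Z: "sep Z" "\<And>Y. sep Y \<Longrightarrow> card Y \<le> card Z"
    using ex_has_greatest_nat[of sep "{}" card "Suc (card F)"] by (metis le_imp_less_Suc)
  have "\<exists>z\<in>Z. dist x z < \<delta>" if x: "x \<in> S" for x
  proof (rule ccontr)
    assume "\<not> ?thesis"
    then have far: "\<And>z. z \<in> Z \<Longrightarrow> \<delta> \<le> dist x z" by force
    then have "x \<notin> Z" using assms(2) by force
    moreover have "sep (insert x Z)" using Z(1) far x unfolding sep_def by (auto simp: dist_commute)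
    ultimately show False using Z(2)[of "insert x Z"] Z(1) by (auto simp: sep_def)
  qed
  with Z(1) show ?thesis unfolding sep_def by (intro exI[of _ Z] conjI) simp_all
qed

text \<open>If a largest connected part \<open>W\<close> missed a point of \<open>Z\<close>, the
  \<open>\<delta>\<close>-balls around \<open>W\<close> and around the rest would cover the
  connected set \<open>S\<close>. They therefore meet in \<open>S\<close>, which gives an edge
  leaving \<open>W\<close>.\<close>

lemma connected_build_net:
  fixes S :: "'a::metric_space set"
  assumes "connected S" "finite Z" "Z \<subseteq> S" "\<And>x. x \<in> S \<Longrightarrow> \<exists>z\<in>Z. dist x z < \<delta>" "S \<noteq> {}" "\<delta> > 0"
  shows "connected_build (\<lambda>x y. dist x y < 2 * \<delta>) Z"
proof -
  let ?c = "connected_build (\<lambda>x y. dist x y < 2 * \<delta>)"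
  obtain z0 where z0: "z0 \<in> Z" using assms(4,5) by blast
  have "?c {z0} \<and> {z0} \<subseteq> Z" using z0 by (simp add: connected_build.single)
  moreover have "\<forall>W. ?c W \<and> W \<subseteq> Z \<longrightarrow> card W < Suc (card Z)"
    using card_mono[OF assms(2)] by (simp add: less_Suc_eq_le)
  ultimately obtain W where W: "?c W" "W \<subseteq> Z" "\<And>Y. ?c Y \<Longrightarrow> Y \<subseteq> Z \<Longrightarrow> card Y \<le> card W"
    using ex_has_greatest_nat[of "\<lambda>W. ?c W \<and> W \<subseteq> Z" "{z0}" card "Suc (card Z)"] by blast
  have "W = Z"
  proof (rule ccontr)
    assume "W \<noteq> Z"
    then obtain z1 where z1: "z1 \<in> Z - W" using W by blast
    obtain w where w: "w \<in> W" using W(1) by (cases rule: connected_build.cases) auto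
    let ?A = "\<Union>z\<in>W. ball z \<delta>" and ?B = "\<Union>z\<in>Z - W. ball z \<delta>"
    have "\<exists>x\<in>S. x \<in> ?A \<and> x \<in> ?B"
    proof (rule ccontr)
      assume "\<not> ?thesis"
      then have "?A \<inter> ?B \<inter> S = {}" by blast
      moreover have "S \<subseteq> ?A \<union> ?B" using assms(4) by (fastforce simp: dist_commute)
      moreover have "open ?A" "open ?B" by auto
      ultimately have "?A \<inter> S = {} \<or> ?B \<inter> S = {}" by (intro connectedD[OF assms(1)])
      moreover have "w \<in> ball w \<delta>" "z1 \<in> ball z1 \<delta>" using assms(6) by simp_all
      then have "w \<in> ?A \<inter> S" "z1 \<in> ?B \<inter> S" using w z1 W(2) assms(3) by blast+
      ultimately show False by blast
    qed
    then obtain x z z' where "z \<in> W" "z' \<in> Z - W" "dist z x < \<delta>" "dist z' x < \<delta>" by auto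
    moreover from this have "dist z z' < 2 * \<delta>" using dist_triangle2[of z z' x] by linarith
    ultimately have "?c (insert z' W)" "insert z' W \<subseteq> Z" "z' \<notin> W" using connected_build.extend[OF W(1)] W(2) by auto
    then show False using W(3)[of "insert z' W"] connected_build_finite[OF W(1)] by simp
  qed
  then show ?thesis using W by simp
qed

text \<open>A node of the net may have to carry many points. They must be distinct, since a design
  is a set, and every cap has room for them.\<close>

lemma infinite_sphere_Int_ball:
  fixes z :: "'a::euclidean_space"
  assumes "DIM('a) \<ge> 2" "norm z = 1" "r > 0"
  shows "infinite (sphere 0 1 \<inter> ball z r)"
proof -
  have "connected (sphere (0::'a) 1)" using assms by (simp add: connected_sphere)
  moreover have "sphere 0 1 \<noteq> {x}" for x :: 'a
  proof
    assume "sphere 0 1 = {x}"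
    then have *: "sphere 0 1 = {z}" using assms by auto
    have "- z \<in> sphere 0 1" using assms by simp
    then have "- z = z" using * by blast
    then have "z + z = 0" by (metis add.right_inverse)
    then have "z = 0" by (simp flip: scaleR_2)
    then show False using assms by simp
  qed
  moreover have "z \<in> sphere 0 1" using assms by simp
  ultimately have "z islimpt sphere 0 1" by (intro connected_imp_perfect)
  then show ?thesis using assms by (simp add: islimpt_eq_infinite_ball)
qed

text \<open>The conclusion is the dual form of a transport from the sphere measure to the points
  over distances at most \<open>4 * \<delta>\<close>: less than \<open>\<delta>\<close> to a node,
  less than \<open>2 * \<delta>\<close> along an edge when masses are rounded, and less than
  \<open>\<delta> / 2\<close> to the actual points. The condition on \<open>N\<close> gives each
  node mass at least \<open>1\<close>, as the rounding demands.\<close>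

lemma ex_equidistributed_points:
  fixes \<delta> :: real
  assumes card: "CARD('n::finite) \<ge> 2" and \<delta>: "0 < \<delta>" "\<delta> \<le> 1"
    and N: "1 \<le> real N * ((\<delta> / 4) ^ (CARD('n) - 1) / (4 * 8 ^ CARD('n)))"
  shows "\<exists>X :: (real ^ 'n) set. X \<subseteq> sphere 0 1 \<and> finite X \<and> card X = N \<and>
    (\<forall>F H. continuous_on (sphere 0 1) H \<longrightarrow>
       (\<forall>x\<in>X. \<forall>y. norm y = 1 \<longrightarrow> dist x y \<le> 4 * \<delta> \<longrightarrow> H y \<le> F x) \<longrightarrow>
       real N * (\<integral>y. H y \<partial>sphere_lebesgue) \<le> (\<Sum>x\<in>X. F x))"
proof -
  let ?S = "sphere (0 :: real ^ 'n) 1"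
  obtain Z where Z': "finite Z" "Z \<subseteq> ?S" "\<forall>x\<in>Z. \<forall>y\<in>Z. x \<noteq> y \<longrightarrow> \<delta> \<le> dist x y"
    "\<forall>x\<in>?S. \<exists>z\<in>Z. dist x z < \<delta>"
    using ex_maximal_separated[OF compact_sphere[of 0 1] \<delta>(1)] by (elim exE conjE) (rule that)
  note Z = Z'(1,2) Z'(3)[rule_format] Z'(4)[rule_format]
  have conn: "connected_build (\<lambda>x y. dist x y < 2 * \<delta>) Z"
    using card Z \<delta> by (intro connected_build_net[of ?S]) (auto simp: connected_sphere)
  \<comment> \<open>The bumps \<open>g\<close> have disjoint supports and reserve weight
    \<open>1 / 2\<close> for each node on the ball of radius \<open>\<delta> / 4\<close>. What they
    leave of the constant \<open>1\<close> is shared out by the normalized \<open>h\<close>, so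
    \<open>wt\<close> is a partition of unity whose members all have large integrals.\<close>
  define g where "g z y = max 0 (1 - 2 * dist y z / \<delta>)" for z y :: "real ^ 'n"
  define h where "h z y = max 0 (\<delta> - dist y z)" for z y :: "real ^ 'n"
  define wt where "wt z y = g z y + (1 - (\<Sum>z\<in>Z. g z y)) * (h z y / (\<Sum>z\<in>Z. h z y))" for z y
  have hsum: "(\<Sum>z\<in>Z. h z y) > 0" if y: "y \<in> ?S" for y
  proof -
    obtain z where "z \<in> Z" "dist y z < \<delta>" using Z(4)[OF y] by blast
    then show ?thesis using Z(1) by (intro sum_pos2[where i = z and I = Z]) (auto simp: h_def)
  qed
  have gsum: "(\<Sum>z\<in>Z. g z y) \<le> 1" for y
  proof (cases "\<exists>z\<in>Z. dist y z < \<delta> / 2")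
    case True
    then obtain z where z: "z \<in> Z" "dist y z < \<delta> / 2" by blast
    have "g z' y = 0" if "z' \<in> Z - {z}" for z'
    proof -
      have "\<delta> \<le> dist z z'" using Z(3)[of z z'] z that by auto
      then have "dist y z' \<ge> \<delta> / 2" using z dist_triangle3[of z z' y] by linarith
      then show ?thesis using \<delta> by (simp add: g_def field_simps)
    qed
    then have "(\<Sum>z\<in>Z. g z y) = g z y" using Z(1) z(1) by (simp add: sum.remove[of Z z])
    also have "\<dots> \<le> 1" using \<delta> by (simp add: g_def)
    finally show ?thesis .
  next
    case False
    then have "(\<Sum>z\<in>Z. g z y) = 0" using \<delta> by (intro sum.neutral) (auto simp: g_def field_simps not_less)
    then show ?thesis by simp
  qed
  have g0: "0 \<le> g z y" and h0: "0 \<le> h z y" for z y by (auto simp: g_def h_def)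
  have gchi: "g z y \<le> wt z y" if "y \<in> ?S" for z y
    using gsum[of y] hsum[OF that] h0[of z y] by (simp add: wt_def)
  have chi0: "0 \<le> wt z y" if "y \<in> ?S" for z y using gchi[OF that, of z] g0[of z y] by linarith
  have chisum: "(\<Sum>z\<in>Z. wt z y) = 1" if "y \<in> ?S" for y
    using hsum[OF that] by (simp add: wt_def sum.distrib flip: sum_distrib_left sum_divide_distrib)
  have chisupp: "wt z y = 0" if "dist y z \<ge> \<delta>" for z y
    using that \<delta> by (simp add: wt_def g_def h_def field_simps)
  have gc: "continuous_on ?S (g z)" and hc: "continuous_on ?S (h z)" for z
    unfolding g_def h_def using \<delta> by (intro continuous_intros; simp)+
  have chic: "continuous_on ?S (wt z)" for z
    unfolding wt_def using hsum by (intro continuous_intros gc hc) (auto simp: less_imp_neq[symmetric])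
  define a where "a z = real N * (\<integral>y. wt z y \<partial>sphere_lebesgue)" for z
  have a1: "a z \<ge> 1" if z: "z \<in> Z" for z
  proof -
    have nz: "norm z = 1" using z Z(2) by auto
    have "(\<delta> / 4) ^ (CARD('n) - 1) / (2 * 8 ^ CARD('n)) \<le> measure sphere_lebesgue (?S \<inter> ball z (\<delta> / 4))"
      using \<delta> by (intro measure_sphere_cap_ge nz) auto
    also have "\<dots> = (\<integral>y. indicator (?S \<inter> ball z (\<delta> / 4)) y \<partial>sphere_lebesgue)"
      by (simp add: Int_absorb2)
    also have "\<dots> \<le> (\<integral>y. 2 * wt z y \<partial>sphere_lebesgue)"
    proof (rule integral_mono)
      show "integrable sphere_lebesgue (indicat_real (?S \<inter> ball z (\<delta> / 4)))"
        using finite_measure.emeasure_finite[OF finite_measure_sphere_lebesgue]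
        by (intro integrable_real_indicator) (auto simp: sets_restrict_space_iff less_top)
      show "integrable sphere_lebesgue (\<lambda>y. 2 * wt z y)" by (intro integrable_sphere_lebesgue continuous_intros chic)
      fix y :: "real ^ 'n" assume "y \<in> space sphere_lebesgue"
      then have y: "y \<in> ?S" by simp
      show "indicat_real (?S \<inter> ball z (\<delta> / 4)) y \<le> 2 * wt z y"
      proof (cases "y \<in> ball z (\<delta> / 4)")
        case True
        then have "g z y \<ge> 1 / 2" using \<delta> by (simp add: g_def dist_commute field_simps)
        then show ?thesis using gchi[OF y, of z] True y by simp
      qed (use chi0[OF y, of z] in simp)
    qed
    also have "\<dots> = 2 * (\<integral>y. wt z y \<partial>sphere_lebesgue)" by simp
    finally have "(\<delta> / 4) ^ (CARD('n) - 1) / (4 * 8 ^ CARD('n)) \<le> (\<integral>y. wt z y \<partial>sphere_lebesgue)" by simp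
    then have "real N * ((\<delta> / 4) ^ (CARD('n) - 1) / (4 * 8 ^ CARD('n))) \<le> a z"
      unfolding a_def by (rule mult_left_mono) simp
    then show ?thesis using N by linarith
  qed
  have asum: "(\<Sum>z\<in>Z. a z + 0) = real N"
  proof -
    have "(\<Sum>z\<in>Z. a z) = real N * (\<integral>y. (\<Sum>z\<in>Z. wt z y) \<partial>sphere_lebesgue)"
      unfolding a_def by (subst Bochner_Integration.integral_sum) (auto intro!: integrable_sphere_lebesgue chic simp: sum_distrib_left)
    also have "(\<integral>y. (\<Sum>z\<in>Z. wt z y) \<partial>sphere_lebesgue) = (\<integral>y. 1 \<partial>(sphere_lebesgue :: (real ^ 'n) measure))"
      by (intro Bochner_Integration.integral_cong) (auto simp: chisum)
    also have "\<dots> = 1" by (rule integral_sphere_lebesgue_const)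
    finally show ?thesis by simp
  qed
  obtain n where n: "(\<Sum>z\<in>Z. n z) = N" "\<And>z. z \<in> Z \<Longrightarrow> n z \<ge> (1::nat)"
    "\<And>\<alpha> \<beta>. (\<forall>i\<in>Z. \<forall>j\<in>Z. i = j \<or> dist i j < 2 * \<delta> \<longrightarrow> \<alpha> j \<le> \<beta> i) \<Longrightarrow>
     (\<Sum>j\<in>Z. a j * \<alpha> j) \<le> (\<Sum>j\<in>Z. real (n j) * \<beta> j)"
    using ex_integer_rounding[where a = a and b = "\<lambda>_. 0", OF conn a1 _ asum] by auto
  have "\<exists>Y. finite Y \<and> card Y = n z \<and> Y \<subseteq> ?S \<inter> ball z (\<delta> / 2)" if "z \<in> Z" for z
  proof -
    have "infinite (?S \<inter> ball z (\<delta> / 2))"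
      using that Z(2) \<delta> card by (intro infinite_sphere_Int_ball) auto
    from infinite_arbitrarily_large[OF this] show ?thesis by blast
  qed
  then obtain Y where Y: "\<And>z. z \<in> Z \<Longrightarrow> finite (Y z) \<and> card (Y z) = n z \<and> Y z \<subseteq> ?S \<inter> ball z (\<delta> / 2)"
    by metis
  have disj: "Y z \<inter> Y z' = {}" if "z \<in> Z" "z' \<in> Z" "z \<noteq> z'" for z z'
  proof -
    have "ball z (\<delta> / 2) \<inter> ball z' (\<delta> / 2) = {}" using Z(3)[OF that] by (intro disjoint_ballI) simp
    then show ?thesis using Y[OF that(1)] Y[OF that(2)] by blast
  qed
  define X where "X = (\<Union>z\<in>Z. Y z)"
  have Xsum: "(\<Sum>x\<in>X. f x) = (\<Sum>z\<in>Z. \<Sum>x\<in>Y z. f x)" for f :: "_ \<Rightarrow> 'b::comm_monoid_add"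
    unfolding X_def using Z(1) Y disj by (intro sum.UNION_disjoint) auto
  have cX: "card X = N" using Xsum[of "\<lambda>_. 1::nat"] Y n(1) by simp
  have fX: "finite X" "X \<subseteq> ?S" using Z(1) Y by (auto simp: X_def)
  have main: "real N * (\<integral>y. H y \<partial>sphere_lebesgue) \<le> (\<Sum>x\<in>X. F x)"
    if H: "continuous_on ?S H" and FH: "\<And>x y. x \<in> X \<Longrightarrow> norm y = 1 \<Longrightarrow> dist x y \<le> 4 * \<delta> \<Longrightarrow> H y \<le> F x" for F H
  proof -
    have "\<exists>y. y \<in> ?S \<inter> cball z \<delta> \<and> (\<forall>w\<in>?S \<inter> cball z \<delta>. H w \<le> H y)" if "z \<in> Z" for z
    proof -
      have "compact (?S \<inter> cball z \<delta>)" by (intro compact_Int compact_sphere compact_cball)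
      moreover have "z \<in> ?S \<inter> cball z \<delta>" using that Z(2) \<delta> by auto
      moreover have "continuous_on (?S \<inter> cball z \<delta>) H" by (rule continuous_on_subset[OF H]) auto
      ultimately show ?thesis using continuous_attains_sup[of "?S \<inter> cball z \<delta>" H] by blast
    qed
    then obtain m where m: "\<And>z. z \<in> Z \<Longrightarrow> m z \<in> ?S \<inter> cball z \<delta> \<and> (\<forall>w\<in>?S \<inter> cball z \<delta>. H w \<le> H (m z))"
      by metis
    \<comment> \<open>The rounding is applied with the worst cases on both sides: the largest value
      of \<open>H\<close> near the node where mass starts, the least value of \<open>F\<close> at
      the points where it ends.\<close>
    define \<beta> where "\<beta> z = Min (F ` Y z)" for z
    have Yne: "Y z \<noteq> {}" if "z \<in> Z" for z using n(2)[OF that] Y[OF that] by auto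
    have "real N * (\<integral>y. H y \<partial>sphere_lebesgue) = real N * (\<integral>y. (\<Sum>z\<in>Z. wt z y * H y) \<partial>sphere_lebesgue)"
      by (intro arg_cong2[where f = "(*)"] refl Bochner_Integration.integral_cong) (auto simp: chisum simp flip: sum_distrib_right)
    also have "\<dots> = (\<Sum>z\<in>Z. real N * (\<integral>y. wt z y * H y \<partial>sphere_lebesgue))"
      by (subst Bochner_Integration.integral_sum) (auto intro!: integrable_sphere_lebesgue continuous_on_mult chic H simp: sum_distrib_left)
    also have "\<dots> \<le> (\<Sum>z\<in>Z. a z * H (m z))"
    proof (intro sum_mono)
      fix z assume z: "z \<in> Z"
      have "(\<integral>y. wt z y * H y \<partial>sphere_lebesgue) \<le> (\<integral>y. wt z y * H (m z) \<partial>sphere_lebesgue)"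
      proof (rule integral_sphere_lebesgue_mono)
        fix y :: "real ^ 'n" assume y: "norm y = 1"
        show "wt z y * H y \<le> wt z y * H (m z)"
        proof (cases "dist y z \<ge> \<delta>")
          case False
          then show ?thesis using m[OF z] y chi0[of y z] by (intro mult_left_mono) (auto simp: dist_commute)
        qed (simp add: chisupp)
      qed (intro continuous_intros chic H)+
      then show "real N * (\<integral>y. wt z y * H y \<partial>sphere_lebesgue) \<le> a z * H (m z)"
        unfolding a_def by (simp add: mult_left_mono mult.assoc)
    qed
    also have "\<dots> \<le> (\<Sum>z\<in>Z. real (n z) * \<beta> z)"
    proof (intro n(3) ballI impI)
      fix i j assume ij: "i \<in> Z" "j \<in> Z" "i = j \<or> dist i j < 2 * \<delta>"
      have "H (m j) \<le> F x" if x: "x \<in> Y i" for x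
      proof (rule FH)
        show "x \<in> X" using x ij by (auto simp: X_def)
        show "norm (m j) = 1" using m[OF ij(2)] by auto
        have "dist i x < \<delta> / 2" using Y[OF ij(1)] x by auto
        moreover have "dist j (m j) \<le> \<delta>" using m[OF ij(2)] by auto
        moreover have "dist i j < 2 * \<delta>" using ij(3) \<delta> by auto
        moreover have "dist x (m j) \<le> dist i x + dist i j + dist j (m j)"
          using dist_triangle[of x "m j" i] dist_triangle[of i "m j" j] by (simp add: dist_commute)
        ultimately show "dist x (m j) \<le> 4 * \<delta>" using \<delta> by linarith
      qed
      then show "H (m j) \<le> \<beta> i" unfolding \<beta>_def using Y[OF ij(1)] Yne[OF ij(1)] by simp
    qed
    also have "\<dots> \<le> (\<Sum>z\<in>Z. \<Sum>x\<in>Y z. F x)"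
    proof (intro sum_mono)
      fix z assume z: "z \<in> Z"
      have "(\<Sum>x\<in>Y z. \<beta> z) \<le> (\<Sum>x\<in>Y z. F x)" unfolding \<beta>_def using Y[OF z] by (intro sum_mono Min_le) auto
      then show "real (n z) * \<beta> z \<le> (\<Sum>x\<in>Y z. F x)" using Y[OF z] by simp
    qed
    also have "\<dots> = (\<Sum>x\<in>X. F x)" by (simp add: Xsum)
    finally show ?thesis .
  qed
  show ?thesis
  proof (intro exI[of _ X] conjI allI impI)
    fix F H :: "real ^ 'n \<Rightarrow> real"
    assume "continuous_on ?S H" "\<forall>x\<in>X. \<forall>y. norm y = 1 \<longrightarrow> dist x y \<le> 4 * \<delta> \<longrightarrow> H y \<le> F x"
    then show "real N * (\<integral>y. H y \<partial>sphere_lebesgue) \<le> (\<Sum>x\<in>X. F x)" by (intro main) auto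
  qed (use cX fX in auto)
qed

section \<open>Zeros of maps pointing outward\<close>

lemma nsphere_top_of_set:
  "nsphere n = top_of_set {x. (\<Sum>i\<le>n. (x i)\<^sup>2) = 1 \<and> (\<forall>i>n. x i = 0)}"
  unfolding nsphere by (simp add: euclidean_product_topology)

text \<open>Let \<open>p\<close> project the unit sphere radially to the level set
  \<open>g x = 1\<close>, the boundary of the star-shaped body. If \<open>f\<close> had no zero, its
  normalization along \<open>p\<close> would be homotopic both to a constant and to the identity, so
  the sphere would be contractible. Indices up to \<open>n\<close> give the sphere of dimension
  \<open>n\<close>, including the two-point sphere for \<open>n = 0\<close>.\<close>

lemma exists_zero_if_outward_on_sphere:
  fixes f :: "(nat \<Rightarrow> real) \<Rightarrow> nat \<Rightarrow> real" and g :: "(nat \<Rightarrow> real) \<Rightarrow> real"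
  assumes cf: "\<And>i. i \<le> n \<Longrightarrow> continuous_on UNIV (\<lambda>x. f x i)"
    and cg: "continuous_on UNIV g"
    and hom: "\<And>x r. r \<ge> 0 \<Longrightarrow> g (\<lambda>i. r * x i) = r * g x"
    and gpos: "\<And>x. \<exists>i\<le>n. x i \<noteq> 0 \<Longrightarrow> g x > 0"
    and outward: "\<And>x. g x = 1 \<Longrightarrow> (\<Sum>i\<le>n. x i * f x i) > 0"
  shows "\<exists>x. \<forall>i\<le>n. f x i = 0"
proof (rule ccontr)
  assume "\<not> ?thesis"
  then have nz: "\<exists>i\<le>n. f x i \<noteq> 0" for x by blast
  define S where "S = {x::nat\<Rightarrow>real. (\<Sum>i\<le>n. (x i)\<^sup>2) = 1 \<and> (\<forall>i>n. x i = 0)}"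
  have top: "nsphere n = top_of_set S" unfolding nsphere_top_of_set S_def ..
  define nu where "nu v = (\<lambda>i. if i \<le> n then v i / sqrt (\<Sum>i\<le>n. (v i)\<^sup>2) else 0)" for v :: "nat \<Rightarrow> real"
  have sumpos: "(\<Sum>i\<le>n. (v i)\<^sup>2) > 0" if v: "\<exists>i\<le>n. v i \<noteq> 0" for v :: "nat \<Rightarrow> real"
  proof -
    obtain i where "i \<le> n" "v i \<noteq> 0" using v by blast
    then show ?thesis by (intro sum_pos2[where i = i and I = "{..n}"]) simp_all
  qed
  have nuS: "nu v \<in> S" if "\<exists>i\<le>n. v i \<noteq> 0" for v :: "nat \<Rightarrow> real"
  proof -
    define a where "a = (\<Sum>i\<le>n. (v i)\<^sup>2)"
    have a: "a > 0" unfolding a_def by (rule sumpos[OF that])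
    have "(\<Sum>i\<le>n. (nu v i)\<^sup>2) = (\<Sum>i\<le>n. (v i)\<^sup>2 / a)"
      using a by (intro sum.cong) (auto simp: nu_def power_divide simp flip: a_def)
    also have "\<dots> = 1" using a by (simp flip: sum_divide_distrib a_def)
    finally show ?thesis by (simp add: S_def, simp add: nu_def)
  qed
  have nucont: "continuous_on T (\<lambda>z. nu (h z))"
    if "\<And>i. i \<le> n \<Longrightarrow> continuous_on T (\<lambda>z. h z i)" "\<And>z. z \<in> T \<Longrightarrow> \<exists>i\<le>n. h z i \<noteq> 0"
    for T :: "(real \<times> (nat \<Rightarrow> real)) set" and h
  proof (rule continuous_on_coordinatewise_then_product)
    fix i
    have *: "sqrt (\<Sum>i\<le>n. (h z i)\<^sup>2) \<noteq> 0" if "z \<in> T" for z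
      using sumpos[OF \<open>\<And>z. z \<in> T \<Longrightarrow> \<exists>i\<le>n. h z i \<noteq> 0\<close>[OF that]] by (metis less_irrefl real_sqrt_eq_zero_cancel_iff)
    show "continuous_on T (\<lambda>z. nu (h z) i)"
    proof (cases "i \<le> n")
      case True
      have "continuous_on T (\<lambda>z. h z i / sqrt (\<Sum>i\<le>n. (h z i)\<^sup>2))"
        using True * by (intro continuous_on_divide continuous_on_real_sqrt continuous_on_sum continuous_on_power that(1)) auto
      then show ?thesis using True by (simp add: nu_def)
    qed (simp add: nu_def)
  qed
  have gS: "g x > 0" if "x \<in> S" for x
  proof (rule gpos, rule ccontr)
    assume "\<not> (\<exists>i\<le>n. x i \<noteq> 0)"
    then have "(\<Sum>i\<le>n. (x i)\<^sup>2) = 0" by simp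
    then show False using that by (simp add: S_def)
  qed
  define p where "p x = (\<lambda>i. x i / g x)" for x :: "nat \<Rightarrow> real"
  have gp: "g (p x) = 1" if "x \<in> S" for x
    using hom[of "1 / g x" x] gS[OF that] by (simp add: p_def)
  have csnd: "continuous_on T (\<lambda>z. snd z i)" for T :: "(real \<times> (nat \<Rightarrow> real)) set" and i
    by (rule continuous_on_product_then_coordinatewise) (intro continuous_intros)
  let ?D = "{0..1::real} \<times> S"
  have cgs: "continuous_on ?D (\<lambda>z. g (snd z))"
    by (rule continuous_on_compose2[OF cg continuous_on_snd[OF continuous_on_id]]) simp
  have gne: "g (snd z) \<noteq> 0" if "z \<in> ?D" for z using gS that by (metis less_irrefl mem_Times_iff)
  have cfp: "continuous_on ?D (\<lambda>z. f (\<lambda>i. a z * p (snd z) i) i)"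
    if "i \<le> n" "continuous_on ?D a" for i and a :: "real \<times> (nat \<Rightarrow> real) \<Rightarrow> real"
  proof (rule continuous_on_compose2[OF cf[OF that(1)]])
    show "continuous_on ?D (\<lambda>z i. a z * p (snd z) i)"
      unfolding p_def
      by (intro continuous_on_coordinatewise_then_product continuous_on_mult continuous_on_divide that(2) csnd cgs ballI gne)
  qed simp
  have prodtop: "prod_topology (top_of_set {0..1::real}) (nsphere n) = top_of_set ?D"
    by (simp add: top flip: subtopology_Times)
  have topS: "topspace (nsphere n) = S" by (simp add: top)
  have hw: "homotopic_with (\<lambda>x. True) (nsphere n) (nsphere n) u v"
    if h: "\<And>i. i \<le> n \<Longrightarrow> continuous_on ?D (\<lambda>z. h z i)" "\<And>z. z \<in> ?D \<Longrightarrow> \<exists>i\<le>n. h z i \<noteq> 0"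
      and "\<And>x. x \<in> S \<Longrightarrow> u x = nu (h (0, x))" "\<And>x. x \<in> S \<Longrightarrow> v x = nu (h (1, x))" for u v h
  proof -
    have "continuous_map (prod_topology (top_of_set {0..1::real}) (nsphere n)) (nsphere n) (\<lambda>z. nu (h z))"
      unfolding prodtop using nucont[OF h] nuS h(2)
      by (auto simp: top intro!: image_subsetI)
    then show ?thesis
      using that(3,4) by (intro iffD2[OF homotopic_with] exI[of _ "\<lambda>z. nu (h z)"]) (simp_all add: topS)
  qed
  \<comment> \<open>Shrinks \<open>p x\<close> to the origin; normalization is possible throughout
    because \<open>f\<close> vanishes nowhere.\<close>
  have "homotopic_with (\<lambda>x. True) (nsphere n) (nsphere n) (\<lambda>x. nu (f (\<lambda>i. 0))) (\<lambda>x. nu (f (p x)))"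
    by (rule hw[where h = "\<lambda>z. f (\<lambda>i. fst z * p (snd z) i)"])
      (auto intro!: cfp continuous_on_fst continuous_on_id simp: nz)
  \<comment> \<open>The segment from \<open>x\<close> to \<open>f (p x)\<close> avoids the origin:
    \<open>p x\<close> is a positive multiple of \<open>x\<close>, so the inner product with
    \<open>x\<close> stays positive along it.\<close>
  moreover have "homotopic_with (\<lambda>x. True) (nsphere n) (nsphere n) id (\<lambda>x. nu (f (p x)))"
  proof (rule hw[where h = "\<lambda>z i. (1 - fst z) * snd z i + fst z * f (p (snd z)) i"])
    show "continuous_on ?D (\<lambda>z. (1 - fst z) * snd z i + fst z * f (p (snd z)) i)" if "i \<le> n" for i
      using cfp[OF that, of "\<lambda>_. 1"] by (auto intro!: continuous_intros csnd)
    fix z assume z: "z \<in> ?D"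
    define s x where "s = fst z" and "x = snd z"
    have sx: "x \<in> S" "0 \<le> s" "s \<le> 1" using z by (auto simp: s_def x_def)
    have "(\<Sum>i\<le>n. p x i * f (p x) i) > 0" by (rule outward) (simp add: gp sx)
    moreover have "(\<Sum>i\<le>n. x i * f (p x) i) = g x * (\<Sum>i\<le>n. p x i * f (p x) i)"
      using gS[OF sx(1)] by (simp add: sum_distrib_left p_def)
    ultimately have pos: "(\<Sum>i\<le>n. x i * f (p x) i) > 0" using gS[OF sx(1)] by simp
    have "(\<Sum>i\<le>n. x i * ((1 - s) * x i + s * f (p x) i)) = (1 - s) * (\<Sum>i\<le>n. (x i)\<^sup>2) + s * (\<Sum>i\<le>n. x i * f (p x) i)"
      by (simp add: sum_distrib_left sum.distrib[symmetric] algebra_simps power2_eq_square)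
    also have "\<dots> = (1 - s) + s * (\<Sum>i\<le>n. x i * f (p x) i)" using sx by (simp add: S_def)
    also have "\<dots> > 0"
      using pos sx by (cases "s = 1") (auto intro: add_pos_nonneg)
    finally have *: "(\<Sum>i\<le>n. x i * ((1 - s) * x i + s * f (p x) i)) > 0" .
    show "\<exists>i\<le>n. (1 - fst z) * snd z i + fst z * f (p (snd z)) i \<noteq> 0"
    proof (rule ccontr)
      assume "\<not> ?thesis"
      then have "(\<Sum>i\<le>n. x i * ((1 - s) * x i + s * f (p x) i)) = 0"
        by (intro sum.neutral) (auto simp: s_def x_def)
      with * show False by simp
    qed
  next
    show "id x = nu (\<lambda>i. (1 - fst (0::real, x)) * snd (0, x) i + fst (0, x) * f (p (snd (0::real, x))) i)" if "x \<in> S" for x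
      using that by (auto simp: nu_def S_def fun_eq_iff)
  qed (simp add: )
  ultimately have "homotopic_with (\<lambda>x. True) (nsphere n) (nsphere n) id (\<lambda>x. nu (f (\<lambda>i. 0)))"
    using homotopic_with_symD homotopic_with_trans by blast
  then show False using non_contractible_space_nsphere[of n] unfolding contractible_space_def by blast
qed

section \<open>Points moved along a steering field\<close>

text \<open>The constants are a budget. \<open>m * s = \<rho> / 2\<close> keeps the moved points
  where the oscillation is controlled; \<open>C * h = s / 8\<close> and
  \<open>m * \<epsilon> = 1 / 8\<close> limit the cost of passing from \<open>y\<close> to
  \<open>x\<close> and of clipping to about an eighth of the gain each. The minorant
  \<open>H\<close> involves values at \<open>y\<close> only, so equidistribution replaces the sum
  over moved points by its integral.\<close>

lemma sum_at_moved_points_pos: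
  fixes L :: "'n::finite plane list" and P :: "real ^ 'n \<Rightarrow> real"
  assumes L: "distinct L" "set L = {p. fst p \<noteq> snd p}" "L \<noteq> []"
    and C: "C \<ge> 1" and r: "r > 0"
    and reach: "\<And>x y h. norm x = 1 \<Longrightarrow> norm y = 1 \<Longrightarrow> dist x y \<le> h \<Longrightarrow> h \<le> r \<Longrightarrow>
      \<exists>\<theta>. (\<forall>p. \<bar>\<theta> p\<bar> \<le> C * h) \<and> rots L \<theta> x = y"
    and osc: "\<And>p x y. p \<in> set L \<Longrightarrow> norm x = 1 \<Longrightarrow> norm y = 1 \<Longrightarrow> dist y x \<le> r \<Longrightarrow> \<bar>Q p y - Q p x\<bar> \<le> W p x"
    and der: "\<And>p. p \<in> set L \<Longrightarrow> rot_deriv p P (Q p)"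
    and cont: "continuous_on (sphere 0 1) P" "\<And>p. p \<in> set L \<Longrightarrow> continuous_on (sphere 0 1) (Q p)"
      "\<And>p. p \<in> set L \<Longrightarrow> continuous_on (sphere 0 1) (W p)"
    and intP: "(\<integral>x. P x \<partial>sphere_lebesgue) = 0"
    and intQ: "(\<integral>x. (\<Sum>p\<in>set L. \<bar>Q p x\<bar>) \<partial>sphere_lebesgue) = 1"
    and intO: "(\<integral>x. (\<Sum>p\<in>set L. W p x) \<partial>sphere_lebesgue) \<le> 1 / 8"
    and N: "N > 0" and X: "X \<subseteq> sphere 0 1"
  defines "m \<equiv> real (length L)"
  defines "\<rho> \<equiv> r / 4"
  defines "s \<equiv> \<rho> / (2 * m)"
  defines "h \<equiv> s / (8 * C)"
  defines "\<epsilon> \<equiv> 1 / (8 * m)"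
  assumes equi: "\<And>F H. continuous_on (sphere 0 1) H \<Longrightarrow>
      (\<And>x y. x \<in> X \<Longrightarrow> norm y = 1 \<Longrightarrow> dist x y \<le> h \<Longrightarrow> H y \<le> F x) \<Longrightarrow>
      real N * (\<integral>y. H y \<partial>sphere_lebesgue) \<le> (\<Sum>x\<in>X. F x)"
  shows "(\<Sum>x\<in>X. P (rots L (\<lambda>p. s * (if p \<in> set L then steer \<epsilon> \<rho> (Q p) x else 0)) x)) > 0"
proof -
  let ?E = "set L"
  have m: "m \<ge> 1" using L(3) by (cases L) (auto simp: m_def)
  have planes: "\<forall>p\<in>?E. fst p \<noteq> snd p" using L by simp
  have \<rho>: "\<rho> > 0" using r by (simp add: \<rho>_def)
  have s: "s > 0" using \<rho> m by (simp add: s_def)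
  have ms: "m * s = \<rho> / 2" using m by (simp add: s_def)
  have Ch: "C * h = s / 8" using C by (simp add: h_def)
  have h0: "h > 0" using s C by (simp add: h_def)
  have "1 * h \<le> C * h" using C h0 by (intro mult_right_mono) auto
  moreover have "1 * s \<le> m * s" using m s by (intro mult_right_mono) auto
  ultimately have hs: "h \<le> s / 8" "s \<le> \<rho> / 2" using Ch ms by auto
  have \<epsilon>: "\<epsilon> > 0" using m by (simp add: \<epsilon>_def)
  have me: "m * \<epsilon> = 1 / 8" using m by (simp add: \<epsilon>_def)
  define g where "g y = (\<Sum>p\<in>?E. \<bar>Q p y\<bar>)" for y
  define U where "U y = (\<Sum>p\<in>?E. W p y)" for y
  have sl: "(\<Sum>p\<leftarrow>L. f p) = (\<Sum>p\<in>?E. f p)" for f :: "_ \<Rightarrow> real"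
    using L(1) by (simp add: sum_list_distinct_conv_sum_set)
  have cardE: "real (card ?E) = m" using L(1) by (simp add: m_def distinct_card)
  define v where "v x p = (if p \<in> ?E then steer \<epsilon> \<rho> (Q p) x else 0)" for x p
  \<comment> \<open>The value at \<open>y\<close>, minus the cost of passing to \<open>x\<close>,
    plus the gain of the move. Of \<open>3 * U y\<close>, one part is the first-order error of the
    move; the other two arise because the field is evaluated at \<open>x\<close> but multiplied by
    derivatives at \<open>y\<close>.\<close>
  define H where "H y = P y - C * h * (g y + U y) + s * (g y - 1 / 8 - 3 * U y)" for y
  have gc: "continuous_on (sphere 0 1) g" and Uc: "continuous_on (sphere 0 1) U"
    unfolding g_def U_def by (intro continuous_intros cont; simp)+
  have Hc: "continuous_on (sphere 0 1) H" unfolding H_def by (intro continuous_intros cont gc Uc)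
  have "real N * (\<integral>y. H y \<partial>sphere_lebesgue) \<le> (\<Sum>x\<in>X. P (rots L (\<lambda>p. s * v x p) x))"
  proof (rule equi[OF Hc])
    fix x y assume x: "x \<in> X" and y: "norm y = 1" and xy: "dist x y \<le> h"
    have x1: "norm x = 1" using x X by auto
    have near: "\<bar>Q p w - Q p y\<bar> \<le> W p y" if "p \<in> ?E" "norm w = 1" "dist w y \<le> r" for p w
      using osc[OF that(1) y that(2,3)] .
    \<comment> \<open>The path runs from \<open>y\<close> to \<open>x\<close>, so its first-order
      expansion and its error terms are centred at \<open>y\<close>.\<close>
    obtain \<theta> where \<theta>: "\<And>p. \<bar>\<theta> p\<bar> \<le> C * h" "rots L \<theta> y = x"
      using reach[OF y x1, of h] xy hs \<rho> s by (auto simp: dist_commute \<rho>_def)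
    have "\<bar>P (rots L \<theta> y) - P y - (\<Sum>p\<leftarrow>L. \<theta> p * Q p y)\<bar> \<le> C * h * (\<Sum>p\<leftarrow>L. W p y)"
    proof (rule rots_first_order[OF planes _ \<theta>(1) y])
      show "real (length L) * (C * h) \<le> r" using ms \<rho> by (simp add: Ch flip: m_def) (simp add: \<rho>_def)
    qed (use der near in auto)
    then have "\<bar>P x - P y - (\<Sum>p\<in>?E. \<theta> p * Q p y)\<bar> \<le> C * h * U y" unfolding sl \<theta>(2) U_def .
    moreover have "\<bar>\<Sum>p\<in>?E. \<theta> p * Q p y\<bar> \<le> C * h * g y"
    proof -
      have "\<bar>\<Sum>p\<in>?E. \<theta> p * Q p y\<bar> \<le> (\<Sum>p\<in>?E. \<bar>\<theta> p\<bar> * \<bar>Q p y\<bar>)"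
        using sum_abs[of "\<lambda>p. \<theta> p * Q p y" ?E] by (simp add: abs_mult)
      also have "\<dots> \<le> C * h * g y" unfolding g_def sum_distrib_left using \<theta> by (intro sum_mono mult_right_mono) auto
      finally show ?thesis .
    qed
    moreover have "C * h * (g y + U y) = C * h * g y + C * h * U y" by (simp add: distrib_left)
    ultimately have 1: "P y - C * h * (g y + U y) \<le> P x" by linarith
    have v1: "\<bar>v x p\<bar> \<le> 1" for p unfolding v_def using steer_abs_le[OF \<epsilon> \<rho> cont(2) x1] by auto
    have "\<bar>P (rots L (\<lambda>p. s * v x p) x) - P x - (\<Sum>p\<leftarrow>L. s * v x p * Q p y)\<bar> \<le> s * (\<Sum>p\<leftarrow>L. W p y)"
    proof (rule rots_first_order[OF planes _ _ x1 order.refl])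
      show "\<bar>s * v x p\<bar> \<le> s" for p using v1[of p] s by (simp add: abs_mult mult_left_le)
      show "\<bar>Q p w - Q p y\<bar> \<le> W p y" if "p \<in> ?E" "norm w = 1" "dist w x \<le> real (length L) * s" for p w
      proof (rule near[OF that(1,2)])
        have "dist w y \<le> dist w x + dist x y" by (rule dist_triangle)
        also have "\<dots> \<le> r" using that(3) xy ms hs \<rho> by (simp add: m_def \<rho>_def)
        finally show "dist w y \<le> r" .
      qed
    qed (use der in auto)
    then have 2: "\<bar>P (rots L (\<lambda>p. s * v x p) x) - P x - s * (\<Sum>p\<in>?E. v x p * Q p y)\<bar> \<le> s * U y"
      unfolding sl U_def by (simp add: sum_distrib_left mult.assoc)
    have "(\<Sum>p\<in>?E. \<bar>Q p y\<bar> - \<epsilon> - 2 * W p y) \<le> (\<Sum>p\<in>?E. v x p * Q p y)"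
    proof (rule sum_mono)
      fix p assume p: "p \<in> ?E"
      have "steer \<epsilon> \<rho> (Q p) x * Q p y \<ge> \<bar>Q p y\<bar> - \<epsilon> - 2 * W p y"
      proof (rule steer_mult_ge[OF \<epsilon> \<rho> cont(2)[OF p] x1])
        fix w :: "real ^ 'n" assume w: "norm w = 1" "dist w x \<le> 2 * \<rho>"
        have "dist w y \<le> dist w x + dist x y" by (rule dist_triangle)
        also have "\<dots> \<le> r" using w xy hs \<rho> by (simp add: \<rho>_def)
        finally show "\<bar>Q p w - Q p y\<bar> \<le> W p y" using near[OF p w(1)] by blast
      qed
      then show "\<bar>Q p y\<bar> - \<epsilon> - 2 * W p y \<le> v x p * Q p y" using p by (simp add: v_def)
    qed
    moreover have "(\<Sum>p\<in>?E. \<bar>Q p y\<bar> - \<epsilon> - 2 * W p y) = g y - 1 / 8 - 2 * U y"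
      using me by (simp add: g_def U_def sum_subtractf cardE sum_distrib_left)
    ultimately have "s * (g y - 1 / 8 - 2 * U y) \<le> s * (\<Sum>p\<in>?E. v x p * Q p y)" using s by simp
    moreover have "s * (g y - 1 / 8 - 3 * U y) = s * (g y - 1 / 8 - 2 * U y) - s * U y" by (simp add: algebra_simps)
    ultimately show "H y \<le> P (rots L (\<lambda>p. s * v x p) x)" using 1 2 unfolding H_def by linarith
  qed
  moreover have "real N * (\<integral>y. H y \<partial>sphere_lebesgue) > 0"
  proof -
    define J where "J = (\<integral>y. U y \<partial>sphere_lebesgue)"
    have ig: "(\<integral>y. g y \<partial>sphere_lebesgue) = 1" using intQ by (simp add: g_def)
    have J: "J \<le> 1 / 8" using intO by (simp add: J_def U_def)
    note I = integrable_sphere_lebesgue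
    have "(\<integral>y. H y \<partial>sphere_lebesgue) = (\<integral>y. P y \<partial>sphere_lebesgue) - (\<integral>y. C * h * (g y + U y) \<partial>sphere_lebesgue)
      + (\<integral>y. s * (g y - 1 / 8 - 3 * U y) \<partial>sphere_lebesgue)"
      unfolding H_def
      by (subst Bochner_Integration.integral_add Bochner_Integration.integral_diff;
          (intro I continuous_intros cont gc Uc)?)+ simp
    also have "(\<integral>y. C * h * (g y + U y) \<partial>sphere_lebesgue) = C * h * (1 + J)"
      using I[OF gc] I[OF Uc] ig by (simp add: J_def)
    also have "(\<integral>y. s * (g y - 1 / 8 - 3 * U y) \<partial>sphere_lebesgue) = s * (1 - 1 / 8 - 3 * J)"
    proof -
      have "(\<integral>y. g y - 1 / 8 - 3 * U y \<partial>sphere_lebesgue) = (\<integral>y. g y \<partial>sphere_lebesgue)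
         - (\<integral>y. 1 / 8 \<partial>(sphere_lebesgue :: (real ^ 'n) measure)) - (\<integral>y. 3 * U y \<partial>sphere_lebesgue)"
        by (subst Bochner_Integration.integral_diff; (intro I continuous_intros gc Uc)?)+ simp
      then show ?thesis by (simp only: integral_sphere_lebesgue_const ig) (simp add: J_def)
    qed
    finally have "(\<integral>y. H y \<partial>sphere_lebesgue) = - (s / 8) * (1 + J) + s * (1 - 1 / 8 - 3 * J)" by (simp add: intP Ch)
    \<comment> \<open>With \<open>J \<le> 1 / 8\<close> the factor is at least
      \<open>23 / 64\<close>.\<close>
    also have "\<dots> = s * (3 / 4 - 25 / 8 * J)" by (simp add: field_simps)
    also have "\<dots> > 0" using s J by simp
    finally show ?thesis using N by simp
  qed
  ultimately show ?thesis unfolding v_def by linarith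
qed

text \<open>The field has Lipschitz constant \<open>1 / \<rho>\<close> and the step is
  \<open>\<rho>\<close> over twice the number of planes, so all the rotations together take away at
  most half of the distance of two points.\<close>

lemma inj_on_moved_points:
  fixes L :: "'n::finite plane list"
  assumes planes: "\<forall>p\<in>set L. fst p \<noteq> snd p" and "L \<noteq> []" "\<epsilon> > 0" "\<rho> > 0"
    and cont: "\<And>p. p \<in> set L \<Longrightarrow> continuous_on (sphere 0 1) (Q p)"
  shows "inj_on (\<lambda>x. rots L (\<lambda>p. \<rho> / (2 * real (length L)) * (if p \<in> set L then steer \<epsilon> \<rho> (Q p) x else 0)) x) (sphere 0 1)"
proof (rule inj_onI, rule ccontr)
  fix x y :: "real ^ 'n"
  define s where "s = \<rho> / (2 * real (length L))"
  define v where "v x p = (if p \<in> set L then steer \<epsilon> \<rho> (Q p) x else 0)" for x p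
  assume x: "x \<in> sphere 0 1" and y: "y \<in> sphere 0 1" and ne: "x \<noteq> y"
  assume "rots L (\<lambda>p. \<rho> / (2 * real (length L)) * (if p \<in> set L then steer \<epsilon> \<rho> (Q p) x else 0)) x =
    rots L (\<lambda>p. \<rho> / (2 * real (length L)) * (if p \<in> set L then steer \<epsilon> \<rho> (Q p) y else 0)) y"
  then have eq: "rots L (\<lambda>p. s * v x p) x = rots L (\<lambda>p. s * v y p) y" by (simp add: s_def v_def)
  have len: "real (length L) > 0" using assms(2) by simp
  have s0: "s \<ge> 0" using assms len by (simp add: s_def)
  have "\<bar>v x p - v y p\<bar> \<le> dist x y / \<rho>" for p
    using steer_lipschitz[OF assms(3,4) cont, of p x y] x y assms(4) by (auto simp: v_def)
  then have "s * \<bar>v x p - v y p\<bar> \<le> s * (dist x y / \<rho>)" for p using s0 by (rule mult_left_mono)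
  then have "\<bar>s * v x p - s * v y p\<bar> \<le> s * (dist x y / \<rho>)" for p
    using s0 by (simp add: abs_mult flip: right_diff_distrib)
  then have A: "dist x y - real (length L) * (s * (dist x y / \<rho>)) \<le> dist (rots L (\<lambda>p. s * v x p) x) (rots L (\<lambda>p. s * v y p) y)"
    using x y by (intro dist_rots_ge[OF planes]) auto
  have B: "real (length L) * (s * (dist x y / \<rho>)) = dist x y / 2" using len assms(4) by (simp add: s_def)
  have "dist x y \<le> 0" using A unfolding B eq by simp
  then show False using ne by simp
qed

section \<open>Definiteness and continuity of the normalization\<close>

lemma integral_sphere_lebesgue_eq_0D:
  fixes f :: "real ^ 'n::finite \<Rightarrow> real"
  assumes f: "continuous_on (sphere 0 1) f" and pos: "\<And>x. norm x = 1 \<Longrightarrow> 0 \<le> f x"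
    and int: "(\<integral>x. f x \<partial>sphere_lebesgue) = 0" and z: "norm z = 1"
  shows "f z = 0"
proof (rule ccontr)
  assume "f z \<noteq> 0"
  then have fz: "f z > 0" using pos[OF z] by simp
  then obtain d where d: "d > 0" "\<And>x. x \<in> sphere 0 1 \<Longrightarrow> dist x z < d \<Longrightarrow> dist (f x) (f z) < f z / 2"
    using f z unfolding continuous_on_iff by (metis half_gt_zero mem_sphere_0)
  define e where "e = min d 1"
  have e: "e > 0" "e \<le> 1" "e \<le> d" using d by (auto simp: e_def)
  let ?A = "sphere 0 1 \<inter> ball z e"
  have "0 < e ^ (CARD('n) - 1) / (2 * 8 ^ CARD('n))" using e by simp
  also have "\<dots> \<le> measure sphere_lebesgue ?A" using e by (intro measure_sphere_cap_ge z) auto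
  finally have "0 < f z / 2 * measure sphere_lebesgue ?A" using fz by simp
  also have "\<dots> = (\<integral>y. f z / 2 * indicator ?A y \<partial>sphere_lebesgue)" by (simp add: Int_absorb2)
  also have "\<dots> \<le> (\<integral>y. f y \<partial>sphere_lebesgue)"
  proof (rule integral_mono)
    show "integrable sphere_lebesgue (\<lambda>y. f z / 2 * indicat_real ?A y)"
      using finite_measure.emeasure_finite[OF finite_measure_sphere_lebesgue]
      by (intro integrable_mult_right integrable_real_indicator) (auto simp: sets_restrict_space_iff less_top)
    show "integrable sphere_lebesgue f" by (rule integrable_sphere_lebesgue[OF f])
    fix y :: "real ^ 'n" assume "y \<in> space sphere_lebesgue"
    then have y: "y \<in> sphere 0 1" by simp
    show "f z / 2 * indicat_real ?A y \<le> f y"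
    proof (cases "y \<in> ?A")
      case True
      then have "dist (f y) (f z) < f z / 2" using e by (intro d(2)) (auto simp: dist_commute)
      then have "f z / 2 \<le> f y" unfolding dist_real_def by linarith
      then show ?thesis using True by simp
    qed (use pos[of y] y in simp)
  qed
  finally show False using int by simp
qed

text \<open>Nearby points are joined by rotations along which the derivative vanishes, so
  \<open>P\<close> is locally constant on a connected sphere.\<close>

lemma constant_if_rot_derivs_vanish:
  fixes P :: "real ^ 'n::finite \<Rightarrow> real"
  assumes L: "distinct L" "set L = {p. fst p \<noteq> snd p}" and card: "CARD('n) \<ge> 2"
    and der: "\<And>p. p \<in> set L \<Longrightarrow> rot_deriv p P (Q p)"
    and Q0: "\<And>p x. p \<in> set L \<Longrightarrow> norm x = 1 \<Longrightarrow> Q p x = 0"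
    and xy: "norm x = 1" "norm y = 1"
  shows "P x = P y"
proof -
  obtain C r0 where r0: "r0 > 0" and reach: "\<And>x y r. norm x = 1 \<Longrightarrow> norm y = 1 \<Longrightarrow> dist x y \<le> r \<Longrightarrow> r \<le> r0 \<Longrightarrow>
      \<exists>\<theta>. (\<forall>p. \<bar>\<theta> p\<bar> \<le> C * r) \<and> rots L \<theta> x = (y :: real ^ 'n)"
    using ex_rots_eq[OF L] by blast
  have local: "P a = P b" if ab: "norm a = 1" "norm b = 1" "dist a b \<le> r0" for a b
  proof -
    obtain \<theta> where \<theta>: "\<And>p. \<bar>\<theta> p\<bar> \<le> C * r0" "rots L \<theta> a = b" using reach[OF ab order.refl] by blast
    have "\<bar>P (rots L \<theta> a) - P a - (\<Sum>p\<leftarrow>L. \<theta> p * 0)\<bar> \<le> C * r0 * (\<Sum>p\<leftarrow>L. 0)"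
      using L der Q0 ab by (intro rots_first_order[where Q = Q, OF _ _ \<theta>(1) _ order.refl]) auto
    then show ?thesis by (simp add: \<theta>(2))
  qed
  show ?thesis
  proof (rule connected_local_const[of "sphere (0 :: real ^ 'n) 1"])
    show "connected (sphere (0 :: real ^ 'n) 1)" using card by (simp add: connected_sphere)
    show "\<forall>a\<in>sphere 0 1. \<forall>\<^sub>F b in at a within sphere 0 1. P a = P b"
    proof
      fix a :: "real ^ 'n" assume a: "a \<in> sphere 0 1"
      show "\<forall>\<^sub>F b in at a within sphere 0 1. P a = P b"
        unfolding eventually_at
      proof (intro exI[of _ r0] conjI ballI impI r0)
        fix b assume "b \<in> sphere 0 1" "b \<noteq> a \<and> dist b a < r0"
        then show "P a = P b" using a by (intro local) (simp_all add: dist_commute)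
      qed
    qed
  qed (use xy in auto)
qed

text \<open>Coefficient vectors are sequences with the product topology, where a bound by finitely
  many coordinates is needed.\<close>

lemma continuous_on_if_coord_lipschitz:
  fixes F :: "(nat \<Rightarrow> real) \<Rightarrow> real"
  assumes "\<And>c c'. \<bar>F c - F c'\<bar> \<le> (\<Sum>i\<le>n. K i * \<bar>c i - c' i\<bar>)"
  shows "continuous_on UNIV F"
proof (rule continuous_at_imp_continuous_on, intro ballI)
  fix c :: "nat \<Rightarrow> real"
  have "continuous_on UNIV (\<lambda>c'. \<Sum>i\<le>n. K i * \<bar>c' i - c i\<bar>)"
    by (intro continuous_intros continuous_on_product_coordinates)
  then have "isCont (\<lambda>c'. \<Sum>i\<le>n. K i * \<bar>c' i - c i\<bar>) c" by (simp add: continuous_on_eq_continuous_at)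
  then have lim: "((\<lambda>c'. \<Sum>i\<le>n. K i * \<bar>c' i - c i\<bar>) \<longlongrightarrow> 0) (at c)" by (simp add: isCont_def)
  have "((\<lambda>c'. F c' - F c) \<longlongrightarrow> 0) (at c)"
    by (rule Lim_null_comparison[OF _ lim]) (auto intro!: always_eventually assms)
  then show "isCont F c" unfolding isCont_def by (rule LIM_zero_cancel)
qed

section \<open>Existence of designs\<close>

text \<open>Monomials are dependent as functions on the sphere, because the squares of the
  coordinates sum to \<open>1\<close>. Linear relations are therefore required only on
  \<open>S\<close>.\<close>

lemma ex_independent_spanning_subset:
  fixes \<phi> :: "'a \<Rightarrow> 'b \<Rightarrow> real"
  assumes "finite A"
  shows "\<exists>B\<subseteq>A. (\<forall>c. (\<forall>x\<in>S. (\<Sum>b\<in>B. c b * \<phi> b x) = 0) \<longrightarrow> (\<forall>b\<in>B. c b = 0)) \<and>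
    (\<forall>a\<in>A. \<exists>c. \<forall>x\<in>S. \<phi> a x = (\<Sum>b\<in>B. c b * \<phi> b x))"
proof -
  define indep where "indep B \<longleftrightarrow> (\<forall>c. (\<forall>x\<in>S. (\<Sum>b\<in>B. c b * \<phi> b x) = 0) \<longrightarrow> (\<forall>b\<in>B. c b = 0))" for B
  define good where "good B \<longleftrightarrow> B \<subseteq> A \<and> indep B" for B
  have "good {}" by (simp add: good_def indep_def)
  moreover have "\<forall>B. good B \<longrightarrow> card B < Suc (card A)"
    using card_mono[OF assms] by (simp add: good_def less_Suc_eq_le)
  ultimately obtain B where "good B" "\<forall>B'. good B' \<longrightarrow> card B' \<le> card B"
    using ex_has_greatest_nat[of good "{}" card] by blast
  then have B: "B \<subseteq> A" "indep B" "\<And>B'. B' \<subseteq> A \<Longrightarrow> indep B' \<Longrightarrow> card B' \<le> card B"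
    by (auto simp: good_def)
  have fin: "finite B" using B(1) assms by (rule finite_subset)
  have "\<exists>c. \<forall>x\<in>S. \<phi> a x = (\<Sum>b\<in>B. c b * \<phi> b x)" if a: "a \<in> A" for a
  proof (cases "a \<in> B")
    case True
    then show ?thesis using fin by (intro exI[of _ "\<lambda>b. if b = a then 1 else 0"]) (simp add: if_distrib if_distribR cong: if_cong)
  next
    case False
    then have "card (insert a B) > card B" using fin by simp
    then have "\<not> indep (insert a B)" using B(3)[of "insert a B"] B(1) a by force
    then obtain c where c: "\<And>x. x \<in> S \<Longrightarrow> (\<Sum>b\<in>insert a B. c b * \<phi> b x) = 0" "\<exists>b\<in>insert a B. c b \<noteq> 0"
      unfolding indep_def by blast
    have ceq: "c a * \<phi> a x + (\<Sum>b\<in>B. c b * \<phi> b x) = 0" if "x \<in> S" for x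
      using c(1)[OF that] fin False by simp
    have "c a \<noteq> 0"
    proof
      assume "c a = 0"
      then have "\<forall>b\<in>B. c b = 0" using B(2) ceq unfolding indep_def by simp
      then show False using c(2) \<open>c a = 0\<close> by auto
    qed
    then have "\<phi> a x = (\<Sum>b\<in>B. (- c b / c a) * \<phi> b x)" if "x \<in> S" for x
    proof -
      have "(\<Sum>b\<in>B. (- c b / c a) * \<phi> b x) = (- 1 / c a) * (\<Sum>b\<in>B. c b * \<phi> b x)"
        by (simp add: sum_distrib_left)
      also have "(\<Sum>b\<in>B. c b * \<phi> b x) = - (c a * \<phi> a x)" using ceq[OF that] by linarith
      finally show ?thesis using \<open>c a \<noteq> 0\<close> by simp
    qed
    then show ?thesis by (intro exI[of _ "\<lambda>b. - c b / c a"] ballI)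
  qed
  then show ?thesis using B(1,2) unfolding indep_def by (intro exI[of _ B] conjI ballI) assumption+
qed

text \<open>The unknown is the coefficient vector \<open>c\<close>, and \<open>f c\<close> lists the
  sums of the basis functions over the points moved according to \<open>P c\<close>. Pairing
  \<open>f c\<close> with \<open>c\<close> gives the sum of \<open>P c\<close> over these points, so
  outwardness is the positivity already proved, and a zero of \<open>f\<close> makes all mean zero
  polynomials sum to zero.\<close>

lemma ex_spherical_design:
  fixes L :: "'n::finite plane list" and T :: "(real ^ 'n \<Rightarrow> real) \<Rightarrow> real ^ 'n \<Rightarrow> real" and X :: "(real ^ 'n) set"
  assumes L: "distinct L" "set L = {p. fst p \<noteq> snd p}" "L \<noteq> []" and card: "CARD('n) \<ge> 2"
    and C: "C \<ge> 1" and r: "r > 0" and N: "N > 0"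
    and reach: "\<And>x y h. norm x = 1 \<Longrightarrow> norm y = 1 \<Longrightarrow> dist x y \<le> h \<Longrightarrow> h \<le> r \<Longrightarrow>
      \<exists>\<theta>. (\<forall>p. \<bar>\<theta> p\<bar> \<le> C * h) \<and> rots L \<theta> x = (y :: real ^ 'n)"
    and Tc: "\<And>f. continuous_on UNIV f \<Longrightarrow> continuous_on UNIV (T f)"
    and Tint: "\<And>f. continuous_on UNIV f \<Longrightarrow> (\<integral>x. T f x \<partial>sphere_lebesgue) \<le> 1 / 8 * (\<integral>x. \<bar>f x\<bar> \<partial>sphere_lebesgue)"
    and Tdom: "\<And>f x y. poly_le t f \<Longrightarrow> norm x = 1 \<Longrightarrow> norm y = 1 \<Longrightarrow> dist y x \<le> r \<Longrightarrow> \<bar>f y - f x\<bar> \<le> T f x"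
    and X: "X \<subseteq> sphere 0 1" "finite X" "card X = N"
    and equi: "\<And>F H. continuous_on (sphere 0 1) H \<Longrightarrow>
      (\<And>x y. x \<in> X \<Longrightarrow> norm y = 1 \<Longrightarrow> dist x y \<le> r / 4 / (2 * real (length L)) / (8 * C) \<Longrightarrow> H y \<le> F x) \<Longrightarrow>
      real N * (\<integral>y. H y \<partial>sphere_lebesgue) \<le> (\<Sum>x\<in>X. F x)"
  shows "\<exists>Y :: (real ^ 'n) set. spherical_design t Y \<and> card Y = N"
proof -
  let ?S = "sphere (0 :: real ^ 'n) 1"
  define A where "A = {a :: 'n \<Rightarrow> nat. (\<Sum>i\<in>UNIV. a i) \<le> t}"
  define mono where "mono a x = (\<Prod>i\<in>UNIV. x $ i ^ a i)" for a :: "'n \<Rightarrow> nat" and x :: "real ^ 'n"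
  define tilde where "tilde a x = - (\<integral>x. mono a x \<partial>sphere_lebesgue) + mono a x" for a x
  have finA: "finite A" unfolding A_def by (rule finite_exponents_le)
  have mono_poly: "poly_le t (mono a)" if "a \<in> A" for a
    using poly_le_mono[OF _ poly_le_monomial[of a], of t] that by (simp add: A_def mono_def[abs_def])
  have tilde_poly: "poly_le t (tilde a)" if "a \<in> A" for a
    unfolding tilde_def[abs_def] by (intro poly_le.add poly_le.const mono_poly that)
  have polyc: "continuous_on D f" if "poly_le t f" for f and D :: "(real ^ 'n) set"
    using that by (rule poly_le_continuous)
  have tilde_int: "(\<integral>x. tilde a x \<partial>sphere_lebesgue) = 0" if "a \<in> A" for a
  proof -
    have "(\<integral>x. tilde a x \<partial>sphere_lebesgue) = (\<integral>x. - (\<integral>x. mono a x \<partial>sphere_lebesgue) \<partial>(sphere_lebesgue :: (real ^ 'n) measure)) + (\<integral>x. mono a x \<partial>sphere_lebesgue)"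
      unfolding tilde_def by (intro Bochner_Integration.integral_add integrable_sphere_lebesgue polyc[OF mono_poly[OF that]] continuous_intros)
    then show ?thesis by (simp only: integral_sphere_lebesgue_const)
  qed
  have design: "\<exists>Y :: (real ^ 'n) set. spherical_design t Y \<and> card Y = N"
    if Y: "Y \<subseteq> ?S" "finite Y" "card Y = N" and zero: "\<And>a. a \<in> A \<Longrightarrow> (\<Sum>y\<in>Y. tilde a y) = 0" for Y
  proof -
    have mono_sum: "(\<Sum>y\<in>Y. mono a y) = real N * (\<integral>x. mono a x \<partial>sphere_lebesgue)" if "a \<in> A" for a
      using zero[OF that] Y(3) by (simp add: tilde_def sum_subtractf sum.distrib)
    have "(\<integral>x. P x \<partial>sphere_lebesgue) = (\<Sum>x\<in>Y. P x) / real (card Y)" if poly: "polynomial_of_degree_le t P" for P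
    proof -
      obtain c where P: "P = (\<lambda>x. \<Sum>a\<in>A. c a * mono a x)"
        using poly unfolding polynomial_of_degree_le_def A_def mono_def by blast
      have "(\<integral>x. P x \<partial>sphere_lebesgue) = (\<Sum>a\<in>A. c a * (\<integral>x. mono a x \<partial>sphere_lebesgue))"
        unfolding P by (subst Bochner_Integration.integral_sum)
          (auto intro!: integrable_mult_right integrable_sphere_lebesgue polyc mono_poly)
      moreover have "(\<Sum>x\<in>Y. P x) = (\<Sum>a\<in>A. c a * (\<Sum>x\<in>Y. mono a x))"
        unfolding P by (subst sum.swap) (simp add: sum_distrib_left)
      ultimately show ?thesis using N Y(3) by (simp add: mono_sum sum_divide_distrib mult.left_commute flip: sum_distrib_left)
    qed
    moreover have "Y \<noteq> {}" using Y(3) N by auto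
    ultimately show ?thesis using Y unfolding spherical_design_def by blast
  qed
  obtain B where B': "B \<subseteq> A" "\<forall>c. (\<forall>x\<in>?S. (\<Sum>b\<in>B. c b * tilde b x) = 0) \<longrightarrow> (\<forall>b\<in>B. c b = 0)"
    "\<forall>a\<in>A. \<exists>c. \<forall>x\<in>?S. tilde a x = (\<Sum>b\<in>B. c b * tilde b x)"
    using ex_independent_spanning_subset[OF finA, of ?S tilde] by (elim exE conjE) (rule that)
  note B = B'(1) B'(2)[THEN spec, THEN mp, OF ballI] B'(3)[THEN bspec]
  have finB: "finite B" using B(1) finA by (rule finite_subset)
  show ?thesis
  proof (cases "B = {}")
    \<comment> \<open>All mean zero monomials vanish on the sphere, so any \<open>X\<close> will do;
      the zero argument needs at least one coordinate.\<close>
    case True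
    have "(\<Sum>y\<in>X. tilde a y) = 0" if "a \<in> A" for a
      using B(3)[OF that] X(1) True by (intro sum.neutral) auto
    then show ?thesis using X by (intro design)
  next
    case False
    then obtain n where "card B = Suc n" using finB by (metis card_eq_0_iff not0_implies_Suc)
    then obtain e where e: "bij_betw e {..n} B"
      using ex_bij_betw_nat_finite[OF finB] by (auto simp: atLeast0LessThan lessThan_Suc_atMost)
    have eA: "e i \<in> A" if "i \<le> n" for i using e B(1) that by (auto simp: bij_betw_def)
    have "\<forall>i p. \<exists>f'. i \<le> n \<longrightarrow> p \<in> set L \<longrightarrow> poly_le t f' \<and> rot_deriv p (tilde (e i)) f'"
      using ex_rot_deriv[OF _ tilde_poly[OF eA]] L(2) by blast
    \<comment> \<open>Derivatives are chosen once for the basis, which makes \<open>Q c\<close>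
      linear in \<open>c\<close>.\<close>
    then obtain D where D: "\<And>i p. i \<le> n \<Longrightarrow> p \<in> set L \<Longrightarrow> poly_le t (D i p) \<and> rot_deriv p (tilde (e i)) (D i p)"
      by metis
    define P where "P c x = (\<Sum>i\<le>n. c i * tilde (e i) x)" for c :: "nat \<Rightarrow> real" and x
    define Q where "Q c p x = (\<Sum>i\<le>n. c i * D i p x)" for c :: "nat \<Rightarrow> real" and p x
    have Ppoly: "poly_le t (P c)" for c unfolding P_def by (intro poly_le_sum poly_le_scale tilde_poly eA) auto
    have Qpoly: "poly_le t (Q c p)" if "p \<in> set L" for c p unfolding Q_def using D that by (intro poly_le_sum poly_le_scale) auto
    have der: "rot_deriv p (P c) (Q c p)" if "p \<in> set L" for c p
      unfolding rot_deriv_def P_def Q_def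
    proof (intro allI DERIV_sum DERIV_cmult)
      fix x \<theta> i assume "i \<in> {..n}"
      then show "((\<lambda>\<theta>. tilde (e i) (rot p \<theta> x)) has_real_derivative D i p (rot p \<theta> x)) (at \<theta>)"
        using D[of i p] that by (simp add: rot_deriv_def)
    qed
    have Pint: "(\<integral>x. P c x \<partial>sphere_lebesgue) = 0" for c
      unfolding P_def by (subst Bochner_Integration.integral_sum)
        (auto intro!: integrable_mult_right integrable_sphere_lebesgue polyc tilde_poly eA simp: tilde_int eA)
    define g where "g c = (\<integral>x. (\<Sum>p\<in>set L. \<bar>Q c p x\<bar>) \<partial>sphere_lebesgue)" for c
    define m where "m = real (length L)"
    define \<rho> where "\<rho> = r / 4"
    define \<epsilon> where "\<epsilon> = 1 / (8 * m)"
    have m: "m \<ge> 1" using L(3) by (cases L) (auto simp: m_def)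
    have \<rho>: "\<rho> > 0" using r by (simp add: \<rho>_def)
    have \<epsilon>: "\<epsilon> > 0" using m by (simp add: \<epsilon>_def)
    \<comment> \<open>Continuity in \<open>c\<close> is needed for all coefficient vectors,
      positivity only where \<open>g c = 1\<close>.\<close>
    define \<Phi> where "\<Phi> c x = rots L (\<lambda>p. \<rho> / (2 * m) * (if p \<in> set L then steer \<epsilon> \<rho> (Q c p) x else 0)) x" for c x
    define f where "f c i = (\<Sum>x\<in>X. tilde (e i) (\<Phi> c x))" for c i
    have Qdiff: "\<bar>Q c p x - Q c' p x\<bar> \<le> (\<Sum>i\<le>n. \<bar>D i p x\<bar> * \<bar>c i - c' i\<bar>)" for c c' p x
    proof -
      have "Q c p x - Q c' p x = (\<Sum>i\<le>n. D i p x * (c i - c' i))"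
        unfolding Q_def by (simp add: algebra_simps flip: sum_subtractf)
      then show ?thesis using sum_abs[of "\<lambda>i. D i p x * (c i - c' i)" "{..n}"] by (simp add: abs_mult)
    qed
    have steerc: "continuous_on UNIV (\<lambda>c. steer \<epsilon> \<rho> (Q c p) x)" if p: "p \<in> set L" and x: "norm x = 1" for p x
    proof -
      have "\<exists>K. \<forall>y\<in>?S. \<bar>D i p y\<bar> \<le> K" if "i \<le> n" for i
      proof -
        have "bounded (D i p ` ?S)"
          by (intro compact_imp_bounded compact_continuous_image compact_sphere polyc) (use D that p in blast)
        then show ?thesis unfolding bounded_iff by auto
      qed
      then obtain K where K: "\<And>i y. i \<le> n \<Longrightarrow> norm y = 1 \<Longrightarrow> \<bar>D i p y\<bar> \<le> K i" by (metis mem_sphere_0)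
      show ?thesis
      proof (rule continuous_on_if_coord_lipschitz)
        fix c c' :: "nat \<Rightarrow> real"
        have "\<bar>steer \<epsilon> \<rho> (Q c p) x - steer \<epsilon> \<rho> (Q c' p) x\<bar> \<le> (\<Sum>i\<le>n. K i * \<bar>c i - c' i\<bar>) / \<epsilon>"
        proof (rule steer_stable[OF \<epsilon> \<rho> polyc[OF Qpoly[OF p]] polyc[OF Qpoly[OF p]] x])
          fix y :: "real ^ 'n" assume y: "norm y = 1"
          show "\<bar>Q c p y - Q c' p y\<bar> \<le> (\<Sum>i\<le>n. K i * \<bar>c i - c' i\<bar>)"
            using K[OF _ y] by (intro order.trans[OF Qdiff] sum_mono mult_right_mono) auto
        qed
        then show "\<bar>steer \<epsilon> \<rho> (Q c p) x - steer \<epsilon> \<rho> (Q c' p) x\<bar> \<le> (\<Sum>i\<le>n. K i / \<epsilon> * \<bar>c i - c' i\<bar>)"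
          by (simp add: sum_divide_distrib)
      qed
    qed
    have Phic: "continuous_on UNIV (\<lambda>c. \<Phi> c x)" if "norm x = 1" for x
      unfolding \<Phi>_def
    proof (intro continuous_on_rots continuous_on_mult continuous_on_const)
      fix p show "continuous_on UNIV (\<lambda>c. if p \<in> set L then steer \<epsilon> \<rho> (Q c p) x else 0)"
        using steerc[OF _ that] by (cases "p \<in> set L") auto
    qed
    have fc: "continuous_on UNIV (\<lambda>c. f c i)" if "i \<le> n" for i
      unfolding f_def
    proof (intro continuous_on_sum)
      fix x assume "x \<in> X"
      then have "norm x = 1" using X(1) by auto
      then show "continuous_on UNIV (\<lambda>c. tilde (e i) (\<Phi> c x))"
        by (intro continuous_on_compose2[OF polyc[OF tilde_poly[OF eA[OF that]], of UNIV] Phic]) auto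
    qed
    have Qabsc: "continuous_on ?S (\<lambda>x. \<Sum>p\<in>set L. \<bar>Q c p x\<bar>)" for c
      by (intro continuous_intros polyc Qpoly)
    have gc: "continuous_on UNIV g"
    proof (rule continuous_on_if_coord_lipschitz)
      fix c c' :: "nat \<Rightarrow> real"
      have Dc: "continuous_on ?S (\<lambda>x. \<Sum>p\<in>set L. \<bar>D i p x\<bar>)" if "i \<le> n" for i
        using D that by (intro continuous_on_sum continuous_on_rabs polyc) auto
      have "\<bar>g c - g c'\<bar> = \<bar>\<integral>x. (\<Sum>p\<in>set L. \<bar>Q c p x\<bar>) - (\<Sum>p\<in>set L. \<bar>Q c' p x\<bar>) \<partial>sphere_lebesgue\<bar>"
        unfolding g_def by (subst Bochner_Integration.integral_diff) (auto intro!: integrable_sphere_lebesgue Qabsc)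
      also have "\<dots> \<le> (\<integral>x. \<bar>(\<Sum>p\<in>set L. \<bar>Q c p x\<bar>) - (\<Sum>p\<in>set L. \<bar>Q c' p x\<bar>)\<bar> \<partial>sphere_lebesgue)"
        by (rule integral_abs_bound)
      also have "\<dots> \<le> (\<integral>x. (\<Sum>i\<le>n. (\<Sum>p\<in>set L. \<bar>D i p x\<bar>) * \<bar>c i - c' i\<bar>) \<partial>sphere_lebesgue)"
      proof (rule integral_sphere_lebesgue_mono)
        fix x :: "real ^ 'n"
        have "\<bar>(\<Sum>p\<in>set L. \<bar>Q c p x\<bar>) - (\<Sum>p\<in>set L. \<bar>Q c' p x\<bar>)\<bar> \<le> (\<Sum>p\<in>set L. \<bar>Q c p x - Q c' p x\<bar>)"
          unfolding sum_subtractf[symmetric] by (intro order.trans[OF sum_abs] sum_mono abs_triangle_ineq3)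
        also have "\<dots> \<le> (\<Sum>p\<in>set L. \<Sum>i\<le>n. \<bar>D i p x\<bar> * \<bar>c i - c' i\<bar>)" by (intro sum_mono Qdiff)
        also have "\<dots> = (\<Sum>i\<le>n. (\<Sum>p\<in>set L. \<bar>D i p x\<bar>) * \<bar>c i - c' i\<bar>)"
          by (subst sum.swap) (simp add: sum_distrib_right)
        finally show "\<bar>(\<Sum>p\<in>set L. \<bar>Q c p x\<bar>) - (\<Sum>p\<in>set L. \<bar>Q c' p x\<bar>)\<bar> \<le> (\<Sum>i\<le>n. (\<Sum>p\<in>set L. \<bar>D i p x\<bar>) * \<bar>c i - c' i\<bar>)" .
      qed (auto intro!: continuous_on_sum continuous_on_mult continuous_on_rabs continuous_on_diff Qabsc Dc)
      also have "\<dots> = (\<Sum>i\<le>n. (\<integral>x. (\<Sum>p\<in>set L. \<bar>D i p x\<bar>) \<partial>sphere_lebesgue) * \<bar>c i - c' i\<bar>)"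
        by (subst Bochner_Integration.integral_sum) (auto intro!: integrable_mult_left integrable_sphere_lebesgue Dc)
      finally show "\<bar>g c - g c'\<bar> \<le> (\<Sum>i\<le>n. (\<integral>x. (\<Sum>p\<in>set L. \<bar>D i p x\<bar>) \<partial>sphere_lebesgue) * \<bar>c i - c' i\<bar>)" .
    qed
    have hom: "g (\<lambda>i. k * c i) = k * g c" if "k \<ge> 0" for k c
    proof -
      have "Q (\<lambda>i. k * c i) p x = k * Q c p x" for p x by (simp add: Q_def sum_distrib_left mult.assoc)
      then have "(\<Sum>p\<in>set L. \<bar>Q (\<lambda>i. k * c i) p x\<bar>) = k * (\<Sum>p\<in>set L. \<bar>Q c p x\<bar>)" for x
        using that by (simp add: abs_mult sum_distrib_left)
      then show ?thesis by (simp add: g_def)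
    qed
    have g0: "g c \<ge> 0" for c unfolding g_def by (intro Bochner_Integration.integral_nonneg) (simp add: sum_nonneg)
    \<comment> \<open>If all derivatives vanish, \<open>P c\<close> is constant on the sphere, hence
      zero by its mean, and independence of the basis gives \<open>c = 0\<close>.\<close>
    have gpos: "g c > 0" if "\<exists>i\<le>n. c i \<noteq> 0" for c
    proof (rule ccontr)
      assume "\<not> g c > 0"
      then have "g c = 0" using g0[of c] by simp
      have Q0: "Q c p x = 0" if "p \<in> set L" "norm x = 1" for p x
      proof -
        have "(\<Sum>p\<in>set L. \<bar>Q c p x\<bar>) = 0"
          using \<open>g c = 0\<close> that unfolding g_def by (intro integral_sphere_lebesgue_eq_0D[OF Qabsc]) (auto simp: sum_nonneg)
        then show ?thesis using that by (simp add: sum_nonneg_eq_0_iff)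
      qed
      define z :: "real ^ 'n" where "z = axis undefined 1"
      have z: "norm z = 1" by (simp add: z_def)
      have const: "P c x = P c z" if "norm x = 1" for x
        by (rule constant_if_rot_derivs_vanish[OF L(1,2) card der Q0 that z])
      have "(\<integral>x. P c x \<partial>sphere_lebesgue) = (\<integral>x. P c z \<partial>(sphere_lebesgue :: (real ^ 'n) measure))"
        by (intro Bochner_Integration.integral_cong refl) (simp add: const)
      then have "P c z = 0" using Pint[of c] by (simp only: integral_sphere_lebesgue_const)
      have "(\<Sum>b\<in>B. c (inv_into {..n} e b) * tilde b x) = 0" if "x \<in> ?S" for x
      proof -
        have "(\<Sum>b\<in>B. c (inv_into {..n} e b) * tilde b x) = (\<Sum>i\<le>n. c (inv_into {..n} e (e i)) * tilde (e i) x)"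
          by (rule sum.reindex_bij_betw[OF e, symmetric])
        also have "\<dots> = P c x" unfolding P_def
          using bij_betw_inv_into_left[OF e] by (intro sum.cong) auto
        finally show ?thesis using const[of x] that \<open>P c z = 0\<close> by simp
      qed
      from B(2)[OF this] have "c (inv_into {..n} e (e i)) = 0" if "i \<le> n" for i
        using e that by (auto simp: bij_betw_def)
      then have "c i = 0" if "i \<le> n" for i using bij_betw_inv_into_left[OF e, of i] that by (metis atMost_iff)
      then show False using that by blast
    qed
    have outward: "(\<Sum>i\<le>n. c i * f c i) > 0" if gc1: "g c = 1" for c
    proof -
      have "(\<integral>x. (\<Sum>p\<in>set L. T (Q c p) x) \<partial>sphere_lebesgue) = (\<Sum>p\<in>set L. \<integral>x. T (Q c p) x \<partial>sphere_lebesgue)"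
        by (intro Bochner_Integration.integral_sum integrable_sphere_lebesgue continuous_on_subset[OF Tc] polyc Qpoly) auto
      also have "\<dots> \<le> (\<Sum>p\<in>set L. 1 / 8 * (\<integral>x. \<bar>Q c p x\<bar> \<partial>sphere_lebesgue))"
        by (intro sum_mono Tint polyc Qpoly)
      also have "\<dots> = 1 / 8 * (\<Sum>p\<in>set L. (\<integral>x. \<bar>Q c p x\<bar> \<partial>sphere_lebesgue))" by (simp only: sum_distrib_left)
      also have "(\<Sum>p\<in>set L. (\<integral>x. \<bar>Q c p x\<bar> \<partial>sphere_lebesgue)) = g c"
        unfolding g_def by (intro Bochner_Integration.integral_sum[symmetric] integrable_sphere_lebesgue continuous_on_rabs polyc Qpoly)
      finally have intT: "(\<integral>x. (\<Sum>p\<in>set L. T (Q c p) x) \<partial>sphere_lebesgue) \<le> 1 / 8" using gc1 by simp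
      have "0 < (\<Sum>x\<in>X. P c (\<Phi> c x))"
        unfolding \<Phi>_def m_def \<rho>_def \<epsilon>_def
      proof (rule sum_at_moved_points_pos[OF L C r reach, where Q = "Q c" and W = "\<lambda>p. T (Q c p)" and N = N])
        show "\<bar>Q c p y - Q c p x\<bar> \<le> T (Q c p) x"
          if "p \<in> set L" "norm x = 1" "norm y = 1" "dist y x \<le> r" for p x y
          by (rule Tdom[OF Qpoly[OF that(1)] that(2-4)])
        show "continuous_on ?S (T (Q c p))" if "p \<in> set L" for p
          by (rule continuous_on_subset[OF Tc[OF polyc[OF Qpoly[OF that]]]]) simp
        show "(\<integral>x. (\<Sum>p\<in>set L. \<bar>Q c p x\<bar>) \<partial>sphere_lebesgue) = 1" using gc1 by (simp add: g_def)
        show "real N * (\<integral>y. H y \<partial>sphere_lebesgue) \<le> (\<Sum>x\<in>X. F x)"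
          if "continuous_on ?S H" "\<And>x y. x \<in> X \<Longrightarrow> norm y = 1 \<Longrightarrow>
            dist x y \<le> r / 4 / (2 * real (length L)) / (8 * C) \<Longrightarrow> H y \<le> F x" for F H
          by (rule equi[OF that])
      qed (assumption | rule der polyc Ppoly Qpoly Pint intT N X(1))+
      also have "\<dots> = (\<Sum>i\<le>n. c i * f c i)"
        unfolding P_def f_def by (subst sum.swap) (simp add: sum_distrib_left)
      finally show ?thesis .
    qed
    obtain c where c: "\<And>i. i \<le> n \<Longrightarrow> f c i = 0"
      using exists_zero_if_outward_on_sphere[of n f g, OF fc gc hom gpos outward] by blast
    \<comment> \<open>Keeps the number of points at \<open>N\<close>, and lets sums over the image
      be sums over \<open>X\<close>.\<close>
    have inj: "inj_on (\<Phi> c) ?S"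
      unfolding \<Phi>_def m_def using L \<epsilon> \<rho> by (intro inj_on_moved_points polyc Qpoly) auto
    then have injX: "inj_on (\<Phi> c) X" using X(1) by (rule inj_on_subset)
    show ?thesis
    proof (rule design)
      show "\<Phi> c ` X \<subseteq> ?S"
      proof
        fix y assume "y \<in> \<Phi> c ` X"
        then obtain x where "x \<in> X" "y = \<Phi> c x" by blast
        then show "y \<in> ?S" using X(1) L by (auto simp: \<Phi>_def norm_rots)
      qed
      then have sub: "\<Phi> c ` X \<subseteq> ?S" .
      show "finite (\<Phi> c ` X)" "card (\<Phi> c ` X) = N" using X injX by (auto simp: card_image)
      fix a assume "a \<in> A"
      then obtain k where k: "\<forall>x\<in>?S. tilde a x = (\<Sum>b\<in>B. k b * tilde b x)" using B(3) by blast
      have "(\<Sum>y\<in>\<Phi> c ` X. tilde a y) = (\<Sum>y\<in>\<Phi> c ` X. \<Sum>b\<in>B. k b * tilde b y)"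
        using k sub by (intro sum.cong) auto
      also have "\<dots> = (\<Sum>b\<in>B. k b * (\<Sum>y\<in>\<Phi> c ` X. tilde b y))"
        by (subst sum.swap) (simp add: sum_distrib_left)
      also have "\<dots> = (\<Sum>i\<le>n. k (e i) * (\<Sum>y\<in>\<Phi> c ` X. tilde (e i) y))"
        by (rule sum.reindex_bij_betw[OF e, symmetric])
      also have "\<dots> = 0" using c by (simp add: sum.reindex[OF injX] f_def)
      finally show "(\<Sum>y\<in>\<Phi> c ` X. tilde a y) = 0" .
    qed
  qed
qed

theorem theorem1:
  fixes d :: nat
  assumes "d \<ge> 1" and "CARD('n::finite) = d + 1"
  shows "\<exists>C :: real. C > 0 \<and>
    (\<forall>t N :: nat. t \<ge> 1 \<longrightarrow> real N \<ge> C * real t ^ d \<longrightarrow>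
      (\<exists>X :: (real ^ 'n) set. spherical_design t X \<and> card X = N))"
proof -
  have card: "CARD('n) \<ge> 2" using assms by simp
  obtain L :: "'n plane list" where L: "set L = {p. fst p \<noteq> snd p}" "distinct L"
    using finite_distinct_list[of "{p :: 'n plane. fst p \<noteq> snd p}"] by auto
  have "L \<noteq> []"
  proof
    assume "L = []"
    then have "a = b" for a b :: 'n using L(1) by (metis (mono_tags) empty_iff fst_conv list.set(1) mem_Collect_eq snd_conv)
    then have "CARD('n) \<le> 1" by (metis card_le_Suc0_iff_eq One_nat_def finite)
    then show False using card by simp
  qed
  define m where "m = real (length L)"
  have m: "m \<ge> 1" using \<open>L \<noteq> []\<close> by (cases L) (auto simp: m_def)
  obtain C r0 where C: "C \<ge> 1" and r0: "r0 > 0" and reach: "\<And>x y r. norm x = 1 \<Longrightarrow> norm y = 1 \<Longrightarrow> dist x y \<le> r \<Longrightarrow> r \<le> r0 \<Longrightarrow>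
      \<exists>\<theta>. (\<forall>p. \<bar>\<theta> p\<bar> \<le> C * r) \<and> rots L \<theta> x = (y :: real ^ 'n)"
    using ex_rots_eq[OF L(2,1)] by blast
  \<comment> \<open>Makes the exponent \<open>2 * c1 * m * C\<close> of the oscillation bound at
    most \<open>1 / 20\<close>, so that its mass is below \<open>1 / 8\<close>.\<close>
  define c1 where "c1 = min r0 (1 / (40 * m * C))"
  have c1: "c1 > 0" "c1 \<le> r0" using r0 m C by (auto simp: c1_def)
  have "m * C \<ge> 1 * 1" using m C by (intro mult_mono) auto
  then have mC: "m * C \<ge> 1" by simp
  have c1': "c1 * (40 * m * C) \<le> 1"
  proof -
    have "c1 * (40 * m * C) \<le> 1 / (40 * m * C) * (40 * m * C)" using m C by (intro mult_right_mono) (auto simp: c1_def)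
    also have "\<dots> = 1" using m C by simp
    finally show ?thesis .
  qed
  \<comment> \<open>Chosen such that \<open>4 * \<delta>\<close> is the distance \<open>h\<close> in
    the budget: \<open>256 = 4 * (4 * 2 * 8)\<close>.\<close>
  define c2 where "c2 = c1 / (256 * m * C)"
  have c2: "c2 > 0" using c1 mC by (simp add: c2_def mult.assoc)
  \<comment> \<open>The reciprocal of the lower bound for the mass of a node at
    \<open>\<delta> = c2 / t\<close>, freed of its factor \<open>t ^ d\<close>.\<close>
  define K where "K = 4 * 8 ^ CARD('n) * (4 / c2) ^ d"
  have K: "K > 0" using c2 by (simp add: K_def)
  have "\<exists>X :: (real ^ 'n) set. spherical_design t X \<and> card X = N" if t: "t \<ge> 1" and N: "real N \<ge> K * real t ^ d" for t N
  proof -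
    have t0: "real t > 0" "real t \<ge> 1" using t by auto
    have N0: "N > 0" using N K t0 by (metis gr0I mult_pos_pos not_le of_nat_0 zero_less_power)
    define r where "r = c1 / real t"
    have r: "r > 0" using c1 t0 by (simp add: r_def)
    have "r \<le> c1 / 1" unfolding r_def using t0 c1 by (intro divide_left_mono) auto
    then have r_le: "r \<le> r0" using c1 by simp
    have Cr: "C * r \<ge> 0" using C r by simp
    obtain T where T: "\<And>f. continuous_on UNIV f \<Longrightarrow> continuous_on UNIV (T f)" "\<And>f x. continuous_on UNIV f \<Longrightarrow> 0 \<le> T f x"
      "\<And>f. continuous_on UNIV f \<Longrightarrow> (\<integral>x. T f x \<partial>sphere_lebesgue) \<le>
          (exp (2 * real t * (C * r) * real (length L)) - 1) * (\<integral>x. \<bar>f x\<bar> \<partial>sphere_lebesgue)"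
      "\<And>f x \<theta>. poly_le t f \<Longrightarrow> \<forall>p. \<bar>\<theta> p\<bar> \<le> C * r \<Longrightarrow> \<bar>f (rots L \<theta> x) - f x\<bar> \<le> T f x"
      using ex_oscillation_operator[OF t Cr, of L] L(1) by blast
    have kap: "exp (2 * real t * (C * r) * real (length L)) - 1 \<le> 1 / 8"
    proof -
      define u where "u = 2 * real t * (C * r) * real (length L)"
      \<comment> \<open>Degree times radius is constant: \<open>t\<close> cancels, so one constant
        serves all degrees.\<close>
      have u: "u = 2 * (c1 * (m * C))" using t0 by (simp add: u_def r_def m_def)
      have u0: "0 \<le> u" "u \<le> 1 / 20" using c1' c1 m C unfolding u by (simp_all add: mult_ac)
      have "exp u \<le> 1 + u + u\<^sup>2" using u0 by (intro exp_bound) auto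
      also have "u\<^sup>2 \<le> (1 / 20)\<^sup>2" using u0 by (intro power_mono)
      finally have "exp u \<le> 1 + u + (1 / 20)\<^sup>2" by simp
      then show ?thesis using u0 unfolding u_def[symmetric] by (simp add: power2_eq_square)
    qed
    define \<delta> where "\<delta> = c2 / real t"
    have \<delta>0: "\<delta> > 0" using c2 t0 by (simp add: \<delta>_def)
    have \<delta>1: "\<delta> \<le> 1"
    proof -
      have "1 \<le> 40 * m * C" using mC by (simp add: mult.assoc)
      then have "c1 * 1 \<le> c1 * (40 * m * C)" using c1 by (intro mult_left_mono) auto
      then have "c1 \<le> 1" using c1' by linarith
      then have "c2 \<le> 1" using mC unfolding c2_def by (simp add: mult.assoc divide_le_eq)
      then show ?thesis using t0 by (simp add: \<delta>_def divide_le_eq)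
    qed
    have four: "4 * \<delta> = r / 4 / (2 * real (length L)) / (8 * C)"
      using m C t0 by (simp add: \<delta>_def c2_def r_def m_def field_simps)
    have "1 \<le> real N * ((\<delta> / 4) ^ (CARD('n) - 1) / (4 * 8 ^ CARD('n)))"
    proof -
      have "1 = (4 / c2) ^ d * (c2 / 4) ^ d" using c2 by (simp only: power_mult_distrib[symmetric]) simp
      also have "\<dots> = K * real t ^ d * ((\<delta> / 4) ^ d / (4 * 8 ^ CARD('n)))"
      proof -
        have "(\<delta> / 4) ^ d = (c2 / 4) ^ d / real t ^ d" by (simp add: \<delta>_def power_divide)
        then show ?thesis using t0 by (simp add: K_def)
      qed
      also have "\<dots> \<le> real N * ((\<delta> / 4) ^ d / (4 * 8 ^ CARD('n)))"
        using N \<delta>0 by (intro mult_right_mono) auto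
      finally show ?thesis using assms(2) by simp
    qed
    from ex_equidistributed_points[OF card \<delta>0 \<delta>1 this] obtain X :: "(real ^ 'n) set" where
      X: "X \<subseteq> sphere 0 1" "finite X" "card X = N"
      and equi: "\<forall>F H. continuous_on (sphere 0 1) H \<longrightarrow>
       (\<forall>x\<in>X. \<forall>y. norm y = 1 \<longrightarrow> dist x y \<le> 4 * \<delta> \<longrightarrow> H y \<le> F x) \<longrightarrow>
       real N * (\<integral>y. H y \<partial>sphere_lebesgue) \<le> (\<Sum>x\<in>X. F x)"
      by (elim exE conjE)
    show ?thesis
    proof (rule ex_spherical_design[OF L(2,1) \<open>L \<noteq> []\<close> card C r N0 _ T(1) _ _ X])
      show "\<exists>\<theta>. (\<forall>p. \<bar>\<theta> p\<bar> \<le> C * h) \<and> rots L \<theta> x = y" if "norm x = 1" "norm y = 1" "dist x y \<le> h" "h \<le> r" for x y :: "real ^ 'n" and h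
        using reach[OF that(1-3)] that(4) r_le by simp
      show "(\<integral>x. T f x \<partial>sphere_lebesgue) \<le> 1 / 8 * (\<integral>x. \<bar>f x\<bar> \<partial>sphere_lebesgue)" if "continuous_on UNIV f" for f
        by (rule order.trans[OF T(3)[OF that] mult_right_mono[OF kap]]) simp
      show "\<bar>f y - f x\<bar> \<le> T f x" if f: "poly_le t f" and xy: "norm x = 1" "norm y = 1" "dist y x \<le> r" for f x y
      proof -
        obtain \<theta> where "\<forall>p. \<bar>\<theta> p\<bar> \<le> C * r" "rots L \<theta> x = y"
          using reach[OF xy(1,2), of r] xy(3) r_le by (auto simp: dist_commute)
        then show ?thesis using T(4)[OF f, of \<theta> x] by simp
      qed
      show "real N * (\<integral>y. H y \<partial>sphere_lebesgue) \<le> (\<Sum>x\<in>X. F x)"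
        if "continuous_on (sphere 0 1) H" "\<And>x y. x \<in> X \<Longrightarrow> norm y = 1 \<Longrightarrow> dist x y \<le> r / 4 / (2 * real (length L)) / (8 * C) \<Longrightarrow> H y \<le> F x" for F H
        using equi that unfolding four by blast
    qed
  qed
  then show ?thesis using K by blast
qed

end
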